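(* Let $p<n$ be positive integers, let $\alpha_0,\alpha_1>0$, $\alpha=\alpha_1/\alpha_0$, and equip the Stiefel manifold $\mathrm{St}_{p,n}=\{Y\in\mathbb{R}^{n\times p}: Y^{\mathsf T}Y=I_p\}$ with the Riemannian metric $$\langle\xi,\eta\rangle_{\mathsf g}=\alpha_0\operatorname{Tr}(\xi^{\mathsf T}\eta)+(\alpha_1-\alpha_0)\operatorname{Tr}(\xi^{\mathsf T}YY^{\mathsf T}\eta),\qquad \xi,\eta\in T_Y\mathrm{St}_{p,n}.$$ Let $Y\in\mathrm{St}_{p,n}$ and let $(Y|Y_\perp)$ be an orthogonal basis of $\mathbb{R}^n$ extending $Y$. Represent three tangent vectors at $Y$ as $\xi=YA_1+Y_\perp B_1$, $\eta=YA_2+Y_\perp B_2$, $\phi=YA_3+Y_\perp B_3$ with $A_1,A_2,A_3\in\mathfrak{o}(p)$ and $B_1,B_2,B_3\in\mathbb{R}^{(n-p)\times p}$. (1) The Riemannian curvature tensor is $R_{\xi\eta}\phi=YA_R+Y_\perp B_R$ with $A_R\in\mathfrak{o}(p)$, $B_R\in\mathbb{R}^{(n-p)\times p}$, where $$\begin{aligned}A_R={}&\tfrac{1-2\alpha}{4}\big(A_1B_3^{\mathsf T}B_2-A_2B_3^{\mathsf T}B_1-B_1^{\mathsf T}B_3A_2+B_2^{\mathsf T}B_3A_1\big)\\&+\tfrac{1-\alpha}{2}\big(A_3B_1^{\mathsf T}B_2-A_3B_2^{\mathsf T}B_1-B_1^{\mathsf T}B_2A_3+B_2^{\mathsf T}B_1A_3\big)\\&+\tfrac14\big([[A_1,A_2],A_3]-A_1B_2^{\mathsf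 T}B_3+A_2B_1^{\mathsf T}B_3+B_3^{\mathsf T}B_1A_2-B_3^{\mathsf T}B_2A_1\big),\end{aligned}$$ $$\begin{aligned}B_R={}&\tfrac{2\alpha^2-\alpha}{2}(B_1A_3A_2-B_2A_3A_1)+(\alpha^2-\alpha)(B_3A_1A_2-B_3A_2A_1)\\&+(1-\alpha)(B_3B_1^{\mathsf T}B_2-B_3B_2^{\mathsf T}B_1)+\tfrac{\alpha-2}{2}(B_1B_2^{\mathsf T}B_3-B_2B_1^{\mathsf T}B_3)\\&+\tfrac{\alpha}{2}(B_1A_2A_3-B_1B_3^{\mathsf T}B_2-B_2A_1A_3+B_2B_3^{\mathsf T}B_1).\end{aligned}$$ (2) If $p>1$, the Ricci curvature is $$\mathrm{Ric}(\xi,\eta)=\Big(\tfrac{2-p}{4}+(p-n)\alpha^2\Big)\operatorname{Tr}(A_1A_2)+\big[(1-p)\alpha+(n-2)\big]\operatorname{Tr}(B_1^{\mathsf T}B_2),$$ and, when $\alpha_0=1$, the scalar curvature is $$\mathrm{Scl}(Y)=\big((1-p)\alpha+n-2\big)(n-p)p+\Big((n-p)\alpha+\tfrac{p-2}{4\alpha}\Big)\tfrac{p(p-1)}{2}.$$ (3) When $\alpha_0=1$, the sectional curvature numerator $\hat{\mathcal K}=\hat{\mathcal K}(\xi,\eta)=\langle R_{\xi\eta}\xi,\eta\rangle_{\mathsf g}$ is given by each of the following two expressions: $$\begin{aligned}\hat{\mathcal K}={}&\operatorname{Tr}\Big(\tfrac{2-3\alpha}{2}B_2^{\mathsf T}B_1B_1^{\mathsf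 T}B_2+\tfrac{3\alpha-4}{2}B_2^{\mathsf T}B_1B_2^{\mathsf T}B_1+B_2^{\mathsf T}B_2B_1^{\mathsf T}B_1-\tfrac{\alpha}{4}[A_1,A_2]^2\Big)\\&+\alpha\operatorname{Tr}\big((4\alpha-3)A_1A_2B_2^{\mathsf T}B_1+(3-2\alpha)A_1A_2B_1^{\mathsf T}B_2-\alpha A_2^2B_1^{\mathsf T}B_1-\alpha A_1^2B_2^{\mathsf T}B_2\big),\end{aligned}$$ $$\begin{aligned}\hat{\mathcal K}={}&\tfrac{\alpha}{4}\big\|[A_1,A_2]+(3-4\alpha)(B_2^{\mathsf T}B_1-B_1^{\mathsf T}B_2)\big\|_F^2+\alpha^2\|B_1A_2-B_2A_1\|_F^2\\&+\tfrac12\|B_1B_2^{\mathsf T}-B_2B_1^{\mathsf T}\|_F^2+\tfrac{(1-2\alpha)^3}{2}\|B_2^{\mathsf T}B_1-B_1^{\mathsf T}B_2\|_F^2.\end{aligned}$$ (4) In particular, if $\alpha\le\frac12$, the sectional curvature is non-negative. (5) If $\xi$ and $\eta$ are orthogonal, the sectional curvature denominator is $$\|\xi\wedge\eta\|_{\mathsf g}^2=(\alpha_1\operatorname{Tr}A_1A_1^{\mathsf T}+\alpha_0\operatorname{Tr}B_1B_1^{\mathsf T})(\alpha_1\operatorname{Tr}A_2A_2^{\mathsf T}+\alpha_0\operatorname{Tr}B_2B_2^{\mathsf T}).$$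
   Context: $\mathfrak{o}(p)$ denotes the antisymmetric matrices in $\mathbb{R}^{p\times p}$; $[A,B]=AB-BA$; $\|\cdot\|_F$ is the Frobenius norm. For $Y\in\mathrm{St}_{p,n}$, $Y_\perp\in\mathbb{R}^{n\times(n-p)}$ is an orthogonal complement: $Y_\perp^{\mathsf T}Y_\perp=I_{n-p}$, $Y^{\mathsf T}Y_\perp=0$, $YY^{\mathsf T}+Y_\perp Y_\perp^{\mathsf T}=I_n$. A matrix $YA+Y_\perp B\in\mathbb{R}^{n\times p}$ (with $A\in\mathbb{R}^{p\times p}$, $B\in\mathbb{R}^{(n-p)\times p}$) is a tangent vector at $Y$ if and only if $A\in\mathfrak{o}(p)$. Curvature sign convention: $R_{XY}Z=\nabla_{[X,Y]}Z-\nabla_X\nabla_YZ+\nabla_Y\nabla_XZ$, with $\nabla$ the Levi-Civita connection. The Ricci curvature is $\mathrm{Ric}(\xi,\phi)=\operatorname{Tr}(\eta\mapsto R_{\xi\eta}\phi)$, and the scalar curvature is the trace of the Ricci tensor with respect to the metric. With $\|\xi\wedge\eta\|_{\mathsf g}^2=\|\xi\|_{\mathsf g}^2\|\eta\|_{\mathsf g}^2-\langle\xi,\eta\rangle_{\mathsf g}^2$ (the sectional curvature denominator), the sectional curvature is $\mathcal K(\xi,\eta)=\hat{\mathcal K}(\xi,\eta)/\|\xi\wedge\eta\|_{\mathsf g}^2$ for linearly independent $\xi,\eta$. *)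

theory Defs
  imports "HOL-Analysis.Analysis"
begin

section \<open>Embedded submanifolds of a Euclidean space\<close>

text \<open>
  The manifold is a subset \<open>S\<close> of a Euclidean space, the Riemannian metric a function
  \<open>g x u v\<close> of the base point and two tangent vectors; only its values for \<open>x \<in> S\<close> and
  \<open>u\<close>, \<open>v\<close> tangent at \<open>x\<close> matter. The notions below are the usual ones when \<open>S\<close> is an
  embedded smooth submanifold.
\<close>

definition tangent_space :: "'a::euclidean_space set \<Rightarrow> 'a \<Rightarrow> 'a set" where
  "tangent_space S x =
     {v. \<exists>c :: real \<Rightarrow> 'a. c 0 = x \<and> range c \<subseteq> S \<and> (c has_vector_derivative v) (at 0)}"

text \<open>\<open>Ck_on k f U\<close> is meant for open \<open>U\<close>.\<close>

primrec Ck_on :: "nat \<Rightarrow> ('a::euclidean_space \<Rightarrow> 'b::real_normed_vector) \<Rightarrow> 'a set \<Rightarrow> bool" where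
  "Ck_on 0 f U \<longleftrightarrow> continuous_on U f"
| "Ck_on (Suc k) f U \<longleftrightarrow> (\<forall>x\<in>U. f differentiable (at x)) \<and>
     (\<forall>v. Ck_on k (\<lambda>x. frechet_derivative f (at x) v) U)"

definition smooth_map :: "'a::euclidean_space set \<Rightarrow> ('a \<Rightarrow> 'b::real_normed_vector) \<Rightarrow> bool" where
  "smooth_map S f \<longleftrightarrow>
     (\<exists>U F. open U \<and> S \<subseteq> U \<and> (\<forall>k. Ck_on k F U) \<and> (\<forall>x\<in>S. F x = f x))"

text \<open>
  Derivative of \<open>f\<close> at \<open>x\<close> in the tangent direction \<open>v\<close>. A derivative within \<open>S\<close> is not
  unique as a linear map on the ambient space, but any two of them agree on
  \<open>tangent_space S x\<close> (chain rule along curves in \<open>S\<close>), and they agree there with the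
  derivative of any extension of \<open>f\<close> that is differentiable at \<open>x\<close>.
\<close>

definition dir_deriv :: "'a::euclidean_space set \<Rightarrow> ('a \<Rightarrow> 'b::real_normed_vector) \<Rightarrow> 'a \<Rightarrow> 'a \<Rightarrow> 'b" where
  "dir_deriv S f x v = frechet_derivative f (at x within S) v"

text \<open>
  Vector fields are total functions, set to 0 outside \<open>S\<close>, so that a vector field on \<open>S\<close>
  is represented by exactly one function.
\<close>

definition vector_fields :: "'a::euclidean_space set \<Rightarrow> ('a \<Rightarrow> 'a) set" where
  "vector_fields S =
     {X. smooth_map S X \<and> (\<forall>x\<in>S. X x \<in> tangent_space S x) \<and> (\<forall>x. x \<notin> S \<longrightarrow> X x = 0)}"

definition lie_bracket :: "'a::euclidean_space set \<Rightarrow> ('a \<Rightarrow> 'a) \<Rightarrow> ('a \<Rightarrow> 'a) \<Rightarrow> 'a \<Rightarrow> 'a" where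
  "lie_bracket S X Y x =
     (if x \<in> S then dir_deriv S Y x (X x) - dir_deriv S X x (Y x) else 0)"

text \<open>
  The argument \<open>D X Z\<close> stands for the covariant derivative of \<open>Z\<close> along \<open>X\<close>. Real linearity
  in \<open>Z\<close> is additivity and the Leibniz rule for constant \<open>f\<close>. The value 0 on arguments that
  are not vector fields is a convention that makes the connection unique as a total function.
\<close>

definition is_levi_civita ::
  "'a::euclidean_space set \<Rightarrow> ('a \<Rightarrow> 'a \<Rightarrow> 'a \<Rightarrow> real) \<Rightarrow> (('a \<Rightarrow> 'a) \<Rightarrow> ('a \<Rightarrow> 'a) \<Rightarrow> 'a \<Rightarrow> 'a) \<Rightarrow> bool"
where
  "is_levi_civita S g D \<longleftrightarrow>
     (\<forall>X Z. X \<notin> vector_fields S \<or> Z \<notin> vector_fields S \<longrightarrow> D X Z = (\<lambda>x. 0)) \<and>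
     (\<forall>X\<in>vector_fields S. \<forall>Z\<in>vector_fields S. D X Z \<in> vector_fields S) \<and>
     (\<forall>X\<in>vector_fields S. \<forall>Y\<in>vector_fields S. \<forall>Z\<in>vector_fields S.
        D (\<lambda>x. X x + Y x) Z = (\<lambda>x. D X Z x + D Y Z x)) \<and>
     (\<forall>f :: 'a \<Rightarrow> real. smooth_map S f \<longrightarrow> (\<forall>X\<in>vector_fields S. \<forall>Z\<in>vector_fields S.
        D (\<lambda>x. f x *\<^sub>R X x) Z = (\<lambda>x. f x *\<^sub>R D X Z x))) \<and>
     (\<forall>X\<in>vector_fields S. \<forall>Y\<in>vector_fields S. \<forall>Z\<in>vector_fields S.
        D X (\<lambda>x. Y x + Z x) = (\<lambda>x. D X Y x + D X Z x)) \<and>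
     (\<forall>f :: 'a \<Rightarrow> real. smooth_map S f \<longrightarrow> (\<forall>X\<in>vector_fields S. \<forall>Z\<in>vector_fields S.
        D X (\<lambda>x. f x *\<^sub>R Z x) = (\<lambda>x. dir_deriv S f x (X x) *\<^sub>R Z x + f x *\<^sub>R D X Z x))) \<and>
     (\<forall>X\<in>vector_fields S. \<forall>Y\<in>vector_fields S. \<forall>x.
        D X Y x - D Y X x = lie_bracket S X Y x) \<and>
     (\<forall>X\<in>vector_fields S. \<forall>Y\<in>vector_fields S. \<forall>Z\<in>vector_fields S. \<forall>x\<in>S.
        dir_deriv S (\<lambda>z. g z (Y z) (Z z)) x (X x) = g x (D X Y x) (Z x) + g x (Y x) (D X Z x))"

definition levi_civita ::
  "'a::euclidean_space set \<Rightarrow> ('a \<Rightarrow> 'a \<Rightarrow> 'a \<Rightarrow> real) \<Rightarrow> ('a \<Rightarrow> 'a) \<Rightarrow> ('a \<Rightarrow> 'a) \<Rightarrow> 'a \<Rightarrow> 'a"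
where
  "levi_civita S g = (THE D. is_levi_civita S g D)"

text \<open>Sign convention: on a round sphere \<open>g (R u v u) v\<close> is positive.\<close>

definition curvature_field ::
  "'a::euclidean_space set \<Rightarrow> ('a \<Rightarrow> 'a \<Rightarrow> 'a \<Rightarrow> real) \<Rightarrow>
   ('a \<Rightarrow> 'a) \<Rightarrow> ('a \<Rightarrow> 'a) \<Rightarrow> ('a \<Rightarrow> 'a) \<Rightarrow> 'a \<Rightarrow> 'a"
where
  "curvature_field S g X Y Z x =
     (let D = levi_civita S g
      in D (lie_bracket S X Y) Z x - D X (D Y Z) x + D Y (D X Z) x)"

text \<open>The common value at \<open>x\<close> over all vector fields extending the tangent vectors.\<close>

definition riemann_curvature ::
  "'a::euclidean_space set \<Rightarrow> ('a \<Rightarrow> 'a \<Rightarrow> 'a \<Rightarrow> real) \<Rightarrow> 'a \<Rightarrow> 'a \<Rightarrow> 'a \<Rightarrow> 'a \<Rightarrow> 'a"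
where
  "riemann_curvature S g x u v w =
     (THE r. \<forall>X\<in>vector_fields S. \<forall>Y\<in>vector_fields S. \<forall>Z\<in>vector_fields S.
        X x = u \<and> Y x = v \<and> Z x = w \<longrightarrow> curvature_field S g X Y Z x = r)"

text \<open>Trace of an endomorphism \<open>f\<close> of a subspace \<open>V\<close>; independent of the chosen basis.\<close>

definition trace_on :: "'a::euclidean_space set \<Rightarrow> ('a \<Rightarrow> 'a) \<Rightarrow> real" where
  "trace_on V f =
     (let B = (SOME B. independent B \<and> span B = V) in \<Sum>b\<in>B. representation B (f b) b)"

text \<open>
  Trace of a bilinear form \<open>h\<close> on \<open>V\<close> with respect to the inner product \<open>ip\<close>; independent of
  the chosen orthonormal basis.
\<close>

definition metric_trace_on ::
  "'a::euclidean_space set \<Rightarrow> ('a \<Rightarrow> 'a \<Rightarrow> real) \<Rightarrow> ('a \<Rightarrow> 'a \<Rightarrow> real) \<Rightarrow> real"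
where
  "metric_trace_on V ip h =
     (let E = (SOME E. independent E \<and> span E = V \<and>
                 (\<forall>a\<in>E. \<forall>b\<in>E. ip a b = (if a = b then 1 else 0)))
      in \<Sum>e\<in>E. h e e)"

definition ricci_curvature ::
  "'a::euclidean_space set \<Rightarrow> ('a \<Rightarrow> 'a \<Rightarrow> 'a \<Rightarrow> real) \<Rightarrow> 'a \<Rightarrow> 'a \<Rightarrow> 'a \<Rightarrow> real"
where
  "ricci_curvature S g x u w = trace_on (tangent_space S x) (\<lambda>v. riemann_curvature S g x u v w)"

definition scalar_curvature ::
  "'a::euclidean_space set \<Rightarrow> ('a \<Rightarrow> 'a \<Rightarrow> 'a \<Rightarrow> real) \<Rightarrow> 'a \<Rightarrow> real"
where
  "scalar_curvature S g x = metric_trace_on (tangent_space S x) (g x) (ricci_curvature S g x)"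

definition sectional_numerator ::
  "'a::euclidean_space set \<Rightarrow> ('a \<Rightarrow> 'a \<Rightarrow> 'a \<Rightarrow> real) \<Rightarrow> 'a \<Rightarrow> 'a \<Rightarrow> 'a \<Rightarrow> real"
where
  "sectional_numerator S g x u v = g x (riemann_curvature S g x u v u) v"

definition wedge_norm_sq :: "('a \<Rightarrow> 'a \<Rightarrow> 'a \<Rightarrow> real) \<Rightarrow> 'a \<Rightarrow> 'a \<Rightarrow> 'a \<Rightarrow> real" where
  "wedge_norm_sq g x u v = g x u u * g x v v - (g x u v)\<^sup>2"

definition sectional_curvature ::
  "'a::euclidean_space set \<Rightarrow> ('a \<Rightarrow> 'a \<Rightarrow> 'a \<Rightarrow> real) \<Rightarrow> 'a \<Rightarrow> 'a \<Rightarrow> 'a \<Rightarrow> real"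
where
  "sectional_curvature S g x u v = sectional_numerator S g x u v / wedge_norm_sq g x u v"

section \<open>The Stiefel manifold\<close>

text \<open>
  \<open>real^'p^'n\<close> is the type of matrices with \<open>CARD('n)\<close> rows and \<open>CARD('p)\<close> columns. Its norm is
  the Frobenius norm.
\<close>

definition stiefel :: "(real^'p^'n) set" where
  "stiefel = {Y. transpose Y ** Y = mat 1}"

definition stiefel_metric ::
  "real \<Rightarrow> real \<Rightarrow> real^'p^'n \<Rightarrow> real^'p^'n \<Rightarrow> real^'p^'n \<Rightarrow> real"
where
  "stiefel_metric \<alpha>0 \<alpha>1 Y \<xi> \<eta> =
     \<alpha>0 * trace (transpose \<xi> ** \<eta>)
     + (\<alpha>1 - \<alpha>0) * trace (transpose \<xi> ** Y ** transpose Y ** \<eta>)"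

definition orth_complement :: "real^'p^'n \<Rightarrow> real^'q^'n \<Rightarrow> bool" where
  "orth_complement Y Yp \<longleftrightarrow>
     transpose Yp ** Yp = mat 1 \<and> transpose Y ** Yp = 0 \<and>
     Y ** transpose Y + Yp ** transpose Yp = mat 1"

definition antisymmetric :: "real^'p^'p \<Rightarrow> bool" where
  "antisymmetric A \<longleftrightarrow> transpose A = - A"

definition commutator :: "real^'p^'p \<Rightarrow> real^'p^'p \<Rightarrow> real^'p^'p" where
  "commutator A B = A ** B - B ** A"

end

theory Submission
  imports Defs
begin

text \<open>
  The Levi-Civita connection is written down in ambient coordinates as \<open>D X Z = Z' X + G (X, Z)\<close>
  with \<open>G\<close> a symmetric bilinear form depending polynomially on the base point; Koszul's argument
  shows that it is the only one. By symmetry of second derivatives, every derivative of the vector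
  fields cancels in the curvature, which leaves
  \<open>R u v w = DG[v](u, w) - DG[u](v, w) - G (u, G (v, w)) + G (v, G (u, w))\<close>. In the frame
  \<open>(Y, Yp)\<close> this becomes an identity between noncommutative polynomials in the blocks \<open>A\<close>, \<open>B\<close>.
  The traces are taken over the overcomplete frame of the tangent space given by \<open>Y\<close> times the
  antisymmetrised matrix units and \<open>Yp\<close> times the matrix units.
\<close>

section \<open>Smooth maps and derivatives along a submanifold\<close>

text \<open>Derivatives within \<open>S\<close> are pinned down only in tangent directions, so the
  calculus is carried out on smooth ambient extensions. This is why \<open>G\<close> is given at
  every ambient matrix and not just on the manifold. Its two terms have separate origins: half of
  \<open>Y ** (transpose u ** v + transpose v ** u)\<close> removes the defect left by
  differentiating the tangency condition, and the term with \<open>1 - a\<close> compensates the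
  dependence of the metric on the base point. Values of \<open>G\<close> are in general not tangent,
  so the nested terms of the curvature feed non-tangent arguments to \<open>G\<close>. The
  definitions speak through \<open>THE\<close> and \<open>SOME\<close>, so a computation needs
  existence or uniqueness beforehand: one connection, a vector field through every tangent vector, a
  metric-orthonormal basis. Tangent vectors are velocities of curves, so identifying the tangent
  space calls for explicit curves, here Cayley transforms. The frame is overcomplete because it runs
  over all ordered index pairs; every trace of \<open>P ** Z ** Q\<close> over \<open>Z\<close> then
  reduces to \<open>trace P * trace Q\<close> and \<open>trace (transpose P ** Q)\<close>.\<close>

lemma Ck_on_subset: "Ck_on k f U \<Longrightarrow> V \<subseteq> U \<Longrightarrow> Ck_on k f V"
  by (induction k arbitrary: f) (auto intro: continuous_on_subset)

lemma Ck_on_Suc_imp: "Ck_on (Suc k) f U \<Longrightarrow> Ck_on k f U"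
proof (induction k arbitrary: f)
  case 0
  then show ?case
    by (auto intro!: continuous_at_imp_continuous_on differentiable_imp_continuous_within)
next
  case (Suc k)
  then have "f differentiable at x" "Ck_on (Suc k) (\<lambda>x. frechet_derivative f (at x) v) U"
    if "x \<in> U" for x v using that by auto
  then show ?case using Suc.IH Suc.prems by (subst Ck_on.simps) (metis Ck_on.simps(2))
qed

text \<open>On an open set the two functions agree near every point, so their Frechet derivatives
  agree as well and the induction can pass to them.\<close>

lemma Ck_on_cong_open:
  assumes "open U" "\<And>x. x \<in> U \<Longrightarrow> f x = g x" "Ck_on k f U"
  shows "Ck_on k g U"
  using assms(2,3)
proof (induction k arbitrary: f g)
  case 0
  then show ?case by (auto cong: continuous_on_cong)
next
  case (Suc k)
  have d: "(g has_derivative frechet_derivative f (at x)) (at x)" if x: "x \<in> U" for x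
  proof (rule has_derivative_transform_within_open[OF _ \<open>open U\<close> x])
    show "(f has_derivative frechet_derivative f (at x)) (at x)"
      using Suc.prems x by (simp add: frechet_derivative_works)
  qed (use Suc.prems in auto)
  then have "frechet_derivative f (at x) = frechet_derivative g (at x)" if "x \<in> U" for x
    using frechet_derivative_at that by blast
  note eq = this
  have "Ck_on k (\<lambda>x. frechet_derivative g (at x) v) U" for v
    by (rule Suc.IH[of "\<lambda>x. frechet_derivative f (at x) v"]) (use eq Suc.prems in auto)
  with d show ?case
    by (auto intro: differentiableI)
qed

text \<open>Lets an explicitly known derivative \<open>D\<close> replace the chosen
  \<open>frechet_derivative\<close>; the closure properties below then only have to name their
  derivative.\<close>

lemma Ck_on_SucI:
  assumes "open U" "\<And>x. x \<in> U \<Longrightarrow> (f has_derivative D x) (at x)"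
    and "\<And>v. Ck_on k (\<lambda>x. D x v) U"
  shows "Ck_on (Suc k) f U"
proof -
  have "D x = frechet_derivative f (at x)" if "x \<in> U" for x
    using assms(2) frechet_derivative_at that by blast
  note eq = this
  have "Ck_on k (\<lambda>x. frechet_derivative f (at x) v) U" for v
    by (rule Ck_on_cong_open[OF assms(1) _ assms(3)[of v]]) (use eq in simp)
  with assms(2) show ?thesis
    by (auto intro: differentiableI)
qed

lemma Ck_on_const: "Ck_on k (\<lambda>x. c) U"
  by (induction k arbitrary: c) auto

lemma Ck_on_add:
  assumes "open U" "Ck_on k f U" "Ck_on k g U"
  shows "Ck_on k (\<lambda>x. f x + g x) U"
  using assms(2,3)
proof (induction k arbitrary: f g)
  case 0
  then show ?case by (simp add: continuous_on_add)
next
  case (Suc k)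
  show ?case
  proof (rule Ck_on_SucI[OF \<open>open U\<close>])
    show "((\<lambda>x. f x + g x) has_derivative
        (\<lambda>v. frechet_derivative f (at x) v + frechet_derivative g (at x) v)) (at x)" if "x \<in> U" for x
      using Suc.prems that by (intro has_derivative_add) (simp_all add: frechet_derivative_works)
  qed (use Suc in simp)
qed

text \<open>Both terms of the product rule are again values of \<open>h\<close> at a factor and a
  differentiated factor, hence covered by the induction hypothesis once the undifferentiated factor
  is weakened to order \<open>k\<close>. Scalar, inner and matrix products are all
  instances.\<close>

lemma Ck_on_bilinear:
  assumes "open U" "bounded_bilinear h" "Ck_on k f U" "Ck_on k g U"
  shows "Ck_on k (\<lambda>x. h (f x) (g x)) U"
  using assms(3,4)
proof (induction k arbitrary: f g)
  case 0
  then show ?case using bounded_bilinear.continuous_on[OF assms(2)] by simp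
next
  case (Suc k)
  have "Ck_on k f U" "Ck_on k g U" using Suc.prems Ck_on_Suc_imp by blast+
  show ?case
  proof (rule Ck_on_SucI[OF \<open>open U\<close>])
    show "((\<lambda>x. h (f x) (g x)) has_derivative
        (\<lambda>v. h (f x) (frechet_derivative g (at x) v) + h (frechet_derivative f (at x) v) (g x))) (at x)"
      if "x \<in> U" for x
      using Suc.prems that
      by (intro bounded_bilinear.FDERIV[OF assms(2)]) (simp_all add: frechet_derivative_works)
    show "Ck_on k (\<lambda>x. h (f x) (frechet_derivative g (at x) v)
        + h (frechet_derivative f (at x) v) (g x)) U" for v
      using Suc \<open>Ck_on k f U\<close> \<open>Ck_on k g U\<close> by (intro Ck_on_add[OF \<open>open U\<close>]) simp_all
  qed
qed

definition smooth_on :: "'a::euclidean_space set \<Rightarrow> ('a \<Rightarrow> 'b::real_normed_vector) \<Rightarrow> bool" where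
  "smooth_on U f \<longleftrightarrow> (\<forall>k. Ck_on k f U)"

lemma smooth_on_subset: "smooth_on U f \<Longrightarrow> V \<subseteq> U \<Longrightarrow> smooth_on V f"
  by (auto simp: smooth_on_def intro: Ck_on_subset)

lemma smooth_on_const: "smooth_on U (\<lambda>x. c)"
  by (simp add: smooth_on_def Ck_on_const)

lemma smooth_on_bounded_linear: "bounded_linear h \<Longrightarrow> smooth_on U h"
  unfolding smooth_on_def
proof
  fix k
  assume h: "bounded_linear h"
  show "Ck_on k h U"
  proof (cases k)
    case (Suc m)
    have "Ck_on (Suc m) h UNIV"
      by (rule Ck_on_SucI[OF open_UNIV bounded_linear_imp_has_derivative[OF h]]) (rule Ck_on_const)
    then show ?thesis using Suc Ck_on_subset by blast
  qed (simp add: h linear_continuous_on)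
qed

lemma smooth_on_add:
  "open U \<Longrightarrow> smooth_on U f \<Longrightarrow> smooth_on U g \<Longrightarrow> smooth_on U (\<lambda>x. f x + g x)"
  unfolding smooth_on_def by (intro allI Ck_on_add) simp_all

lemma smooth_on_bilinear:
  "open U \<Longrightarrow> bounded_bilinear h \<Longrightarrow> smooth_on U f \<Longrightarrow> smooth_on U g \<Longrightarrow>
    smooth_on U (\<lambda>x. h (f x) (g x))"
  unfolding smooth_on_def by (intro allI, rule Ck_on_bilinear) simp_all

lemma smooth_on_cong:
  "open U \<Longrightarrow> (\<And>x. x \<in> U \<Longrightarrow> f x = g x) \<Longrightarrow> smooth_on U f \<Longrightarrow> smooth_on U g"
  unfolding smooth_on_def by (intro allI, rule Ck_on_cong_open[of U f g]) simp_all

text \<open>A bounded linear \<open>h\<close> is the bilinear map \<open>r *\<^sub>R h y\<close> at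
  the constant \<open>r = 1\<close>, so the product rule takes the place of a chain rule.\<close>

lemma smooth_on_compose_linear:
  assumes "open U" "bounded_linear h" "smooth_on U f"
  shows "smooth_on U (\<lambda>x. h (f x))"
proof -
  have "bounded_bilinear (\<lambda>r y. r *\<^sub>R h y)"
    using bounded_bilinear.comp[OF bounded_bilinear_scaleR bounded_linear_ident assms(2)] .
  from smooth_on_bilinear[OF assms(1) this smooth_on_const[of U 1] assms(3)]
  show ?thesis by simp
qed

lemma smooth_on_sum:
  assumes "open U" "\<And>i. i \<in> I \<Longrightarrow> smooth_on U (f i)"
  shows "smooth_on U (\<lambda>x. \<Sum>i\<in>I. f i x)"
  using assms(2)
  by (induction I rule: infinite_finite_induct)
     (auto simp: smooth_on_const intro!: smooth_on_add[OF assms(1)])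

lemma smooth_on_has_derivative:
  assumes "smooth_on U f" "x \<in> U"
  shows "(f has_derivative frechet_derivative f (at x)) (at x)"
proof -
  have "Ck_on (Suc 0) f U" using assms(1) unfolding smooth_on_def by blast
  then show ?thesis using assms(2) by (simp add: frechet_derivative_works)
qed

lemma smooth_on_frechet_derivative:
  assumes "smooth_on U f"
  shows "smooth_on U (\<lambda>x. frechet_derivative f (at x) v)"
  unfolding smooth_on_def
proof
  fix k
  have "Ck_on (Suc k) f U" using assms unfolding smooth_on_def by blast
  then show "Ck_on k (\<lambda>x. frechet_derivative f (at x) v) U" by simp
qed

text \<open>\<open>Ck_on\<close> controls derivatives in fixed directions only. The expansion moves
  a direction that varies with the point into scalar coefficients.\<close>

lemma frechet_derivative_basis_sum:
  assumes "smooth_on U f" "x \<in> U"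
  shows "frechet_derivative f (at x) v =
    (\<Sum>b\<in>Basis. (v \<bullet> b) *\<^sub>R frechet_derivative f (at x) b)"
proof -
  interpret bounded_linear "frechet_derivative f (at x)"
    using smooth_on_has_derivative[OF assms] by (rule has_derivative_bounded_linear)
  have "frechet_derivative f (at x) v = frechet_derivative f (at x) (\<Sum>b\<in>Basis. (v \<bullet> b) *\<^sub>R b)"
    by (simp only: euclidean_representation)
  also have "\<dots> = (\<Sum>b\<in>Basis. (v \<bullet> b) *\<^sub>R frechet_derivative f (at x) b)"
    by (simp only: sum scaleR)
  finally show ?thesis .
qed

lemma smooth_on_frechet_derivative_field:
  assumes U: "open U" and f: "smooth_on U f" and X: "smooth_on U X"
  shows "smooth_on U (\<lambda>x. frechet_derivative f (at x) (X x))"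
proof (rule smooth_on_cong[OF U])
  show "smooth_on U (\<lambda>x. \<Sum>b\<in>Basis. (X x \<bullet> b) *\<^sub>R frechet_derivative f (at x) b)"
    by (intro smooth_on_sum U smooth_on_bilinear[OF U bounded_bilinear_scaleR]
        smooth_on_bilinear[OF U bounded_bilinear_inner] X smooth_on_const
        smooth_on_frechet_derivative f)
qed (simp add: frechet_derivative_basis_sum[OF f, symmetric])

lemma has_derivative_frechet_derivative_field:
  assumes U: "open U" "x \<in> U" and f: "smooth_on U f" and X: "(X has_derivative X') (at x)"
  shows "((\<lambda>z. frechet_derivative f (at z) (X z)) has_derivative
    (\<lambda>u. frechet_derivative (\<lambda>z. frechet_derivative f (at z) (X x)) (at x) u
        + frechet_derivative f (at x) (X' u))) (at x)"
proof -
  let ?D = "\<lambda>b z. frechet_derivative f (at z) b"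
  have D: "(?D b has_derivative frechet_derivative (?D b) (at x)) (at x)" for b
    by (intro smooth_on_has_derivative[OF _ U(2)] smooth_on_frechet_derivative f)
  have "((\<lambda>z. \<Sum>b\<in>Basis. (X z \<bullet> b) *\<^sub>R ?D b z) has_derivative
      (\<lambda>u. \<Sum>b\<in>Basis. (X x \<bullet> b) *\<^sub>R frechet_derivative (?D b) (at x) u + (X' u \<bullet> b) *\<^sub>R ?D b x)) (at x)"
    by (intro has_derivative_sum has_derivative_scaleR D has_derivative_inner_left X)
  also have "(\<lambda>u. \<Sum>b\<in>Basis. (X x \<bullet> b) *\<^sub>R frechet_derivative (?D b) (at x) u + (X' u \<bullet> b) *\<^sub>R ?D b x)
    = (\<lambda>u. (\<Sum>b\<in>Basis. (X x \<bullet> b) *\<^sub>R frechet_derivative (?D b) (at x) u) + ?D (X' u) x)"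
    by (simp add: sum.distrib frechet_derivative_basis_sum[OF f U(2), symmetric])
  finally have 1: "((\<lambda>z. \<Sum>b\<in>Basis. (X z \<bullet> b) *\<^sub>R ?D b z) has_derivative \<dots>) (at x)" .
  have "((\<lambda>z. \<Sum>b\<in>Basis. (X x \<bullet> b) *\<^sub>R ?D b z) has_derivative
      (\<lambda>u. \<Sum>b\<in>Basis. (X x \<bullet> b) *\<^sub>R frechet_derivative (?D b) (at x) u)) (at x)"
    by (intro has_derivative_sum has_derivative_scaleR_right D)
  then have "(?D (X x) has_derivative
      (\<lambda>u. \<Sum>b\<in>Basis. (X x \<bullet> b) *\<^sub>R frechet_derivative (?D b) (at x) u)) (at x)"
    by (rule has_derivative_transform_within_open[OF _ U])
       (simp add: frechet_derivative_basis_sum[OF f, symmetric])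
  then have 2: "frechet_derivative (?D (X x)) (at x) =
      (\<lambda>u. \<Sum>b\<in>Basis. (X x \<bullet> b) *\<^sub>R frechet_derivative (?D b) (at x) u)"
    by (rule frechet_derivative_at[symmetric])
  show ?thesis
    unfolding 2 by (rule has_derivative_transform_within_open[OF 1 U])
       (simp add: frechet_derivative_basis_sum[OF f, symmetric])
qed


section \<open>Symmetry of second derivatives\<close>

lemma second_difference_mean_value:
  fixes \<phi> :: "real \<Rightarrow> real \<Rightarrow> real"
  assumes "h > 0"
    and 1: "\<And>s t. \<bar>s\<bar> \<le> h \<Longrightarrow> \<bar>t\<bar> \<le> h \<Longrightarrow> ((\<lambda>s. \<phi> s t) has_real_derivative d1 s t) (at s)"
    and 12: "\<And>s t. \<bar>s\<bar> \<le> h \<Longrightarrow> \<bar>t\<bar> \<le> h \<Longrightarrow> ((\<lambda>t. d1 s t) has_real_derivative d12 s t) (at t)"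
  obtains s t where "0 < s" "s < h" "0 < t" "t < h"
    "\<phi> h h - \<phi> h 0 - \<phi> 0 h + \<phi> 0 0 = h\<^sup>2 * d12 s t"
proof -
  have "((\<lambda>s. \<phi> s h - \<phi> s 0) has_real_derivative d1 s h - d1 s 0) (at s)" if "0 \<le> s" "s \<le> h" for s
    using that \<open>h > 0\<close> by (intro DERIV_diff 1) auto
  from MVT2[OF \<open>h > 0\<close> this] obtain s where s: "0 < s" "s < h"
    "(\<phi> h h - \<phi> h 0) - (\<phi> 0 h - \<phi> 0 0) = h * (d1 s h - d1 s 0)" by auto
  have "((\<lambda>t. d1 s t) has_real_derivative d12 s t) (at t)" if "0 \<le> t" "t \<le> h" for t
    using that s by (intro 12) auto
  from MVT2[OF \<open>h > 0\<close> this] obtain t where t: "0 < t" "t < h" "d1 s h - d1 s 0 = h * d12 s t"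
    by auto
  show ?thesis
    using s t by (intro that[of s t]) (auto simp: power2_eq_square algebra_simps)
qed

text \<open>The second difference of \<open>f\<close> over a small parallelogram does not depend on
  the order of the two directions. The mean value theorem, used in either order, writes it as
  \<open>h\<^sup>2\<close> times one or the other mixed derivative at a point near \<open>x\<close>;
  continuity then makes the two differ by less than any \<open>e\<close> at
  \<open>x\<close>.\<close>

lemma smooth_on_second_derivative_symmetric_real:
  fixes f :: "'a::euclidean_space \<Rightarrow> real"
  assumes U: "open U" "x \<in> U" and f: "smooth_on U f"
  shows "frechet_derivative (\<lambda>z. frechet_derivative f (at z) u) (at x) v =
    frechet_derivative (\<lambda>z. frechet_derivative f (at z) v) (at x) u"
    (is "?D u v x = ?D v u x")
proof -
  have cont: "continuous_on U (?D u v)" for u v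
    using smooth_on_frechet_derivative[OF smooth_on_frechet_derivative[OF f]]
    unfolding smooth_on_def by (metis Ck_on.simps(1))
  have line: "((\<lambda>s. F (y s)) has_real_derivative frechet_derivative F (at (y s)) w) (at s)"
    if "smooth_on U F" "y s \<in> U" "(y has_derivative (\<lambda>r. r *\<^sub>R w)) (at s)"
    for F :: "'a \<Rightarrow> real" and y :: "real \<Rightarrow> 'a" and s w
  proof -
    have F: "(F has_derivative frechet_derivative F (at (y s))) (at (y s))"
      using smooth_on_has_derivative[OF that(1,2)] .
    then interpret bounded_linear "frechet_derivative F (at (y s))"
      by (rule has_derivative_bounded_linear)
    show ?thesis
      using has_derivative_compose[OF that(3) F]
      by (simp add: has_field_derivative_def scaleR mult_commute_abs)
  qed
  have "\<bar>?D u v x - ?D v u x\<bar> \<le> e" if "e > 0" for e :: real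
  proof -
    have near_x: "\<forall>\<^sub>F y in nhds x. dist (?D u v y) (?D u v x) < e / 2" for u v
    proof (rule tendstoD)
      have "isCont (?D u v) x"
        using cont U by (simp add: continuous_on_eq_continuous_at)
      then show "(?D u v \<longlongrightarrow> ?D u v x) (nhds x)"
        by (simp only: isCont_def tendsto_at_iff_tendsto_nhds[of "?D u v"])
    qed (use \<open>e > 0\<close> in simp)
    have "\<forall>\<^sub>F y in nhds x. y \<in> U" using U by (auto simp: eventually_nhds)
    with near_x[of u v] near_x[of v u] have "\<forall>\<^sub>F y in nhds x. dist (?D u v y) (?D u v x) < e / 2 \<and>
        dist (?D v u y) (?D v u x) < e / 2 \<and> y \<in> U"
      by eventually_elim auto
    then obtain d where d: "d > 0" "\<And>y. dist y x < d \<Longrightarrow> dist (?D u v y) (?D u v x) < e / 2 \<and>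
        dist (?D v u y) (?D v u x) < e / 2 \<and> y \<in> U"
      by (auto simp: eventually_nhds_metric)
    \<comment> \<open>The summand 1 keeps \<open>c\<close> positive even for
      \<open>u = v = 0\<close>. With \<open>h = d / (2 * c)\<close> the whole parallelogram lies
      within distance \<open>d / 2\<close> of \<open>x\<close>.\<close>
    define c where "c = norm u + norm v + 1"
    have c: "c > 0" unfolding c_def by (simp add: add_nonneg_pos)
    define h where "h = d / (2 * c)"
    have h: "h > 0" using d(1) c unfolding h_def by simp
    have near: "dist (x + s *\<^sub>R u + t *\<^sub>R v) x < d" if "\<bar>s\<bar> \<le> h" "\<bar>t\<bar> \<le> h" for s t
    proof -
      have "dist (x + s *\<^sub>R u + t *\<^sub>R v) x \<le> \<bar>s\<bar> * norm u + \<bar>t\<bar> * norm v"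
        by (metis add.assoc add_diff_cancel_left' dist_norm norm_scaleR norm_triangle_ineq)
      also have "\<dots> \<le> h * norm u + h * norm v"
        using that by (intro add_mono mult_right_mono) auto
      also have "\<dots> \<le> h * c" using h by (simp add: c_def algebra_simps)
      also have "\<dots> = d / 2" unfolding h_def using c by simp
      finally show ?thesis using d(1) by simp
    qed
    let ?\<phi> = "\<lambda>s t. f (x + s *\<^sub>R u + t *\<^sub>R v)"
    have mv: "\<exists>y. dist y x < d \<and> ?\<phi> h h - ?\<phi> h 0 - ?\<phi> 0 h + ?\<phi> 0 0 = h\<^sup>2 * ?D u v y"
    proof -
      obtain s t where "0 < s" "s < h" "0 < t" "t < h"
        "?\<phi> h h - ?\<phi> h 0 - ?\<phi> 0 h + ?\<phi> 0 0 = h\<^sup>2 * ?D u v (x + s *\<^sub>R u + t *\<^sub>R v)"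
      proof (rule second_difference_mean_value[OF h, of ?\<phi>
            "\<lambda>s t. frechet_derivative f (at (x + s *\<^sub>R u + t *\<^sub>R v)) u"
            "\<lambda>s t. ?D u v (x + s *\<^sub>R u + t *\<^sub>R v)"])
        fix s t :: real assume st: "\<bar>s\<bar> \<le> h" "\<bar>t\<bar> \<le> h"
        then have in_U: "x + s *\<^sub>R u + t *\<^sub>R v \<in> U" using near d(2) by blast
        show "((\<lambda>s. ?\<phi> s t) has_real_derivative
            frechet_derivative f (at (x + s *\<^sub>R u + t *\<^sub>R v)) u) (at s)"
          by (rule line[of f "\<lambda>s. x + s *\<^sub>R u + t *\<^sub>R v", OF f in_U]) (auto intro!: derivative_eq_intros)
        show "((\<lambda>t. frechet_derivative f (at (x + s *\<^sub>R u + t *\<^sub>R v)) u) has_real_derivative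
            ?D u v (x + s *\<^sub>R u + t *\<^sub>R v)) (at t)"
          by (rule line[of _ "\<lambda>t. x + s *\<^sub>R u + t *\<^sub>R v", OF smooth_on_frechet_derivative[OF f] in_U]) (auto intro!: derivative_eq_intros)
      qed
      then show ?thesis using near by (metis abs_of_pos less_le)
    qed
    \<comment> \<open>The same second difference with the roles of the two parameters exchanged:
      \<open>s\<close> now runs along \<open>v\<close> and \<open>t\<close> along
      \<open>u\<close>.\<close>
    have mv': "\<exists>y. dist y x < d \<and> ?\<phi> h h - ?\<phi> h 0 - ?\<phi> 0 h + ?\<phi> 0 0 = h\<^sup>2 * ?D v u y"
    proof -
      obtain s t where "0 < s" "s < h" "0 < t" "t < h"
        "?\<phi> h h - ?\<phi> 0 h - ?\<phi> h 0 + ?\<phi> 0 0 = h\<^sup>2 * ?D v u (x + t *\<^sub>R u + s *\<^sub>R v)"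
      proof (rule second_difference_mean_value[OF h, of "\<lambda>s t. ?\<phi> t s"
            "\<lambda>s t. frechet_derivative f (at (x + t *\<^sub>R u + s *\<^sub>R v)) v"
            "\<lambda>s t. ?D v u (x + t *\<^sub>R u + s *\<^sub>R v)"])
        fix s t :: real assume st: "\<bar>s\<bar> \<le> h" "\<bar>t\<bar> \<le> h"
        then have in_U: "x + t *\<^sub>R u + s *\<^sub>R v \<in> U" using near d(2) by blast
        show "((\<lambda>s. ?\<phi> t s) has_real_derivative
            frechet_derivative f (at (x + t *\<^sub>R u + s *\<^sub>R v)) v) (at s)"
          by (rule line[of f "\<lambda>s. x + t *\<^sub>R u + s *\<^sub>R v", OF f in_U]) (auto intro!: derivative_eq_intros)
        show "((\<lambda>t. frechet_derivative f (at (x + t *\<^sub>R u + s *\<^sub>R v)) v) has_real_derivative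
            ?D v u (x + t *\<^sub>R u + s *\<^sub>R v)) (at t)"
          by (rule line[of _ "\<lambda>t. x + t *\<^sub>R u + s *\<^sub>R v", OF smooth_on_frechet_derivative[OF f] in_U]) (auto intro!: derivative_eq_intros)
      qed
      moreover from this have "dist (x + t *\<^sub>R u + s *\<^sub>R v) x < d" by (intro near) auto
      ultimately show ?thesis by (intro exI[of _ "x + t *\<^sub>R u + s *\<^sub>R v"]) auto
    qed
    from mv mv' obtain y z where "dist y x < d" "dist z x < d" "h\<^sup>2 * ?D u v y = h\<^sup>2 * ?D v u z"
      by auto
    then have "?D u v y = ?D v u z" and "dist (?D u v y) (?D u v x) < e / 2" and "dist (?D v u z) (?D v u x) < e / 2"
      using h d(2)[of y] d(2)[of z] by simp_all
    then show ?thesis unfolding dist_real_def by linarith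
  qed
  note eps = this
  have "\<bar>?D u v x - ?D v u x\<bar> \<le> 0"
    by (rule field_le_epsilon) (use eps in simp)
  then show ?thesis by simp
qed

lemma smooth_on_second_derivative_symmetric:
  fixes f :: "'a::euclidean_space \<Rightarrow> 'b::euclidean_space"
  assumes U: "open U" "x \<in> U" and f: "smooth_on U f"
  shows "frechet_derivative (\<lambda>z. frechet_derivative f (at z) u) (at x) v =
    frechet_derivative (\<lambda>z. frechet_derivative f (at z) v) (at x) u"
proof (rule euclidean_eqI)
  fix b :: 'b
  let ?fb = "\<lambda>z. f z \<bullet> b"
  have inner: "frechet_derivative (\<lambda>z. F z \<bullet> b) (at z) w = frechet_derivative F (at z) w \<bullet> b"
    if "smooth_on U F" "z \<in> U" for F :: "'a \<Rightarrow> 'b" and z w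
    using frechet_derivative_at[OF has_derivative_inner_left[OF smooth_on_has_derivative[OF that]]]
    by metis
  have fb: "smooth_on U ?fb"
    by (rule smooth_on_bilinear[OF U(1) bounded_bilinear_inner f smooth_on_const])
  have second: "frechet_derivative (\<lambda>z. frechet_derivative f (at z) u) (at x) v \<bullet> b =
      frechet_derivative (\<lambda>z. frechet_derivative ?fb (at z) u) (at x) v" for u v
  proof -
    have "((\<lambda>z. frechet_derivative f (at z) u \<bullet> b) has_derivative
        (\<lambda>v. frechet_derivative (\<lambda>z. frechet_derivative f (at z) u) (at x) v \<bullet> b)) (at x)"
      by (intro has_derivative_inner_left smooth_on_has_derivative[OF _ U(2)]
          smooth_on_frechet_derivative f)
    then have "((\<lambda>z. frechet_derivative ?fb (at z) u) has_derivative
        (\<lambda>v. frechet_derivative (\<lambda>z. frechet_derivative f (at z) u) (at x) v \<bullet> b)) (at x)"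
      by (rule has_derivative_transform_within_open[OF _ U]) (simp add: inner[OF f])
    from frechet_derivative_at[OF this] show ?thesis by metis
  qed
  show "frechet_derivative (\<lambda>z. frechet_derivative f (at z) u) (at x) v \<bullet> b =
      frechet_derivative (\<lambda>z. frechet_derivative f (at z) v) (at x) u \<bullet> b"
    unfolding second by (rule smooth_on_second_derivative_symmetric_real[OF U fb])
qed

section \<open>Derivatives along a submanifold\<close>

lemma tangent_derivative_unique:
  assumes "(f has_derivative f1) (at x within S)" "(f has_derivative f2) (at x within S)"
    and "v \<in> tangent_space S x"
  shows "f1 v = f2 v"
proof -
  obtain c where c: "c 0 = x" "range c \<subseteq> S" "(c has_vector_derivative v) (at 0)"
    using assms(3) by (auto simp: tangent_space_def)
  \<comment> \<open>A derivative within \<open>S\<close> only tests increments that stay in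
    \<open>S\<close>. Along \<open>c\<close> all of them do, so the composite has an ordinary
    derivative at 0, and that one is unique.\<close>
  have *: "((\<lambda>t. f (c t)) has_vector_derivative f' v) (at 0)"
    if f': "(f has_derivative f') (at x within S)" for f'
  proof -
    interpret bounded_linear f' using f' by (rule has_derivative_bounded_linear)
    have "(f has_derivative f') (at (c 0) within range c)"
      using has_derivative_subset[OF f' c(2)] c(1) by simp
    from has_derivative_in_compose[OF c(3)[unfolded has_vector_derivative_def] this]
    show ?thesis by (simp add: has_vector_derivative_def scaleR)
  qed
  show ?thesis using vector_derivative_unique_at[OF *[OF assms(1)] *[OF assms(2)]] .
qed

lemma dir_deriv_eq:
  assumes "(f has_derivative f') (at x within S)" "v \<in> tangent_space S x"
  shows "dir_deriv S f x v = f' v"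
proof -
  have "(f has_derivative frechet_derivative f (at x within S)) (at x within S)"
    using assms(1) frechet_derivative_works differentiableI by blast
  then show ?thesis
    unfolding dir_deriv_def using tangent_derivative_unique assms by blast
qed

text \<open>Keeping the extension explicit makes second derivatives along the manifold available.\<close>

definition extends_on :: "'a::euclidean_space set \<Rightarrow> 'a set \<Rightarrow> ('a \<Rightarrow> 'b::real_normed_vector) \<Rightarrow> ('a \<Rightarrow> 'b) \<Rightarrow> bool" where
  "extends_on U S F f \<longleftrightarrow> open U \<and> S \<subseteq> U \<and> smooth_on U F \<and> (\<forall>x\<in>S. F x = f x)"

lemma smooth_map_iff: "smooth_map S f \<longleftrightarrow> (\<exists>U F. extends_on U S F f)"
  by (auto simp: smooth_map_def extends_on_def smooth_on_def)

lemma extends_on_inter: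
  assumes "extends_on U S F f" "open V" "S \<subseteq> V"
  shows "extends_on (U \<inter> V) S F f"
  using assms smooth_on_subset[of U F "U \<inter> V"] by (auto simp: extends_on_def)

lemma smooth_map_common_domain:
  assumes "smooth_map S f" "smooth_map S g"
  obtains U F G where "extends_on U S F f" "extends_on U S G g"
proof -
  obtain U F V G where F: "extends_on U S F f" and G: "extends_on V S G g"
    using assms by (auto simp: smooth_map_iff)
  have "open U" "S \<subseteq> U" "open V" "S \<subseteq> V" using F G by (simp_all add: extends_on_def)
  then show thesis
    using that[of "U \<inter> V" F G] extends_on_inter[OF F, of V] extends_on_inter[OF G, of U]
    by (simp add: Int_commute)
qed

lemma extends_on_has_derivative:
  assumes "extends_on U S F f" "x \<in> S"
  shows "(f has_derivative frechet_derivative F (at x)) (at x within S)"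
proof -
  have "(F has_derivative frechet_derivative F (at x)) (at x)"
    using assms by (intro smooth_on_has_derivative[of U]) (auto simp: extends_on_def)
  then have "(F has_derivative frechet_derivative F (at x)) (at x within S)"
    by (rule has_derivative_at_withinI)
  then show ?thesis
    by (rule has_derivative_transform_within[where d = 1]) (use assms in \<open>auto simp: extends_on_def\<close>)
qed

lemma smooth_map_has_derivative:
  assumes "smooth_map S f" "x \<in> S"
  obtains f' where "(f has_derivative f') (at x within S)" "\<And>v. v \<in> tangent_space S x \<Longrightarrow> dir_deriv S f x v = f' v"
  using assms extends_on_has_derivative dir_deriv_eq by (metis smooth_map_iff)

lemma dir_deriv_extends_on:
  assumes "extends_on U S F f" "x \<in> S" "v \<in> tangent_space S x"
  shows "dir_deriv S f x v = frechet_derivative F (at x) v"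
  using dir_deriv_eq[OF extends_on_has_derivative] assms by blast

lemma extends_on_add:
  "extends_on U S F f \<Longrightarrow> extends_on U S G g \<Longrightarrow> extends_on U S (\<lambda>x. F x + G x) (\<lambda>x. f x + g x)"
  unfolding extends_on_def by (auto intro: smooth_on_add)

lemma extends_on_bilinear:
  assumes "bounded_bilinear h" "extends_on U S F f" "extends_on U S G g"
  shows "extends_on U S (\<lambda>x. h (F x) (G x)) (\<lambda>x. h (f x) (g x))"
  using assms smooth_on_bilinear[OF _ assms(1), of U F G] unfolding extends_on_def by auto

lemma smooth_map_const: "smooth_map S (\<lambda>x. c)"
  unfolding smooth_map_iff extends_on_def by (intro exI[of _ UNIV] exI[of _ "\<lambda>x. c"]) (simp add: smooth_on_const)

lemma smooth_map_add:
  assumes "smooth_map S f" "smooth_map S g"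
  shows "smooth_map S (\<lambda>x. f x + g x)"
  using assms smooth_map_common_domain extends_on_add by (metis smooth_map_iff)

lemma smooth_map_bilinear:
  assumes "bounded_bilinear h" "smooth_map S f" "smooth_map S g"
  shows "smooth_map S (\<lambda>x. h (f x) (g x))"
proof -
  obtain U F G where "extends_on U S F f" "extends_on U S G g"
    using smooth_map_common_domain assms by blast
  from extends_on_bilinear[OF assms(1) this] show ?thesis by (auto simp: smooth_map_iff)
qed

lemma smooth_map_cong:
  assumes "smooth_map S f" "\<And>x. x \<in> S \<Longrightarrow> f x = g x"
  shows "smooth_map S g"
proof -
  obtain U F where "extends_on U S F f" using assms(1) by (auto simp: smooth_map_iff)
  then have "extends_on U S F g" using assms(2) by (simp add: extends_on_def)
  then show ?thesis by (auto simp: smooth_map_iff)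
qed

text \<open>A derivative within \<open>S\<close> sees values on \<open>S\<close> only. This permits
  differentiating a constraint that holds on the manifold and nowhere else.\<close>

lemma dir_deriv_cong:
  assumes "\<And>z. z \<in> S \<Longrightarrow> f z = g z" "x \<in> S"
  shows "dir_deriv S f x v = dir_deriv S g x v"
proof -
  have "(f has_derivative D) (at x within S) = (g has_derivative D) (at x within S)" for D
    using assms has_derivative_transform[of x S] by metis
  then show ?thesis by (simp add: dir_deriv_def frechet_derivative_def)
qed

text \<open>Provides the ambient extension that is required to differentiate a derivative a second
  time.\<close>

lemma dir_deriv_field_extends_on:
  assumes "extends_on U S F f" "extends_on U S V X" "\<And>x. x \<in> S \<Longrightarrow> X x \<in> tangent_space S x"
  shows "extends_on U S (\<lambda>x. frechet_derivative F (at x) (V x)) (\<lambda>x. dir_deriv S f x (X x))"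
  unfolding extends_on_def
proof (intro conjI ballI)
  fix x assume x: "x \<in> S"
  show "frechet_derivative F (at x) (V x) = dir_deriv S f x (X x)"
    using dir_deriv_extends_on[OF assms(1) x assms(3)[OF x]] x assms(2) by (simp add: extends_on_def)
qed (use assms smooth_on_frechet_derivative_field in \<open>auto simp: extends_on_def\<close>)

lemma vector_fields_iff:
  "X \<in> vector_fields S \<longleftrightarrow>
    smooth_map S X \<and> (\<forall>x\<in>S. X x \<in> tangent_space S x) \<and> (\<forall>x. x \<notin> S \<longrightarrow> X x = 0)"
  by (simp add: vector_fields_def)

lemma dir_deriv_add_direction:
  assumes "smooth_map S f" "x \<in> S" "subspace (tangent_space S x)"
    and "u \<in> tangent_space S x" "v \<in> tangent_space S x"
  shows "dir_deriv S f x (u + v) = dir_deriv S f x u + dir_deriv S f x v"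
proof -
  obtain f' where f': "(f has_derivative f') (at x within S)"
    "\<And>v. v \<in> tangent_space S x \<Longrightarrow> dir_deriv S f x v = f' v"
    using smooth_map_has_derivative assms(1,2) by blast
  then show ?thesis
    using assms(3-5) by (simp add: subspace_add linear_add[OF has_derivative_linear])
qed

lemma dir_deriv_scaleR_direction:
  assumes "smooth_map S f" "x \<in> S" "subspace (tangent_space S x)" "u \<in> tangent_space S x"
  shows "dir_deriv S f x (c *\<^sub>R u) = c *\<^sub>R dir_deriv S f x u"
proof -
  obtain f' where f': "(f has_derivative f') (at x within S)"
    "\<And>v. v \<in> tangent_space S x \<Longrightarrow> dir_deriv S f x v = f' v"
    using smooth_map_has_derivative assms(1,2) by blast
  then show ?thesis
    using assms(3,4) by (simp add: subspace_scale linear_scale[OF has_derivative_linear])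
qed

lemma dir_deriv_add:
  assumes "smooth_map S f" "smooth_map S g" "x \<in> S" "u \<in> tangent_space S x"
  shows "dir_deriv S (\<lambda>z. f z + g z) x u = dir_deriv S f x u + dir_deriv S g x u"
proof -
  obtain f' where f': "(f has_derivative f') (at x within S)" "dir_deriv S f x u = f' u"
    using smooth_map_has_derivative assms by metis
  obtain g' where g': "(g has_derivative g') (at x within S)" "dir_deriv S g x u = g' u"
    using smooth_map_has_derivative assms by metis
  from dir_deriv_eq[OF has_derivative_add[OF f'(1) g'(1)] assms(4)] show ?thesis
    using f' g' by simp
qed

lemma dir_deriv_bilinear:
  assumes "bounded_bilinear h" "smooth_map S f" "smooth_map S g" "x \<in> S" "u \<in> tangent_space S x"
  shows "dir_deriv S (\<lambda>z. h (f z) (g z)) x u = h (f x) (dir_deriv S g x u) + h (dir_deriv S f x u) (g x)"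
proof -
  obtain f' where f': "(f has_derivative f') (at x within S)" "dir_deriv S f x u = f' u"
    using smooth_map_has_derivative assms by metis
  obtain g' where g': "(g has_derivative g') (at x within S)" "dir_deriv S g x u = g' u"
    using smooth_map_has_derivative assms by metis
  from dir_deriv_eq[OF bounded_bilinear.FDERIV[OF assms(1) f'(1) g'(1)] assms(5)] show ?thesis
    using f' g' by simp
qed

section \<open>Existence, uniqueness and curvature of a connection given in ambient
  coordinates\<close>

lemma is_levi_civita_metric:
  assumes "is_levi_civita S g D" "X \<in> vector_fields S" "Y \<in> vector_fields S" "Z \<in> vector_fields S" "x \<in> S"
  shows "dir_deriv S (\<lambda>z. g z (Y z) (Z z)) x (X x) = g x (D X Y x) (Z x) + g x (Y x) (D X Z x)"
proof -
  have "\<forall>X\<in>vector_fields S. \<forall>Y\<in>vector_fields S. \<forall>Z\<in>vector_fields S. \<forall>x\<in>S.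
      dir_deriv S (\<lambda>z. g z (Y z) (Z z)) x (X x) = g x (D X Y x) (Z x) + g x (Y x) (D X Z x)"
    using assms(1) unfolding is_levi_civita_def by (elim conjE) assumption
  then show ?thesis using assms(2-5) by blast
qed

lemma is_levi_civita_default:
  assumes "is_levi_civita S g D" "X \<notin> vector_fields S \<or> Z \<notin> vector_fields S"
  shows "D X Z = (\<lambda>x. 0)"
proof -
  have "\<forall>X Z. X \<notin> vector_fields S \<or> Z \<notin> vector_fields S \<longrightarrow> D X Z = (\<lambda>x. 0)"
    using assms(1) unfolding is_levi_civita_def by (elim conjE) assumption
  then show ?thesis using assms(2) by blast
qed

text \<open>\<open>G\<close> is the correction added to the ambient derivative, and
  \<open>DG x z\<close> its derivative in the base point along \<open>z\<close>. Symmetry of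
  \<open>G\<close> gives vanishing torsion; \<open>G_tangent\<close> and \<open>G_metric\<close> say
  that the corrected derivative is tangent and respects the metric. \<open>extend_tangent\<close>
  keeps the quantification over extending fields in the pointwise curvature from being
  vacuous.\<close>

locale embedded_connection =
  fixes S :: "'a::euclidean_space set"
    and g :: "'a \<Rightarrow> 'a \<Rightarrow> 'a \<Rightarrow> real"
    and G :: "'a \<Rightarrow> 'a \<Rightarrow> 'a \<Rightarrow> 'a"
    and DG :: "'a \<Rightarrow> 'a \<Rightarrow> 'a \<Rightarrow> 'a \<Rightarrow> 'a"
  assumes subspace_tangent_space: "x \<in> S \<Longrightarrow> subspace (tangent_space S x)"
    and extend_tangent: "x \<in> S \<Longrightarrow> u \<in> tangent_space S x \<Longrightarrow> \<exists>X\<in>vector_fields S. X x = u"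
    and g_bilinear: "bounded_bilinear (g x)"
    and g_sym: "g x u v = g x v u"
    and g_definite: "x \<in> S \<Longrightarrow> u \<in> tangent_space S x \<Longrightarrow> g x u u = 0 \<Longrightarrow> u = 0"
    and G_bilinear: "bounded_bilinear (G x)"
    and G_sym: "G x u v = G x v u"
    and G_smooth: "smooth_on UNIV (\<lambda>x. G x u v)"
    and G_derivative: "((\<lambda>x. G x u v) has_derivative (\<lambda>z. DG x z u v)) (at x)"
    and G_tangent: "x \<in> S \<Longrightarrow> u \<in> tangent_space S x \<Longrightarrow> Z \<in> vector_fields S \<Longrightarrow>
      dir_deriv S Z x u + G x u (Z x) \<in> tangent_space S x"
    and G_metric: "x \<in> S \<Longrightarrow> u \<in> tangent_space S x \<Longrightarrow> Y \<in> vector_fields S \<Longrightarrow> Z \<in> vector_fields S \<Longrightarrow>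
      dir_deriv S (\<lambda>z. g z (Y z) (Z z)) x u =
        g x (dir_deriv S Y x u + G x u (Y x)) (Z x) + g x (Y x) (dir_deriv S Z x u + G x u (Z x))"
begin

text \<open>The value 0 outside the intended arguments is the convention under which the Levi-Civita
  connection is unique as a total function.\<close>

definition cov :: "('a \<Rightarrow> 'a) \<Rightarrow> ('a \<Rightarrow> 'a) \<Rightarrow> 'a \<Rightarrow> 'a" where
  "cov X Z x = (if X \<in> vector_fields S \<and> Z \<in> vector_fields S \<and> x \<in> S
     then dir_deriv S Z x (X x) + G x (X x) (Z x) else 0)"

lemma vector_field_tangent: "X \<in> vector_fields S \<Longrightarrow> x \<in> S \<Longrightarrow> X x \<in> tangent_space S x"
  and vector_field_smooth: "X \<in> vector_fields S \<Longrightarrow> smooth_map S X"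
  and vector_field_outside: "X \<in> vector_fields S \<Longrightarrow> x \<notin> S \<Longrightarrow> X x = 0"
  by (simp_all add: vector_fields_iff)

lemma vector_fields_add:
  assumes "X \<in> vector_fields S" "Y \<in> vector_fields S"
  shows "(\<lambda>x. X x + Y x) \<in> vector_fields S"
  using assms by (simp add: vector_fields_iff smooth_map_add subspace_add[OF subspace_tangent_space])

lemma vector_fields_scale:
  fixes f :: "'a \<Rightarrow> real"
  assumes "smooth_map S f" "X \<in> vector_fields S"
  shows "(\<lambda>x. f x *\<^sub>R X x) \<in> vector_fields S"
  using assms smooth_map_bilinear[OF bounded_bilinear_scaleR, of S f X]
  by (simp add: vector_fields_iff subspace_scale[OF subspace_tangent_space])

lemma vector_fields_diff:
  assumes "X \<in> vector_fields S" "Y \<in> vector_fields S"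
  shows "(\<lambda>x. X x - Y x) \<in> vector_fields S"
  using vector_fields_add[OF assms(1) vector_fields_scale[OF smooth_map_const[of S "-1"] assms(2)]]
  by simp

text \<open>Reduces \<open>G\<close> at moving vectors to the coefficient functions
  \<open>G x b c\<close> with constant arguments, the ones whose smoothness and derivative are
  given.\<close>

lemma G_basis_sum: "G x v w = (\<Sum>b\<in>Basis. \<Sum>c\<in>Basis. ((v \<bullet> b) * (w \<bullet> c)) *\<^sub>R G x b c)"
proof -
  interpret bounded_bilinear "G x" by (rule G_bilinear)
  have "G x v w = G x (\<Sum>b\<in>Basis. (v \<bullet> b) *\<^sub>R b) (\<Sum>c\<in>Basis. (w \<bullet> c) *\<^sub>R c)"
    by (simp only: euclidean_representation)
  also have "\<dots> = (\<Sum>b\<in>Basis. \<Sum>c\<in>Basis. ((v \<bullet> b) * (w \<bullet> c)) *\<^sub>R G x b c)"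
    unfolding sum_left scaleR_left by (simp add: sum_right scaleR_right scaleR_sum_right)
  finally show ?thesis .
qed

text \<open>Bilinearity of \<open>DG\<close> in its last two arguments is inherited from
  \<open>G\<close>: differentiate the basis expansion of \<open>G\<close> and compare
  derivatives.\<close>

lemma DG_basis_sum: "DG x z v w = (\<Sum>b\<in>Basis. \<Sum>c\<in>Basis. ((v \<bullet> b) * (w \<bullet> c)) *\<^sub>R DG x z b c)"
proof -
  have "((\<lambda>x. \<Sum>b\<in>Basis. \<Sum>c\<in>Basis. ((v \<bullet> b) * (w \<bullet> c)) *\<^sub>R G x b c) has_derivative
      (\<lambda>z. \<Sum>b\<in>Basis. \<Sum>c\<in>Basis. ((v \<bullet> b) * (w \<bullet> c)) *\<^sub>R DG x z b c)) (at x)"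
    by (intro has_derivative_sum has_derivative_scaleR_right G_derivative)
  then have "((\<lambda>x. G x v w) has_derivative
      (\<lambda>z. \<Sum>b\<in>Basis. \<Sum>c\<in>Basis. ((v \<bullet> b) * (w \<bullet> c)) *\<^sub>R DG x z b c)) (at x)"
    by (simp only: G_basis_sum[symmetric])
  from has_derivative_unique[OF G_derivative this] show ?thesis by meson
qed

lemma smooth_on_G:
  assumes "open U" "smooth_on U V" "smooth_on U W"
  shows "smooth_on U (\<lambda>x. G x (V x) (W x))"
proof (rule smooth_on_cong[OF assms(1)])
  show "smooth_on U (\<lambda>x. \<Sum>b\<in>Basis. \<Sum>c\<in>Basis. ((V x \<bullet> b) * (W x \<bullet> c)) *\<^sub>R G x b c)"
    using assms(2,3)
    by (intro smooth_on_sum assms(1) smooth_on_bilinear[OF assms(1) bounded_bilinear_scaleR]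
        smooth_on_bilinear[OF assms(1) bounded_bilinear_mult] smooth_on_const
        smooth_on_bilinear[OF assms(1) bounded_bilinear_inner] smooth_on_subset[OF G_smooth subset_UNIV])
qed (rule G_basis_sum[symmetric])

lemma has_derivative_G:
  assumes V: "(V has_derivative V') (at x)" and W: "(W has_derivative W') (at x)"
  shows "((\<lambda>z. G z (V z) (W z)) has_derivative
    (\<lambda>u. DG x u (V x) (W x) + G x (V' u) (W x) + G x (V x) (W' u))) (at x)"
proof -
  have "((\<lambda>z. \<Sum>b\<in>Basis. \<Sum>c\<in>Basis. ((V z \<bullet> b) * (W z \<bullet> c)) *\<^sub>R G z b c) has_derivative
     (\<lambda>u. \<Sum>b\<in>Basis. \<Sum>c\<in>Basis. ((V x \<bullet> b) * (W x \<bullet> c)) *\<^sub>R DG x u b c +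
        ((V x \<bullet> b) * (W' u \<bullet> c) + (V' u \<bullet> b) * (W x \<bullet> c)) *\<^sub>R G x b c)) (at x)"
    by (intro has_derivative_sum has_derivative_scaleR has_derivative_mult has_derivative_inner_left
        G_derivative V W)
  also have "(\<lambda>u. \<Sum>b\<in>Basis. \<Sum>c\<in>Basis. ((V x \<bullet> b) * (W x \<bullet> c)) *\<^sub>R DG x u b c +
        ((V x \<bullet> b) * (W' u \<bullet> c) + (V' u \<bullet> b) * (W x \<bullet> c)) *\<^sub>R G x b c) =
     (\<lambda>u. DG x u (V x) (W x) + G x (V' u) (W x) + G x (V x) (W' u))"
    unfolding DG_basis_sum[of x _ "V x" "W x"] G_basis_sum[of x "V' _" "W x"] G_basis_sum[of x "V x" "W' _"]
    by (simp add: scaleR_add_left sum.distrib add_ac)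
  finally show ?thesis by (simp only: G_basis_sum[symmetric])
qed

lemma extends_on_cov:
  assumes "X \<in> vector_fields S" "Z \<in> vector_fields S" "extends_on U S V X" "extends_on U S H Z"
  shows "extends_on U S (\<lambda>x. frechet_derivative H (at x) (V x) + G x (V x) (H x)) (cov X Z)"
proof -
  have "extends_on U S (\<lambda>x. frechet_derivative H (at x) (V x)) (\<lambda>x. dir_deriv S Z x (X x))"
    by (intro dir_deriv_field_extends_on assms vector_field_tangent)
  moreover have "extends_on U S (\<lambda>x. G x (V x) (H x)) (\<lambda>x. G x (X x) (Z x))"
    using assms(3,4) by (auto simp: extends_on_def intro: smooth_on_G)
  ultimately have "extends_on U S (\<lambda>x. frechet_derivative H (at x) (V x) + G x (V x) (H x))
      (\<lambda>x. dir_deriv S Z x (X x) + G x (X x) (Z x))"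
    by (rule extends_on_add)
  then show ?thesis using assms(1,2) by (simp add: extends_on_def cov_def)
qed

lemma cov_vector_field:
  assumes "X \<in> vector_fields S" "Z \<in> vector_fields S"
  shows "cov X Z \<in> vector_fields S"
proof -
  obtain U V H where "extends_on U S V X" "extends_on U S H Z"
    using smooth_map_common_domain vector_field_smooth assms by blast
  from extends_on_cov[OF assms this] have "smooth_map S (cov X Z)"
    by (auto simp: smooth_map_iff)
  then show ?thesis
    using assms G_tangent vector_field_tangent by (auto simp: vector_fields_iff[of "cov X Z"] cov_def)
qed

lemma lie_bracket_eq_cov:
  assumes "X \<in> vector_fields S" "Y \<in> vector_fields S"
  shows "lie_bracket S X Y x = cov X Y x - cov Y X x"
  using assms by (auto simp: lie_bracket_def cov_def G_sym[of x "Y x"])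

text \<open>The ambient derivatives in the bracket need not be tangent one by one. Adding the
  symmetric \<open>G\<close> to both leaves the difference unchanged and makes each of them
  tangent.\<close>

lemma lie_bracket_vector_field:
  assumes "X \<in> vector_fields S" "Y \<in> vector_fields S"
  shows "lie_bracket S X Y \<in> vector_fields S"
proof -
  have "lie_bracket S X Y = (\<lambda>x. cov X Y x - cov Y X x)"
    by (rule ext) (rule lie_bracket_eq_cov[OF assms])
  then show ?thesis by (simp add: vector_fields_diff cov_vector_field assms)
qed

lemma is_levi_civita_cov: "is_levi_civita S g cov"
  unfolding is_levi_civita_def
proof (intro conjI ballI allI impI)
  fix X Z
  assume "X \<notin> vector_fields S \<or> Z \<notin> vector_fields S"
  then show "cov X Z = (\<lambda>x. 0)" by (auto simp: cov_def)
next
  fix X Z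
  assume "X \<in> vector_fields S" "Z \<in> vector_fields S"
  then show "cov X Z \<in> vector_fields S" by (rule cov_vector_field)
next
  fix X Y Z
  assume *: "X \<in> vector_fields S" "Y \<in> vector_fields S" "Z \<in> vector_fields S"
  then show "cov (\<lambda>x. X x + Y x) Z = (\<lambda>x. cov X Z x + cov Y Z x)"
    using dir_deriv_add_direction[OF vector_field_smooth[OF *(3)] _ subspace_tangent_space]
    by (intro ext) (simp add: cov_def vector_fields_add vector_field_tangent
        bounded_bilinear.add_left[OF G_bilinear])
next
  fix f :: "'a \<Rightarrow> real" and X Z
  assume *: "smooth_map S f" "X \<in> vector_fields S" "Z \<in> vector_fields S"
  then show "cov (\<lambda>x. f x *\<^sub>R X x) Z = (\<lambda>x. f x *\<^sub>R cov X Z x)"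
    using dir_deriv_scaleR_direction[OF vector_field_smooth[OF *(3)] _ subspace_tangent_space]
    by (intro ext) (simp add: cov_def vector_fields_scale vector_field_tangent scaleR_add_right
        bounded_bilinear.scaleR_left[OF G_bilinear])
next
  fix X Y Z
  assume *: "X \<in> vector_fields S" "Y \<in> vector_fields S" "Z \<in> vector_fields S"
  then show "cov X (\<lambda>x. Y x + Z x) = (\<lambda>x. cov X Y x + cov X Z x)"
    using dir_deriv_add[OF vector_field_smooth[OF *(2)] vector_field_smooth[OF *(3)]]
    by (intro ext) (simp add: cov_def vector_fields_add vector_field_tangent
        bounded_bilinear.add_right[OF G_bilinear])
next
  fix f :: "'a \<Rightarrow> real" and X Z
  assume *: "smooth_map S f" "X \<in> vector_fields S" "Z \<in> vector_fields S"
  show "cov X (\<lambda>x. f x *\<^sub>R Z x) = (\<lambda>x. dir_deriv S f x (X x) *\<^sub>R Z x + f x *\<^sub>R cov X Z x)"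
  proof
    fix x
    show "cov X (\<lambda>x. f x *\<^sub>R Z x) x = dir_deriv S f x (X x) *\<^sub>R Z x + f x *\<^sub>R cov X Z x"
    proof (cases "x \<in> S")
      case True
      then show ?thesis
        using * dir_deriv_bilinear[OF bounded_bilinear_scaleR *(1) vector_field_smooth[OF *(3)] True
            vector_field_tangent[OF *(2) True]]
        by (simp add: cov_def vector_fields_scale scaleR_add_right
            bounded_bilinear.scaleR_right[OF G_bilinear])
    \<comment> \<open>Off \<open>S\<close> the value of \<open>dir_deriv\<close> is arbitrary, but
      it multiplies \<open>Z x = 0\<close>.\<close>
    qed (simp add: cov_def vector_field_outside[OF *(3)])
  qed
next
  fix X Y x
  assume "X \<in> vector_fields S" "Y \<in> vector_fields S"
  then show "cov X Y x - cov Y X x = lie_bracket S X Y x" by (simp add: lie_bracket_eq_cov)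
next
  fix X Y Z x
  assume "X \<in> vector_fields S" "Y \<in> vector_fields S" "Z \<in> vector_fields S" "x \<in> S"
  then show "dir_deriv S (\<lambda>z. g z (Y z) (Z z)) x (X x) = g x (cov X Y x) (Z x) + g x (Y x) (cov X Z x)"
    using G_metric vector_field_tangent by (simp add: cov_def)
qed

text \<open>The difference \<open>?T\<close> of the two connections is symmetric because both have
  the same torsion, and skew because both respect the metric. Since \<open>D X Y\<close> and
  \<open>D' X Y\<close> are vector fields themselves, they may be inserted for \<open>Z\<close>; so
  \<open>?T X Y\<close> is orthogonal to itself and vanishes by definiteness on the tangent
  space.\<close>

lemma is_levi_civita_unique:
  assumes D: "is_levi_civita S g D" and D': "is_levi_civita S g D'"
  shows "D = D'"
proof (intro ext)
  fix X Y x
  have vf: "D X Y \<in> vector_fields S" "D' X Y \<in> vector_fields S"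
    if "X \<in> vector_fields S" "Y \<in> vector_fields S" for X Y
    using D D' that unfolding is_levi_civita_def by simp_all
  have torsion: "D X Y x - D Y X x = D' X Y x - D' Y X x"
    if "X \<in> vector_fields S" "Y \<in> vector_fields S" for X Y
    using D D' that unfolding is_levi_civita_def by simp
  have metric: "g x (D X Y x) (Z x) + g x (Y x) (D X Z x) = g x (D' X Y x) (Z x) + g x (Y x) (D' X Z x)"
    if "X \<in> vector_fields S" "Y \<in> vector_fields S" "Z \<in> vector_fields S" "x \<in> S" for X Y Z
    using is_levi_civita_metric[OF D that] is_levi_civita_metric[OF D' that] by simp
  let ?T = "\<lambda>X Y. D X Y x - D' X Y x"
  interpret g: bounded_bilinear "g x" by (rule g_bilinear)
  show "D X Y x = D' X Y x"
  proof (cases "X \<in> vector_fields S \<and> Y \<in> vector_fields S \<and> x \<in> S")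
    case True
    then have X: "X \<in> vector_fields S" and Y: "Y \<in> vector_fields S" and x: "x \<in> S" by auto
    have sym: "?T X Y = ?T Y X" if "X \<in> vector_fields S" "Y \<in> vector_fields S" for X Y
      using torsion[OF that] by (simp add: algebra_simps)
    have skew: "g x (?T X Y) (Z x) = - g x (?T X Z) (Y x)"
      if "X \<in> vector_fields S" "Y \<in> vector_fields S" "Z \<in> vector_fields S" for X Y Z
      using metric[OF that x] by (simp add: g.diff_left g_sym[of x "Y x"])
    \<comment> \<open>A trilinear form that is symmetric in two slots and skew in two others vanishes.\<close>
    have zero: "g x (?T X Y) (Z x) = 0" if Z: "Z \<in> vector_fields S" for Z
    proof -
      have "g x (?T X Y) (Z x) = - g x (?T Z X) (Y x)" by (simp only: skew[OF X Y Z] sym[OF X Z])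
      also have "\<dots> = g x (?T Y Z) (X x)" by (simp only: skew[OF Z X Y] sym[OF Z Y] minus_minus)
      also have "\<dots> = - g x (?T X Y) (Z x)" by (simp only: skew[OF Y Z X] sym[OF Y X])
      finally show ?thesis by simp
    qed
    have "g x (?T X Y) (?T X Y) = 0"
      using zero[OF vf(1)[OF X Y]] zero[OF vf(2)[OF X Y]] by (simp add: g.diff_right)
    moreover have "?T X Y \<in> tangent_space S x"
      using vector_field_tangent[OF vector_fields_diff[OF vf[OF X Y]] x] .
    ultimately have "?T X Y = 0" using g_definite[OF x] by blast
    then show ?thesis by simp
  next
    case False
    show ?thesis
    proof (cases "X \<in> vector_fields S \<and> Y \<in> vector_fields S")
      case True
      with False have "x \<notin> S" by blast
      with True show ?thesis by (simp add: vector_field_outside vf)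
    next
      case False
      then show ?thesis using is_levi_civita_default[OF D] is_levi_civita_default[OF D'] by simp
    qed
  qed
qed

lemma levi_civita_eq_cov: "levi_civita S g = cov"
  unfolding levi_civita_def
  using is_levi_civita_cov is_levi_civita_unique by blast

lemma cov_cov:
  assumes fields: "X \<in> vector_fields S" "Y \<in> vector_fields S" "Z \<in> vector_fields S"
    and ext: "extends_on U S V X" "extends_on U S W Y" "extends_on U S H Z" and x: "x \<in> S"
  shows "cov X (cov Y Z) x =
    frechet_derivative (\<lambda>z. frechet_derivative H (at z) (Y x)) (at x) (X x)
    + frechet_derivative H (at x) (dir_deriv S Y x (X x))
    + DG x (X x) (Y x) (Z x) + G x (dir_deriv S Y x (X x)) (Z x)
    + G x (Y x) (dir_deriv S Z x (X x))
    + G x (X x) (dir_deriv S Z x (Y x)) + G x (X x) (G x (Y x) (Z x))"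
proof -
  have U: "open U" "x \<in> U" and sm: "smooth_on U W" "smooth_on U H" and val: "W x = Y x" "H x = Z x"
    using ext x by (auto simp: extends_on_def)
  have W: "(W has_derivative frechet_derivative W (at x)) (at x)"
    and H: "(H has_derivative frechet_derivative H (at x)) (at x)"
    using smooth_on_has_derivative U sm by blast+
  have Xx: "X x \<in> tangent_space S x" using vector_field_tangent fields x by blast
  note dd = dir_deriv_extends_on[OF ext(2) x Xx] dir_deriv_extends_on[OF ext(3) x Xx]
  have "((\<lambda>z. frechet_derivative H (at z) (W z) + G z (W z) (H z)) has_derivative
     (\<lambda>u. (frechet_derivative (\<lambda>z. frechet_derivative H (at z) (W x)) (at x) u
        + frechet_derivative H (at x) (frechet_derivative W (at x) u))
      + (DG x u (W x) (H x) + G x (frechet_derivative W (at x) u) (H x)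
        + G x (W x) (frechet_derivative H (at x) u)))) (at x)"
    by (intro has_derivative_add has_derivative_frechet_derivative_field[OF U sm(2) W]
        has_derivative_G W H)
  note d = frechet_derivative_at[OF this, symmetric]
  have "dir_deriv S (cov Y Z) x (X x) =
    frechet_derivative (\<lambda>z. frechet_derivative H (at z) (Y x)) (at x) (X x)
    + frechet_derivative H (at x) (dir_deriv S Y x (X x))
    + DG x (X x) (Y x) (Z x) + G x (dir_deriv S Y x (X x)) (Z x)
    + G x (Y x) (dir_deriv S Z x (X x))"
    using dir_deriv_extends_on[OF extends_on_cov[OF fields(2,3) ext(2,3)] x Xx]
    by (simp add: d dd val add.assoc)
  then show ?thesis
    using fields x cov_vector_field[OF fields(2,3)]
    by (simp add: cov_def[of X "cov Y Z"] cov_def[of Y Z] bounded_bilinear.add_right[OF G_bilinear] add.assoc)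
qed

text \<open>The bracket term removes everything that contains a derivative of \<open>X\<close> or
  \<open>Y\<close>. The mixed terms \<open>G (Y, Z' X)\<close> and \<open>G (X, Z' Y)\<close> occur
  in both iterated derivatives and cancel, and the second derivatives of \<open>Z\<close> cancel by
  symmetry.\<close>

lemma curvature_field_eq:
  assumes fields: "X \<in> vector_fields S" "Y \<in> vector_fields S" "Z \<in> vector_fields S" and x: "x \<in> S"
  shows "curvature_field S g X Y Z x =
    DG x (Y x) (X x) (Z x) - DG x (X x) (Y x) (Z x)
    - G x (X x) (G x (Y x) (Z x)) + G x (Y x) (G x (X x) (Z x))"
proof -
  obtain U1 V W where VW: "extends_on U1 S V X" "extends_on U1 S W Y"
    using smooth_map_common_domain vector_field_smooth fields by blast
  obtain U2 H where H: "extends_on U2 S H Z"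
    using vector_field_smooth[OF fields(3)] by (auto simp: smooth_map_iff)
  define U where "U = U1 \<inter> U2"
  have "extends_on U S V X" "extends_on U S W Y" and "extends_on U S H Z"
    using VW H extends_on_inter[OF VW(1), of U2] extends_on_inter[OF VW(2), of U2] extends_on_inter[OF H, of U1]
    by (simp_all add: U_def Int_commute extends_on_def)
  note ext = this
  have U: "open U" "x \<in> U" and sm: "smooth_on U H" using ext x by (auto simp: extends_on_def)
  have tan: "X x \<in> tangent_space S x" "Y x \<in> tangent_space S x"
    "lie_bracket S X Y x \<in> tangent_space S x"
    using vector_field_tangent fields lie_bracket_vector_field x by blast+
  have lie: "cov (lie_bracket S X Y) Z x =
      frechet_derivative H (at x) (dir_deriv S Y x (X x)) - frechet_derivative H (at x) (dir_deriv S X x (Y x))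
      + G x (dir_deriv S Y x (X x)) (Z x) - G x (dir_deriv S X x (Y x)) (Z x)"
  proof -
    interpret H': bounded_linear "frechet_derivative H (at x)"
      using smooth_on_has_derivative[OF sm U(2)] by (rule has_derivative_bounded_linear)
    have "cov (lie_bracket S X Y) Z x =
        frechet_derivative H (at x) (lie_bracket S X Y x) + G x (lie_bracket S X Y x) (Z x)"
      using lie_bracket_vector_field[OF fields(1,2)] fields x dir_deriv_extends_on[OF ext(3) x tan(3)]
      by (simp add: cov_def)
    then show ?thesis
      using x by (simp add: lie_bracket_def H'.diff bounded_bilinear.diff_left[OF G_bilinear])
  qed
  have second: "frechet_derivative (\<lambda>z. frechet_derivative H (at z) (Y x)) (at x) (X x) =
      frechet_derivative (\<lambda>z. frechet_derivative H (at z) (X x)) (at x) (Y x)"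
    by (rule smooth_on_second_derivative_symmetric[OF U sm])
  show ?thesis
    unfolding curvature_field_def Let_def levi_civita_eq_cov lie
      cov_cov[OF fields(1,2,3) ext(1,2,3) x] cov_cov[OF fields(2,1,3) ext(2,1,3) x] second
    by (simp add: algebra_simps)
qed

text \<open>Existence of extending fields leaves the definite description at most one solution; the
  pointwise formula for the curvature of fields shows that there is one.\<close>

lemma riemann_curvature_eq:
  assumes x: "x \<in> S" and tan: "u \<in> tangent_space S x" "v \<in> tangent_space S x" "w \<in> tangent_space S x"
  shows "riemann_curvature S g x u v w =
    DG x v u w - DG x u v w - G x u (G x v w) + G x v (G x u w)"
  unfolding riemann_curvature_def
proof (rule the_equality)
  obtain X Y Z where "X \<in> vector_fields S" "X x = u" "Y \<in> vector_fields S" "Y x = v"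
    "Z \<in> vector_fields S" "Z x = w"
    using extend_tangent[OF x] tan by metis
  then show "r = DG x v u w - DG x u v w - G x u (G x v w) + G x v (G x u w)"
    if "\<forall>X\<in>vector_fields S. \<forall>Y\<in>vector_fields S. \<forall>Z\<in>vector_fields S.
        X x = u \<and> Y x = v \<and> Z x = w \<longrightarrow> curvature_field S g X Y Z x = r" for r
    using that curvature_field_eq x by metis
qed (use curvature_field_eq x in blast)

end

section \<open>Matrix algebra\<close>

lemma bounded_bilinear_matrix_mult:
  "bounded_bilinear ((**) :: real^'b^'a \<Rightarrow> real^'c^'b \<Rightarrow> real^'c^'a)"
  unfolding bilinear_conv_bounded_bilinear[symmetric] bilinear_def linear_iff
  by (auto simp: vec_eq_iff matrix_matrix_mult_def algebra_simps sum.distrib sum_distrib_left)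

lemmas matrix_mult_bilinear =
  bounded_bilinear.add_left[OF bounded_bilinear_matrix_mult]
  bounded_bilinear.add_right[OF bounded_bilinear_matrix_mult]
  bounded_bilinear.diff_left[OF bounded_bilinear_matrix_mult]
  bounded_bilinear.diff_right[OF bounded_bilinear_matrix_mult]
  bounded_bilinear.minus_left[OF bounded_bilinear_matrix_mult]
  bounded_bilinear.minus_right[OF bounded_bilinear_matrix_mult]
  bounded_bilinear.scaleR_left[OF bounded_bilinear_matrix_mult]
  bounded_bilinear.scaleR_right[OF bounded_bilinear_matrix_mult]
  bounded_bilinear.zero_left[OF bounded_bilinear_matrix_mult]
  bounded_bilinear.zero_right[OF bounded_bilinear_matrix_mult]

lemma transpose_add: "transpose (A + B) = transpose A + transpose (B :: real^'a^'b)"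
  and transpose_diff: "transpose (A - B) = transpose A - transpose B"
  and transpose_minus: "transpose (- A) = - transpose A"
  and transpose_scaleR: "transpose (c *\<^sub>R A) = c *\<^sub>R transpose A"
  and transpose_zero: "transpose (0 :: real^'a^'b) = 0"
  by (simp_all add: vec_eq_iff transpose_def)

lemma bounded_linear_transpose: "bounded_linear (transpose :: real^'a^'b \<Rightarrow> real^'b^'a)"
  unfolding linear_conv_bounded_linear[symmetric] linear_iff
  by (simp add: transpose_add transpose_scaleR)

text \<open>Normal form for noncommutative matrix polynomials: sums are distributed, transposes are
  pushed to the letters and products are associated to the left.\<close>

lemmas matrix_expand = matrix_mult_bilinear transpose_add transpose_diff transpose_minus
  transpose_scaleR transpose_zero transpose_transpose transpose_mat matrix_transpose_mul
  matrix_mul_assoc matrix_mul_lid matrix_mul_rid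

lemma trace_scaleR: "trace (c *\<^sub>R A) = c * trace (A :: real^'a^'a)"
  and trace_minus: "trace (- A) = - trace A"
  and trace_zero: "trace (0 :: real^'a^'a) = 0"
  by (simp_all add: trace_def sum_distrib_left sum_negf)

lemma trace_transpose: "trace (transpose A) = trace A"
  by (simp add: trace_def transpose_def)

lemma inner_matrix_eq_trace: "A \<bullet> B = trace (transpose A ** (B :: real^'a^'b))"
proof -
  have "A \<bullet> B = (\<Sum>i\<in>UNIV. \<Sum>j\<in>UNIV. A $ i $ j * B $ i $ j)" by (simp add: inner_vec_def)
  also have "\<dots> = (\<Sum>j\<in>UNIV. \<Sum>i\<in>UNIV. A $ i $ j * B $ i $ j)" by (rule sum.swap)
  finally show ?thesis by (simp add: trace_def matrix_matrix_mult_def transpose_def)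
qed

lemma inner_matrix_mult_left: "(A ** B) \<bullet> C = B \<bullet> (transpose A ** (C :: real^'a^'b))"
  by (simp add: inner_matrix_eq_trace matrix_transpose_mul matrix_mul_assoc)

lemma inner_matrix_mult_right: "(A ** B) \<bullet> C = A \<bullet> ((C :: real^'a^'b) ** transpose B)"
  using trace_mul_sym[of "transpose A ** C" "transpose B"]
  by (simp add: inner_matrix_eq_trace matrix_transpose_mul matrix_mul_assoc)

lemma inner_transpose: "transpose A \<bullet> transpose B = A \<bullet> (B :: real^'a^'b)"
  using trace_mul_sym[of A "transpose B"]
  by (simp add: inner_matrix_eq_trace[of "transpose A"] inner_commute[of A] inner_matrix_eq_trace[of B])

text \<open>Transposition preserves the inner product, fixes \<open>M\<close> and negates
  \<open>A\<close>, so the product equals its own negative.\<close>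

lemma inner_symmetric_antisymmetric:
  fixes A M :: "real^'a^'a"
  assumes "transpose M = M" "transpose A = - A"
  shows "M \<bullet> A = 0"
  using inner_transpose[of M A] assms by simp

lemma norm_matrix_sq: "(norm A)\<^sup>2 = trace (transpose A ** (A :: real^'a^'b))"
  by (simp add: power2_norm_eq_inner inner_matrix_eq_trace)

section \<open>The Stiefel manifold as a submanifold\<close>

lemma smooth_on_matrix_mult:
  fixes F :: "'e::euclidean_space \<Rightarrow> real^'b^'a" and H :: "'e \<Rightarrow> real^'c^'b"
  shows "smooth_on UNIV F \<Longrightarrow> smooth_on UNIV H \<Longrightarrow> smooth_on UNIV (\<lambda>x. F x ** H x)"
  by (rule smooth_on_bilinear[OF open_UNIV bounded_bilinear_matrix_mult])

lemma smooth_on_transpose: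
  fixes F :: "'e::euclidean_space \<Rightarrow> real^'b^'a"
  shows "smooth_on UNIV F \<Longrightarrow> smooth_on UNIV (\<lambda>x. transpose (F x))"
  by (rule smooth_on_compose_linear[OF open_UNIV bounded_linear_transpose])

lemma smooth_on_diff:
  assumes "open U" "smooth_on U f" "smooth_on U g"
  shows "smooth_on U (\<lambda>x. f x - g x)"
  using smooth_on_add[OF assms(1,2) smooth_on_compose_linear[OF assms(1) bounded_linear_minus[OF bounded_linear_ident] assms(3)]]
  by simp

lemma smooth_on_scaleR:
  "open U \<Longrightarrow> smooth_on U f \<Longrightarrow> smooth_on U (\<lambda>x. c *\<^sub>R f x)"
  by (rule smooth_on_compose_linear[OF _ bounded_linear_scaleR_right])

lemmas smooth_matrix_intros = smooth_on_matrix_mult smooth_on_transpose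
  smooth_on_diff[OF open_UNIV] smooth_on_add[OF open_UNIV] smooth_on_scaleR[OF open_UNIV]
  smooth_on_const smooth_on_bounded_linear[OF bounded_linear_ident]

lemma smooth_on_imp_smooth_map: "smooth_on UNIV f \<Longrightarrow> smooth_map S f"
  unfolding smooth_map_iff extends_on_def by (intro exI[of _ UNIV] exI[of _ f]) simp

lemmas has_derivative_matrix_mult = bounded_bilinear.FDERIV[OF bounded_bilinear_matrix_mult]
lemmas has_derivative_transpose = bounded_linear.has_derivative[OF bounded_linear_transpose]

section \<open>The tangent space, by way of Cayley curves\<close>

lemma stiefel_tangent_spaceD:
  assumes "Y \<in> stiefel" "v \<in> tangent_space stiefel Y"
  shows "transpose Y ** v + transpose v ** Y = 0"
proof -
  obtain c where c: "c 0 = Y" "range c \<subseteq> stiefel" "(c has_vector_derivative v) (at 0)"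
    using assms(2) by (auto simp: tangent_space_def)
  have d: "(c has_derivative (\<lambda>t. t *\<^sub>R v)) (at 0)"
    using c(3) by (simp add: has_vector_derivative_def)
  have "((\<lambda>t. transpose (c t) ** c t) has_derivative
      (\<lambda>t. transpose (c 0) ** (t *\<^sub>R v) + transpose (t *\<^sub>R v) ** c 0)) (at 0)"
    by (intro has_derivative_matrix_mult has_derivative_transpose d)
  moreover have "(\<lambda>t. transpose (c t) ** c t) = (\<lambda>t. mat 1)"
    using c(2) by (auto simp: stiefel_def)
  ultimately have "((\<lambda>t. mat 1) has_derivative
      (\<lambda>t. transpose (c 0) ** (t *\<^sub>R v) + transpose (t *\<^sub>R v) ** c 0)) (at 0)"
    by simp
  from fun_cong[OF has_derivative_unique[OF this has_derivative_const], of 1] show ?thesis by (simp add: c(1))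
qed

text \<open>For tangent \<open>v\<close>, an infinitesimal rotation that carries \<open>Y\<close> to
  \<open>v\<close>. The plain choice \<open>v ** transpose Y - Y ** transpose v\<close> would count
  the part of \<open>v\<close> in the column space of \<open>Y\<close> twice; the factor 1/2 in the
  projections corrects this.\<close>

definition skew_generator :: "real^'p^'n \<Rightarrow> real^'p^'n \<Rightarrow> real^'n^'n" where
  "skew_generator Y v =
     (mat 1 - (1/2) *\<^sub>R (Y ** transpose Y)) ** v ** transpose Y
     - Y ** transpose v ** (mat 1 - (1/2) *\<^sub>R (Y ** transpose Y))"

lemma skew_generator_antisymmetric: "transpose (skew_generator Y v) = - skew_generator Y v"
  by (simp add: skew_generator_def matrix_expand)

lemma skew_generator_mult:
  assumes Y: "Y \<in> stiefel" and v: "transpose Y ** v + transpose v ** Y = 0"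
  shows "skew_generator Y v ** Y = v"
proof -
  have YY: "M ** transpose Y ** Y = M" for M :: "real^'a^'c"
    using Y by (simp add: stiefel_def matrix_mul_assoc[symmetric])
  have vY: "transpose v ** Y = - (transpose Y ** v)"
    using v by (simp add: eq_neg_iff_add_eq_0 add.commute)
  have "skew_generator Y v ** Y = v - (1/2) *\<^sub>R (Y ** (transpose Y ** v)) - (1/2) *\<^sub>R (Y ** (transpose v ** Y))"
    by (simp add: skew_generator_def matrix_expand YY algebra_simps)
  then show ?thesis unfolding vY by (simp add: matrix_expand)
qed

text \<open>The quadratic form of an antisymmetric matrix vanishes, so \<open>W *v x = x\<close>
  forces \<open>x \<bullet> x = 0\<close>. A square matrix with trivial kernel is invertible on both
  sides.\<close>

lemma cayley_inverse:
  fixes W :: "real^'n^'n"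
  assumes "transpose W = - W"
  shows "\<exists>M. (mat 1 - W) ** M = mat 1 \<and> M ** (mat 1 - W) = mat 1"
proof -
  have "x = 0" if "(mat 1 - W) *v x = 0" for x
  proof -
    have "W *v x = x" using that by (simp add: matrix_vector_mult_diff_rdistrib)
    then have "x \<bullet> x = x \<bullet> (W *v x)" by simp
    also have "\<dots> = - (x \<bullet> (W *v x))"
    proof -
      have "x \<bullet> (W *v x) = (transpose W *v x) \<bullet> x"
        by (simp add: dot_lmul_matrix)
      also have "transpose W *v x = - (W *v x)"
        using matrix_vector_mult_diff_rdistrib[of 0 W x] by (simp add: assms)
      finally show ?thesis by (simp add: inner_commute)
    qed
    finally show ?thesis using \<open>W *v x = x\<close> by simp
  qed
  then obtain M where "M ** (mat 1 - W) = mat 1"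
    using matrix_left_invertible_ker by blast
  then show ?thesis using matrix_left_right_inverse by blast
qed

text \<open>The Cayley transform \<open>Q t\<close> of \<open>(t/2) *\<^sub>R W\<close> is
  orthogonal and has derivative \<open>W\<close> at 0, so \<open>Q t ** Y\<close> stays in the
  manifold. Its derivative is obtained from an exact quadratic remainder in which the inverse
  \<open>M t\<close> occurs, so a uniform bound on \<open>M t\<close> is enough.\<close>

lemma cayley_curve:
  fixes Y :: "real^'p^'n" and W :: "real^'n^'n"
  assumes Y: "Y \<in> stiefel" and W: "transpose W = - W"
  obtains c where "c 0 = Y" "range c \<subseteq> stiefel" "(c has_vector_derivative W ** Y) (at 0)"
proof -
  have "\<forall>t. \<exists>M. (mat 1 - (t/2) *\<^sub>R W) ** M = mat 1 \<and> M ** (mat 1 - (t/2) *\<^sub>R W) = mat 1"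
    by (intro allI cayley_inverse) (simp add: transpose_scaleR W)
  then obtain M where M: "\<And>t. (mat 1 - (t/2) *\<^sub>R W) ** M t = mat 1"
    "\<And>t. M t ** (mat 1 - (t/2) *\<^sub>R W) = mat 1" by metis
  define Q where "Q t = (mat 1 + (t/2) *\<^sub>R W) ** M t" for t
  have M_eq: "M t = mat 1 + (t/2) *\<^sub>R (W ** M t)" for t
    using M(1)[of t] by (simp add: matrix_mult_bilinear algebra_simps)
  have Q_eq: "Q t = mat 1 + t *\<^sub>R (W ** M t)" for t
  proof -
    have "Q t = M t + (t/2) *\<^sub>R (W ** M t)" by (simp add: Q_def matrix_mult_bilinear)
    also have "\<dots> = mat 1 + ((t/2) *\<^sub>R (W ** M t) + (t/2) *\<^sub>R (W ** M t))"
      by (subst (1) M_eq) (simp add: add.assoc)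
    finally show ?thesis by (simp add: scaleR_add_left[symmetric])
  qed
  \<comment> \<open>Expresses \<open>M t\<close> affinely by \<open>Q t\<close>, so that
    orthogonality of \<open>Q t\<close> bounds the norm of the inverse.\<close>
  have Q_M: "Q t = 2 *\<^sub>R M t - mat 1" for t
  proof -
    have "2 *\<^sub>R M t = M t + M t" by (simp add: scaleR_2)
    also have "\<dots> = (mat 1 + mat 1) + t *\<^sub>R (W ** M t)"
      by (subst (1 2) M_eq) (simp add: algebra_simps scaleR_add_left[symmetric])
    finally show ?thesis by (simp add: Q_eq)
  qed
  have orth: "transpose (Q t) ** Q t = mat 1" for t
  proof -
    let ?w = "(t/2) *\<^sub>R W"
    have "transpose (M t) ** (mat 1 + ?w) = transpose ((mat 1 - ?w) ** M t)"
      by (simp add: matrix_transpose_mul transpose_diff transpose_scaleR W)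
    then have M': "transpose (M t) ** (mat 1 + ?w) = mat 1" by (simp add: M)
    have "transpose (Q t) ** Q t = transpose (M t) ** ((mat 1 - ?w) ** (mat 1 + ?w)) ** M t"
      by (simp add: Q_def matrix_transpose_mul transpose_add transpose_scaleR W matrix_mul_assoc)
    \<comment> \<open>The factors commute as polynomials in \<open>W\<close>; after the exchange
      each one stands next to its inverse.\<close>
    also have "(mat 1 - ?w) ** (mat 1 + ?w) = (mat 1 + ?w) ** (mat 1 - ?w)"
      by (simp add: matrix_mult_bilinear scaleR_add_right scaleR_diff_right)
    also have "transpose (M t) ** ((mat 1 + ?w) ** (mat 1 - ?w)) ** M t
        = (transpose (M t) ** (mat 1 + ?w)) ** ((mat 1 - ?w) ** M t)"
      by (simp only: matrix_mul_assoc)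
    finally show ?thesis by (simp add: M M')
  qed
  have norm_M: "norm (M t) \<le> norm (mat 1 :: real^'n^'n)" for t
  proof -
    have "(norm (Q t))\<^sup>2 = (norm (mat 1 :: real^'n^'n))\<^sup>2" by (simp add: norm_matrix_sq orth)
    then have "norm (Q t) = norm (mat 1 :: real^'n^'n)" by simp
    moreover have "norm (2 *\<^sub>R M t) \<le> norm (Q t) + norm (mat 1 :: real^'n^'n)"
      using norm_triangle_ineq[of "Q t" "mat 1"] by (simp add: Q_M)
    ultimately show ?thesis by simp
  qed
  have "bounded_linear (\<lambda>M. W ** (W ** M) ** Y)"
    by (intro bounded_linear_compose[OF bounded_bilinear.bounded_linear_left[OF bounded_bilinear_matrix_mult]]
        bounded_linear_compose[OF bounded_bilinear.bounded_linear_right[OF bounded_bilinear_matrix_mult]]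
        bounded_linear_ident)
  then obtain K where K: "K \<ge> 0" "\<And>M. norm (W ** (W ** M) ** Y) \<le> norm M * K"
    using bounded_linear.nonneg_bounded by blast
  define C where "C = norm (mat 1 :: real^'n^'n) * K"
  define c where "c t = Q t ** Y" for t
  \<comment> \<open>Inserting \<open>M_eq\<close> once more into \<open>Q_eq\<close> gives the exact
    second-order term, with \<open>M t\<close> in place of its value at 0.\<close>
  have remainder: "c t - c 0 - t *\<^sub>R (W ** Y) = (t\<^sup>2 / 2) *\<^sub>R (W ** (W ** M t) ** Y)" for t
  proof -
    have "c t - c 0 - t *\<^sub>R (W ** Y) = t *\<^sub>R (W ** (M t - mat 1) ** Y)"
      by (simp add: c_def Q_eq matrix_mult_bilinear scaleR_diff_right)
    also have "M t - mat 1 = (t/2) *\<^sub>R (W ** M t)" by (subst M_eq) simp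
    finally show ?thesis by (simp add: matrix_mult_bilinear power2_eq_square)
  qed
  have "(c has_vector_derivative W ** Y) (at 0)"
    unfolding has_vector_derivative_def
  proof (rule has_derivativeI_sandwich[of 1])
    show "bounded_linear (\<lambda>x. x *\<^sub>R (W ** Y))" by (rule bounded_linear_scaleR_left)
    show "((\<lambda>t. C / 2 * \<bar>t\<bar>) \<longlongrightarrow> 0) (at 0)"
      by (auto intro!: tendsto_eq_intros)
    fix t :: real assume t: "t \<noteq> 0"
    have "norm (c t - c 0 - (t - 0) *\<^sub>R (W ** Y)) = t\<^sup>2 / 2 * norm (W ** (W ** M t) ** Y)"
      by (simp add: remainder)
    also have "\<dots> \<le> t\<^sup>2 / 2 * C"
      unfolding C_def using K(2)[of "M t"] mult_right_mono[OF norm_M[of t] K(1)]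
      by (intro mult_left_mono) auto
    finally show "norm (c t - c 0 - (t - 0) *\<^sub>R (W ** Y)) / norm (t - 0) \<le> C / 2 * \<bar>t\<bar>"
      using t by (simp add: divide_simps power2_eq_square abs_if split: if_splits) (simp_all add: mult_ac)
  qed simp
  moreover have "c 0 = Y" by (simp add: c_def Q_eq)
  moreover have "range c \<subseteq> stiefel"
  proof (clarsimp simp: stiefel_def c_def)
    fix t
    have "transpose (Q t ** Y) ** (Q t ** Y) = transpose Y ** (transpose (Q t) ** Q t) ** Y"
      by (simp only: matrix_transpose_mul matrix_mul_assoc)
    then show "transpose (Q t ** Y) ** (Q t ** Y) = mat 1" using Y by (simp add: orth stiefel_def)
  qed
  ultimately show thesis using that by blast
qed

lemma stiefel_tangent_space:
  assumes "Y \<in> stiefel"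
  shows "tangent_space stiefel Y = {v. transpose Y ** v + transpose v ** Y = 0}"
proof (intro set_eqI iffI)
  fix v :: "real^'a^'b"
  assume "v \<in> {v. transpose Y ** v + transpose v ** Y = 0}"
  then have v: "skew_generator Y v ** Y = v" using skew_generator_mult assms by blast
  show "v \<in> tangent_space stiefel Y"
  proof (rule cayley_curve[OF assms skew_generator_antisymmetric[of Y v]])
    fix c assume "c 0 = Y" "range c \<subseteq> stiefel" "(c has_vector_derivative skew_generator Y v ** Y) (at 0)"
    then show ?thesis unfolding tangent_space_def v by blast
  qed
qed (use assms stiefel_tangent_spaceD in blast)

section \<open>The Levi-Civita connection of the Stiefel manifold\<close>

text \<open>The first term is the Gauss-formula correction for the Euclidean metric, which is the
  case \<open>a = 1\<close> up to a scale. The second is the horizontal term due to the extra weight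
  of the metric on the part along \<open>Y\<close>. Both are polynomial in \<open>Y\<close>, hence
  smooth on all matrices.\<close>

definition stiefel_connection :: "real \<Rightarrow> real^'p^'n \<Rightarrow> real^'p^'n \<Rightarrow> real^'p^'n \<Rightarrow> real^'p^'n" where
  "stiefel_connection a Y u v =
     (1/2) *\<^sub>R (Y ** (transpose u ** v + transpose v ** u))
     + (1 - a) *\<^sub>R ((mat 1 - Y ** transpose Y) ** (u ** transpose v + v ** transpose u) ** Y)"

definition stiefel_connection_deriv ::
  "real \<Rightarrow> real^'p^'n \<Rightarrow> real^'p^'n \<Rightarrow> real^'p^'n \<Rightarrow> real^'p^'n \<Rightarrow> real^'p^'n" where
  "stiefel_connection_deriv a Y z u v =
     (1/2) *\<^sub>R (z ** (transpose u ** v + transpose v ** u))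
     - (1 - a) *\<^sub>R ((z ** transpose Y + Y ** transpose z) ** (u ** transpose v + v ** transpose u) ** Y)
     + (1 - a) *\<^sub>R ((mat 1 - Y ** transpose Y) ** (u ** transpose v + v ** transpose u) ** z)"

lemma stiefel_connection_sym: "stiefel_connection a Y u v = stiefel_connection a Y v u"
  by (simp add: stiefel_connection_def add.commute)

lemma bounded_bilinear_stiefel_connection: "bounded_bilinear (stiefel_connection a Y)"
  unfolding bilinear_conv_bounded_bilinear[symmetric] bilinear_def linear_iff stiefel_connection_def
  by (simp add: matrix_mult_bilinear transpose_add transpose_scaleR scaleR_add_right mult_ac add_ac)

lemma smooth_on_stiefel_connection: "smooth_on UNIV (\<lambda>Y. stiefel_connection a Y u v)"
  unfolding stiefel_connection_def by (intro smooth_matrix_intros)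

lemma stiefel_connection_has_derivative:
  "((\<lambda>Y. stiefel_connection a Y u v) has_derivative (\<lambda>z. stiefel_connection_deriv a Y z u v)) (at Y)"
  unfolding stiefel_connection_def
  by (rule has_derivative_eq_rhs,
      (rule has_derivative_add has_derivative_diff has_derivative_scaleR_right
        has_derivative_matrix_mult has_derivative_transpose has_derivative_const has_derivative_ident)+)
     (simp add: stiefel_connection_deriv_def fun_eq_iff matrix_mult_bilinear scaleR_add_right scaleR_diff_right)

lemma stiefel_metric_eq_inner:
  "stiefel_metric \<alpha>0 \<alpha>1 Y u v = \<alpha>0 * (u \<bullet> v) + (\<alpha>1 - \<alpha>0) * ((transpose Y ** u) \<bullet> (transpose Y ** v))"
  by (simp add: stiefel_metric_def inner_matrix_eq_trace matrix_transpose_mul matrix_mul_assoc)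

lemma bounded_bilinear_stiefel_metric: "bounded_bilinear (stiefel_metric \<alpha>0 \<alpha>1 Y)"
  unfolding bilinear_conv_bounded_bilinear[symmetric] bilinear_def linear_iff stiefel_metric_eq_inner
  by (simp add: matrix_mult_bilinear inner_simps algebra_simps)

lemma stiefel_metric_sym: "stiefel_metric \<alpha>0 \<alpha>1 Y u v = stiefel_metric \<alpha>0 \<alpha>1 Y v u"
  by (simp add: stiefel_metric_eq_inner inner_commute)

text \<open>The horizontal part of a tangent vector; it plays the role of the block \<open>B\<close> without a
  choice of orthogonal complement.\<close>

definition horizontal_part :: "real^'p^'n \<Rightarrow> real^'p^'n \<Rightarrow> real^'p^'n" where
  "horizontal_part Y v = v - Y ** (transpose Y ** v)"

lemma stiefel_cancel:
  assumes "Y \<in> stiefel"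
  shows "transpose Y ** Y = mat 1" "M ** transpose Y ** Y = M" "transpose Y ** (Y ** N) = N"
  proof -
  show YY: "transpose Y ** Y = mat 1" using assms by (simp add: stiefel_def)
  show "M ** transpose Y ** Y = M" by (simp add: matrix_mul_assoc[symmetric] YY)
  show "transpose Y ** (Y ** N) = N" by (simp add: matrix_mul_assoc YY)
qed

lemma horizontal_part_orthogonal:
  assumes "Y \<in> stiefel"
  shows "transpose Y ** horizontal_part Y v = 0" "transpose (horizontal_part Y v) ** Y = 0"
  by (simp_all add: horizontal_part_def matrix_expand stiefel_cancel[OF assms])

lemma tangent_decomposition: "v = Y ** (transpose Y ** v) + horizontal_part Y v"
  by (simp add: horizontal_part_def)

text \<open>By Pythagoras the Euclidean product splits into the part along \<open>Y\<close> and the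
  horizontal part; the part along \<open>Y\<close> collects the weight
  \<open>\<alpha>0 + (\<alpha>1 - \<alpha>0)\<close>.\<close>

lemma stiefel_metric_decomposition:
  assumes Y: "Y \<in> stiefel"
  shows "stiefel_metric \<alpha>0 \<alpha>1 Y u v =
    \<alpha>1 * ((transpose Y ** u) \<bullet> (transpose Y ** v)) + \<alpha>0 * (horizontal_part Y u \<bullet> horizontal_part Y v)"
proof -
  have "horizontal_part Y u \<bullet> horizontal_part Y v = u \<bullet> v - (transpose Y ** u) \<bullet> (transpose Y ** v)"
    by (simp add: horizontal_part_def inner_diff_left inner_diff_right inner_matrix_mult_left
        stiefel_cancel[OF Y] inner_commute[of u "Y ** _"])
  then show ?thesis unfolding stiefel_metric_eq_inner by (simp only:) (simp add: algebra_simps)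
qed

lemma stiefel_metric_definite:
  assumes Y: "Y \<in> stiefel" and pos: "\<alpha>0 > 0" "\<alpha>1 > 0" and zero: "stiefel_metric \<alpha>0 \<alpha>1 Y u u = 0"
  shows "u = 0"
proof -
  have "\<alpha>1 * ((transpose Y ** u) \<bullet> (transpose Y ** u)) + \<alpha>0 * (horizontal_part Y u \<bullet> horizontal_part Y u) = 0"
    using zero by (simp add: stiefel_metric_decomposition[OF Y])
  moreover have "\<alpha>1 * ((transpose Y ** u) \<bullet> (transpose Y ** u)) \<ge> 0"
    "\<alpha>0 * (horizontal_part Y u \<bullet> horizontal_part Y u) \<ge> 0"
    using pos by simp_all
  ultimately have "transpose Y ** u = 0" "horizontal_part Y u = 0"
    using pos by (simp_all add: add_nonneg_eq_0_iff)
  then show ?thesis using tangent_decomposition[of u Y] by (simp add: matrix_mult_bilinear)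
qed

lemma stiefel_tangent_iff:
  assumes "Y \<in> stiefel"
  shows "v \<in> tangent_space stiefel Y \<longleftrightarrow> transpose v ** Y = - (transpose Y ** v)"
  by (simp add: stiefel_tangent_space[OF assms] eq_neg_iff_add_eq_0 add.commute)

lemma transpose_decomposition:
  assumes Y: "Y \<in> stiefel" and u: "u \<in> tangent_space stiefel Y"
  shows "transpose u ** v = - (transpose Y ** u ** (transpose Y ** v)) + transpose (horizontal_part Y u) ** horizontal_part Y v"
proof -
  have "transpose u ** Y = - (transpose Y ** u)" using u by (simp add: stiefel_tangent_iff[OF Y])
  then have "transpose u ** (Y ** (transpose Y ** v)) = - (transpose Y ** u ** (transpose Y ** v))"
    by (simp add: matrix_mul_assoc matrix_mult_bilinear)
  then show ?thesis
    by (simp add: horizontal_part_def matrix_mult_bilinear transpose_diff matrix_transpose_mul stiefel_cancel[OF Y] matrix_mul_assoc[symmetric])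
qed

lemma stiefel_connection_components:
  assumes Y: "Y \<in> stiefel" and u: "u \<in> tangent_space stiefel Y" and v: "v \<in> tangent_space stiefel Y"
  shows "transpose Y ** stiefel_connection a Y u v = (1/2) *\<^sub>R (transpose u ** v + transpose v ** u)"
    "horizontal_part Y (stiefel_connection a Y u v) =
      - (1 - a) *\<^sub>R (horizontal_part Y u ** (transpose Y ** v) + horizontal_part Y v ** (transpose Y ** u))"
proof -
  have uY: "transpose u ** Y = - (transpose Y ** u)" "transpose v ** Y = - (transpose Y ** v)"
    using u v by (simp_all add: stiefel_tangent_iff[OF Y])
  have mixed: "(mat 1 - Y ** transpose Y) ** (u ** transpose v + v ** transpose u) ** Y =
      - (horizontal_part Y u ** (transpose Y ** v) + horizontal_part Y v ** (transpose Y ** u))"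
  proof -
    have "(mat 1 - Y ** transpose Y) ** (u ** transpose v + v ** transpose u) ** Y =
        (mat 1 - Y ** transpose Y) ** (u ** (transpose v ** Y) + v ** (transpose u ** Y))"
      by (simp add: matrix_mult_bilinear matrix_mul_assoc)
    then show ?thesis
      by (simp add: uY horizontal_part_def matrix_mult_bilinear matrix_mul_assoc)
  qed
  have YH: "transpose Y ** (horizontal_part Y z ** N) = 0" for z N
    by (simp add: matrix_mul_assoc horizontal_part_orthogonal[OF Y] matrix_mult_bilinear)
  show tan: "transpose Y ** stiefel_connection a Y u v = (1/2) *\<^sub>R (transpose u ** v + transpose v ** u)"
    unfolding stiefel_connection_def mixed
    by (simp only: matrix_mult_bilinear YH stiefel_cancel[OF Y]) simp
  show "horizontal_part Y (stiefel_connection a Y u v) =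
      - (1 - a) *\<^sub>R (horizontal_part Y u ** (transpose Y ** v) + horizontal_part Y v ** (transpose Y ** u))"
    unfolding horizontal_part_def[of Y "stiefel_connection a Y u v"] tan
    unfolding stiefel_connection_def mixed
    by (simp add: matrix_mult_bilinear algebra_simps)
qed

text \<open>The right side is the derivative of the metric in its base point along \<open>u\<close>
  with \<open>v\<close> and \<open>w\<close> frozen. Metric compatibility is this identity together
  with the product rule. The ratio \<open>\<alpha>1 / \<alpha>0\<close> enters because
  \<open>\<alpha>0 * (1 - \<alpha>) = \<alpha>0 - \<alpha>1\<close>.\<close>

lemma stiefel_connection_skew_part:
  assumes Y: "Y \<in> stiefel" and u: "u \<in> tangent_space stiefel Y" and v: "v \<in> tangent_space stiefel Y"
    and w: "w \<in> tangent_space stiefel Y" and \<alpha>: "\<alpha>0 \<noteq> 0" "\<alpha> = \<alpha>1 / \<alpha>0"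
  shows "stiefel_metric \<alpha>0 \<alpha>1 Y (stiefel_connection \<alpha> Y u v) w + stiefel_metric \<alpha>0 \<alpha>1 Y v (stiefel_connection \<alpha> Y u w) =
    (\<alpha>1 - \<alpha>0) * ((transpose u ** v) \<bullet> (transpose Y ** w) + (transpose Y ** v) \<bullet> (transpose u ** w))"
proof -
  define A B C where "A = transpose Y ** u" "B = transpose Y ** v" "C = transpose Y ** w"
  define H K L where "H = horizontal_part Y u" "K = horizontal_part Y v" "L = horizontal_part Y w"
  note defs = A_B_C_def H_K_L_def
  have anti: "transpose A = - A" "transpose B = - B" "transpose C = - C"
    using u v w by (simp_all add: defs matrix_transpose_mul stiefel_tangent_iff[OF Y])
  \<comment> \<open>The block of the connection along \<open>Y\<close> is symmetric, hence
    orthogonal to the antisymmetric blocks of \<open>v\<close> and \<open>w\<close>; only horizontal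
    parts remain.\<close>
  have sym: "((1/2) *\<^sub>R (transpose u ** v + transpose v ** u)) \<bullet> C = 0"
    "B \<bullet> ((1/2) *\<^sub>R (transpose u ** w + transpose w ** u)) = 0"
    using inner_symmetric_antisymmetric[OF _ anti(3)] inner_symmetric_antisymmetric[OF _ anti(2)]
    by (simp_all add: inner_commute[of B] transpose_add transpose_scaleR matrix_transpose_mul add.commute)
  have uv: "transpose u ** v = - (A ** B) + transpose H ** K" "transpose u ** w = - (A ** C) + transpose H ** L"
    using transpose_decomposition[OF Y u] by (simp_all add: defs)
  have "stiefel_metric \<alpha>0 \<alpha>1 Y (stiefel_connection \<alpha> Y u v) w + stiefel_metric \<alpha>0 \<alpha>1 Y v (stiefel_connection \<alpha> Y u w)
    = (\<alpha>1 - \<alpha>0) * ((H ** B + K ** A) \<bullet> L + K \<bullet> (H ** C + L ** A))"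
    using \<alpha> sym
    by (simp add: stiefel_metric_decomposition[OF Y] stiefel_connection_components[OF Y u]
        v w defs[symmetric]) (simp add: field_simps)
  also have "(H ** B + K ** A) \<bullet> L + K \<bullet> (H ** C + L ** A) = (H ** B) \<bullet> L + K \<bullet> (H ** C)"
  proof -
    have "(K ** A) \<bullet> L = - (K \<bullet> (L ** A))"
      by (simp add: inner_matrix_mult_right anti matrix_mult_bilinear)
    then show ?thesis by (simp add: inner_simps)
  qed
  also have "(H ** B) \<bullet> L + K \<bullet> (H ** C) = (transpose u ** v) \<bullet> C + B \<bullet> (transpose u ** w)"
  proof -
    have "(A ** B) \<bullet> C + B \<bullet> (A ** C) = 0"
      by (simp add: inner_matrix_mult_left anti matrix_mult_bilinear)
    moreover have "(transpose H ** K) \<bullet> C = K \<bullet> (H ** C)" "B \<bullet> (transpose H ** L) = (H ** B) \<bullet> L"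
      by (simp_all add: inner_matrix_mult_left)
    ultimately show ?thesis by (simp add: uv inner_simps)
  qed
  finally show ?thesis by (simp add: defs)
qed

text \<open>The constant vector \<open>u\<close> is projected orthogonally to each tangent space by
  subtracting \<open>z\<close> times the symmetric part of \<open>transpose z ** u\<close>. At
  \<open>Y\<close> that part is zero because \<open>u\<close> is tangent there.\<close>

lemma stiefel_extend_tangent:
  assumes Y: "Y \<in> stiefel" and u: "u \<in> tangent_space stiefel Y"
  shows "\<exists>X\<in>vector_fields stiefel. X Y = u"
proof
  let ?P = "\<lambda>z. u - (1/2) *\<^sub>R (z ** (transpose z ** u + transpose u ** z))"
  let ?X = "\<lambda>z. if z \<in> stiefel then ?P z else 0"
  have "smooth_map stiefel ?P"
    by (intro smooth_on_imp_smooth_map smooth_matrix_intros)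
  then have "smooth_map stiefel ?X" by (rule smooth_map_cong) simp
  moreover have "?P z \<in> tangent_space stiefel z" if z: "z \<in> stiefel" for z
    using scaleR_half_double[of "transpose u ** z"] scaleR_half_double[of "transpose z ** u"]
    by (simp add: stiefel_tangent_iff[OF z] matrix_expand scaleR_add_right algebra_simps stiefel_cancel[OF z])
  ultimately show "?X \<in> vector_fields stiefel" by (simp add: vector_fields_iff)
  show "?X Y = u" using Y u by (simp add: stiefel_tangent_iff matrix_mult_bilinear)
qed

text \<open>Differentiating the tangency condition of \<open>Z\<close> along \<open>u\<close> yields
  the defect \<open>- (transpose u ** Z Y + transpose (Z Y) ** u)\<close> of the ambient derivative.
  The connection contributes one half of the opposite term, and its transpose the other
  half.\<close>

lemma stiefel_connection_tangent:
  assumes Y: "Y \<in> stiefel" and u: "u \<in> tangent_space stiefel Y" and Z: "Z \<in> vector_fields stiefel"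
  shows "dir_deriv stiefel Z Y u + stiefel_connection a Y u (Z Y) \<in> tangent_space stiefel Y"
proof -
  let ?S = "stiefel :: (real^'a^'b) set"
  have "smooth_map ?S Z" and Zt: "\<And>z. z \<in> ?S \<Longrightarrow> Z z \<in> tangent_space ?S z"
    using Z by (simp_all add: vector_fields_iff)
  then obtain Z' where Z': "(Z has_derivative Z') (at Y within ?S)" "dir_deriv ?S Z Y u = Z' u"
    using smooth_map_has_derivative Y u by metis
  let ?f = "\<lambda>z. transpose z ** Z z + transpose (Z z) ** z"
  have "(?f has_derivative (\<lambda>h. (transpose Y ** Z' h + transpose h ** Z Y)
      + (transpose (Z Y) ** h + transpose (Z' h) ** Y))) (at Y within ?S)"
    by (intro has_derivative_add has_derivative_matrix_mult has_derivative_transpose Z' has_derivative_ident)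
  from dir_deriv_eq[OF this u] have "dir_deriv ?S ?f Y u = (transpose Y ** Z' u + transpose u ** Z Y)
      + (transpose (Z Y) ** u + transpose (Z' u) ** Y)" .
  moreover have "dir_deriv ?S ?f Y u = dir_deriv ?S (\<lambda>z. 0) Y u"
    by (rule dir_deriv_cong[OF _ Y]) (use Zt in \<open>simp add: stiefel_tangent_iff\<close>)
  moreover have "dir_deriv ?S (\<lambda>z. 0 :: real^'a^'a) Y u = 0"
    using dir_deriv_eq[OF has_derivative_const u] .
  ultimately have D: "transpose Y ** Z' u + transpose (Z' u) ** Y = - (transpose u ** Z Y + transpose (Z Y) ** u)"
    by (simp add: eq_neg_iff_add_eq_0 algebra_simps)
  have \<Gamma>: "transpose Y ** stiefel_connection a Y u (Z Y) = (1/2) *\<^sub>R (transpose u ** Z Y + transpose (Z Y) ** u)"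
    by (rule stiefel_connection_components(1)[OF Y u Zt[OF Y]])
  have "transpose (stiefel_connection a Y u (Z Y)) ** Y = transpose (transpose Y ** stiefel_connection a Y u (Z Y))"
    by (simp add: matrix_transpose_mul)
  also have "\<dots> = (1/2) *\<^sub>R (transpose u ** Z Y + transpose (Z Y) ** u)"
    unfolding \<Gamma> by (simp add: matrix_expand add.commute)
  finally have \<Gamma>': "transpose (stiefel_connection a Y u (Z Y)) ** Y = (1/2) *\<^sub>R (transpose u ** Z Y + transpose (Z Y) ** u)" .
  let ?N = "transpose u ** Z Y + transpose (Z Y) ** u"
  have "transpose Y ** (Z' u + stiefel_connection a Y u (Z Y)) + transpose (Z' u + stiefel_connection a Y u (Z Y)) ** Y
    = (transpose Y ** Z' u + transpose (Z' u) ** Y) + ((1/2) *\<^sub>R ?N + (1/2) *\<^sub>R ?N)"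
    by (simp add: matrix_mult_bilinear transpose_add \<Gamma> \<Gamma>')
  also have "\<dots> = 0" unfolding D by (simp add: scaleR_add_left[symmetric])
  finally show ?thesis unfolding Z'(2) by (simp add: stiefel_tangent_space[OF Y])
qed

lemma stiefel_connection_metric:
  assumes Y: "Y \<in> stiefel" and u: "u \<in> tangent_space stiefel Y"
    and V: "V \<in> vector_fields stiefel" and Z: "Z \<in> vector_fields stiefel"
    and \<alpha>: "\<alpha>0 \<noteq> 0" "\<alpha> = \<alpha>1 / \<alpha>0"
  shows "dir_deriv stiefel (\<lambda>z. stiefel_metric \<alpha>0 \<alpha>1 z (V z) (Z z)) Y u =
    stiefel_metric \<alpha>0 \<alpha>1 Y (dir_deriv stiefel V Y u + stiefel_connection \<alpha> Y u (V Y)) (Z Y)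
    + stiefel_metric \<alpha>0 \<alpha>1 Y (V Y) (dir_deriv stiefel Z Y u + stiefel_connection \<alpha> Y u (Z Y))"
proof -
  let ?S = "stiefel :: (real^'a^'b) set"
  let ?g = "stiefel_metric \<alpha>0 \<alpha>1"
  have "smooth_map ?S V" "smooth_map ?S Z"
    and tan: "V Y \<in> tangent_space ?S Y" "Z Y \<in> tangent_space ?S Y"
    using V Z Y by (simp_all add: vector_fields_iff)
  then obtain V' Z' where V': "(V has_derivative V') (at Y within ?S)" "dir_deriv ?S V Y u = V' u"
    and Z': "(Z has_derivative Z') (at Y within ?S)" "dir_deriv ?S Z Y u = Z' u"
    using smooth_map_has_derivative Y u by metis
  have "((\<lambda>z. \<alpha>0 * (V z \<bullet> Z z) + (\<alpha>1 - \<alpha>0) * ((transpose z ** V z) \<bullet> (transpose z ** Z z))) has_derivative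
      (\<lambda>h. \<alpha>0 * (V Y \<bullet> Z' h + V' h \<bullet> Z Y) + (\<alpha>1 - \<alpha>0) *
        ((transpose Y ** V Y) \<bullet> (transpose Y ** Z' h + transpose h ** Z Y)
         + (transpose Y ** V' h + transpose h ** V Y) \<bullet> (transpose Y ** Z Y)))) (at Y within ?S)"
    by (intro has_derivative_add has_derivative_mult_right has_derivative_inner has_derivative_matrix_mult
        has_derivative_transpose V' Z' has_derivative_ident)
  from dir_deriv_eq[OF this u]
  have "dir_deriv ?S (\<lambda>z. ?g z (V z) (Z z)) Y u = ?g Y (V Y) (Z' u) + ?g Y (V' u) (Z Y)
      + (\<alpha>1 - \<alpha>0) * ((transpose u ** V Y) \<bullet> (transpose Y ** Z Y) + (transpose Y ** V Y) \<bullet> (transpose u ** Z Y))"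
    by (simp add: stiefel_metric_eq_inner[abs_def] inner_simps algebra_simps)
  also have "\<dots> = ?g Y (V' u + stiefel_connection \<alpha> Y u (V Y)) (Z Y) + ?g Y (V Y) (Z' u + stiefel_connection \<alpha> Y u (Z Y))"
    unfolding stiefel_connection_skew_part[OF Y u tan \<alpha>, symmetric]
    by (simp add: bounded_bilinear.add_left[OF bounded_bilinear_stiefel_metric]
        bounded_bilinear.add_right[OF bounded_bilinear_stiefel_metric])
  finally show ?thesis unfolding V' Z' .
qed

lemma embedded_connection_stiefel:
  assumes pos: "\<alpha>0 > 0" "\<alpha>1 > 0"
  shows "embedded_connection (stiefel :: (real^'p^'n) set) (stiefel_metric \<alpha>0 \<alpha>1)
    (stiefel_connection (\<alpha>1 / \<alpha>0)) (stiefel_connection_deriv (\<alpha>1 / \<alpha>0))"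
proof (rule embedded_connection.intro)
  show "subspace (tangent_space stiefel x)" if "x \<in> stiefel" for x :: "real^'p^'n"
    using that by (auto simp: subspace_def stiefel_tangent_iff matrix_mult_bilinear transpose_add
        transpose_scaleR transpose_zero)
qed (use pos in \<open>auto intro: stiefel_extend_tangent bounded_bilinear_stiefel_metric stiefel_metric_sym
    stiefel_metric_definite bounded_bilinear_stiefel_connection stiefel_connection_sym
    smooth_on_stiefel_connection stiefel_connection_has_derivative stiefel_connection_tangent
    stiefel_connection_metric\<close>)

section \<open>Curvature of the Stiefel manifold\<close>

text \<open>The versions with a factor on the left match words associated to the left, in which
  \<open>transpose Y ** Y\<close> is not a subterm.\<close>

lemma orth_complement_cancel:
  assumes Y: "Y \<in> stiefel" and Yp: "orth_complement Y Yp"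
  shows "transpose Y ** Y = mat 1" "transpose Y ** Yp = 0" "transpose Yp ** Y = 0" "transpose Yp ** Yp = mat 1"
    "M ** transpose Y ** Y = M" "M ** transpose Y ** Yp = 0" "N ** transpose Yp ** Y = 0" "N ** transpose Yp ** Yp = N"
proof -
  show 1: "transpose Y ** Y = mat 1" "transpose Y ** Yp = 0" "transpose Yp ** Yp = mat 1"
    using Y Yp by (simp_all add: stiefel_def orth_complement_def)
  then show 2: "transpose Yp ** Y = 0"
    by (metis matrix_transpose_mul transpose_transpose transpose_zero)
  show "M ** transpose Y ** Y = M" "M ** transpose Y ** Yp = 0" "N ** transpose Yp ** Y = 0" "N ** transpose Yp ** Yp = N"
    by (simp_all add: matrix_mul_assoc[symmetric] 1 2 matrix_mult_bilinear)
qed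

lemma orth_complement_projection:
  "orth_complement Y Yp \<Longrightarrow> mat 1 - Y ** transpose Y = Yp ** transpose Yp"
  by (simp add: orth_complement_def algebra_simps)

text \<open>Passing to entries turns an identity of noncommutative polynomials into one of reals:
  each normalised word contributes one opaque entry and \<open>field_simps\<close> collects the
  coefficients.\<close>

lemma matrix_eqI: "(\<And>i j. A $ i $ j = B $ i $ j) \<Longrightarrow> A = (B :: real^'a^'b)"
  by (simp add: vec_eq_iff)

text \<open>\<open>C\<close> is kept general for the nested terms of the curvature: there the second
  argument is itself a value of the connection, whose block along \<open>Y\<close> is
  symmetric.\<close>

lemma stiefel_connection_frame:
  fixes A C :: "real^'p^'p" and B D :: "real^'p^'q" and Y :: "real^'p^'n" and Yp :: "real^'q^'n"
  assumes Y: "Y \<in> stiefel" and Yp: "orth_complement Y Yp" and A: "transpose A = - A"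
  shows "stiefel_connection a Y (Y ** A + Yp ** B) (Y ** C + Yp ** D) =
    Y ** ((1/2) *\<^sub>R (transpose B ** D + transpose D ** B - A ** C + transpose C ** A))
    + Yp ** ((1 - a) *\<^sub>R (B ** transpose C - D ** A))"
  unfolding stiefel_connection_def orth_complement_projection[OF Yp]
  by (rule matrix_eqI)
     (simp add: matrix_expand orth_complement_cancel[OF Y Yp] A algebra_simps)

lemma stiefel_connection_deriv_frame:
  fixes A1 A2 A3 :: "real^'p^'p" and B1 B2 B3 :: "real^'p^'q" and Y :: "real^'p^'n" and Yp :: "real^'q^'n"
  assumes Y: "Y \<in> stiefel" and Yp: "orth_complement Y Yp"
    and A: "transpose A1 = - A1" "transpose A2 = - A2" "transpose A3 = - A3"
  shows "stiefel_connection_deriv a Y (Y ** A1 + Yp ** B1) (Y ** A2 + Yp ** B2) (Y ** A3 + Yp ** B3) =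
    Y ** ((1/2) *\<^sub>R (A1 ** (transpose B2 ** B3 + transpose B3 ** B2 - A2 ** A3 - A3 ** A2))
      + (1 - a) *\<^sub>R (A1 ** A3 ** A2 + A1 ** A2 ** A3 + (transpose B1 ** B2 - A1 ** A2) ** A3
          + (transpose B1 ** B3 - A1 ** A3) ** A2))
    + Yp ** ((1/2) *\<^sub>R (B1 ** (transpose B2 ** B3 + transpose B3 ** B2 - A2 ** A3 - A3 ** A2))
      + (1 - a) *\<^sub>R (B1 ** A3 ** A2 + B1 ** A2 ** A3 + B2 ** (transpose B3 ** B1 - A3 ** A1)
          + B3 ** (transpose B2 ** B1 - A2 ** A1)))"
  unfolding stiefel_connection_deriv_def orth_complement_projection[OF Yp]
  by (rule matrix_eqI)
     (simp add: matrix_expand orth_complement_cancel[OF Y Yp] A,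
      simp add: field_simps)

lemma stiefel_tangent_frame:
  assumes Y: "Y \<in> stiefel" and Yp: "orth_complement Y Yp" and A: "transpose A = - A"
  shows "Y ** A + Yp ** B \<in> tangent_space stiefel Y"
  by (simp add: stiefel_tangent_iff[OF Y] matrix_expand orth_complement_cancel[OF Y Yp] A)

definition curvature_A where
  "curvature_A \<alpha> A1 A2 A3 B1 B2 B3 =
           ((1 - 2*\<alpha>) / 4) *\<^sub>R
             (A1 ** transpose B3 ** B2 - A2 ** transpose B3 ** B1
              - transpose B1 ** B3 ** A2 + transpose B2 ** B3 ** A1)
           + ((1 - \<alpha>) / 2) *\<^sub>R
             (A3 ** transpose B1 ** B2 - A3 ** transpose B2 ** B1
              - transpose B1 ** B2 ** A3 + transpose B2 ** B1 ** A3)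
           + (1/4) *\<^sub>R
             (commutator (commutator A1 A2) A3
              - A1 ** transpose B2 ** B3 + A2 ** transpose B1 ** B3
              + transpose B3 ** B1 ** A2 - transpose B3 ** B2 ** A1)"
  for A1 A2 A3 :: "real^'p^'p" and B1 B2 B3 :: "real^'p^'q"

definition curvature_B where
  "curvature_B \<alpha> A1 A2 A3 B1 B2 B3 =
           ((2*\<alpha>\<^sup>2 - \<alpha>) / 2) *\<^sub>R (B1 ** A3 ** A2 - B2 ** A3 ** A1)
           + (\<alpha>\<^sup>2 - \<alpha>) *\<^sub>R (B3 ** A1 ** A2 - B3 ** A2 ** A1)
           + (1 - \<alpha>) *\<^sub>R (B3 ** transpose B1 ** B2 - B3 ** transpose B2 ** B1)
           + ((\<alpha> - 2) / 2) *\<^sub>R (B1 ** transpose B2 ** B3 - B2 ** transpose B1 ** B3)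
           + (\<alpha> / 2) *\<^sub>R
             (B1 ** A2 ** A3 - B1 ** transpose B3 ** B2
              - B2 ** A1 ** A3 + B2 ** transpose B3 ** B1)"
  for A1 A2 A3 :: "real^'p^'p" and B1 B2 B3 :: "real^'p^'q"

lemma curvature_A_antisymmetric:
  assumes A: "transpose A1 = - A1" "transpose A2 = - A2" "transpose A3 = - A3"
  shows "transpose (curvature_A \<alpha> A1 A2 A3 B1 B2 B3) = - curvature_A \<alpha> A1 A2 A3 B1 B2 B3"
  unfolding curvature_A_def commutator_def
  by (rule matrix_eqI) (simp add: matrix_expand A, simp add: field_simps)

theorem stiefel_riemann_curvature:
  fixes A1 A2 A3 :: "real^'p^'p" and B1 B2 B3 :: "real^'p^'q" and Y :: "real^'p^'n" and Yp :: "real^'q^'n"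
  assumes pos: "\<alpha>0 > 0" "\<alpha>1 > 0" and Y: "Y \<in> stiefel" and Yp: "orth_complement Y Yp"
    and A: "transpose A1 = - A1" "transpose A2 = - A2" "transpose A3 = - A3"
    and \<alpha>: "\<alpha> = \<alpha>1 / \<alpha>0"
  shows "riemann_curvature stiefel (stiefel_metric \<alpha>0 \<alpha>1) Y
      (Y ** A1 + Yp ** B1) (Y ** A2 + Yp ** B2) (Y ** A3 + Yp ** B3) =
    Y ** curvature_A \<alpha> A1 A2 A3 B1 B2 B3 + Yp ** curvature_B \<alpha> A1 A2 A3 B1 B2 B3"
proof -
  interpret embedded_connection "stiefel :: (real^'p^'n) set" "stiefel_metric \<alpha>0 \<alpha>1"
      "stiefel_connection \<alpha>" "stiefel_connection_deriv \<alpha>"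
    unfolding \<alpha> by (rule embedded_connection_stiefel[OF pos])
  show ?thesis
    unfolding riemann_curvature_eq[OF Y stiefel_tangent_frame[OF Y Yp A(1)]
        stiefel_tangent_frame[OF Y Yp A(2)] stiefel_tangent_frame[OF Y Yp A(3)]]
      stiefel_connection_frame[OF Y Yp A(1)] stiefel_connection_frame[OF Y Yp A(2)]
      stiefel_connection_deriv_frame[OF Y Yp A(2,1,3)] stiefel_connection_deriv_frame[OF Y Yp A(1,2,3)]
      curvature_A_def curvature_B_def commutator_def
    by (rule matrix_eqI) (simp add: matrix_expand A, simp add: field_simps power2_eq_square)
qed

section \<open>Traces over a frame\<close>

text \<open>Any family \<open>e\<close> with functionals \<open>\<phi>\<close> that resolves the
  identity of \<open>V\<close> computes the trace as a basis and its dual would: insert the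
  resolution into each \<open>F b\<close> and exchange the sums. As \<open>f\<close> is known on
  \<open>V\<close> only, a linear ambient map \<open>F\<close> represents it.\<close>

lemma trace_on_frame:
  fixes F :: "'a::euclidean_space \<Rightarrow> 'a"
  assumes sub: "subspace V" and F: "linear F" "\<And>v. v \<in> V \<Longrightarrow> F v \<in> V"
    and f: "\<And>v. v \<in> V \<Longrightarrow> f v = F v"
    and e: "\<And>i. i \<in> I \<Longrightarrow> e i \<in> V" and \<phi>: "\<And>i. i \<in> I \<Longrightarrow> linear (\<phi> i :: 'a \<Rightarrow> real)"
    and frame: "\<And>v. v \<in> V \<Longrightarrow> v = (\<Sum>i\<in>I. \<phi> i v *\<^sub>R e i)"
  shows "trace_on V f = (\<Sum>i\<in>I. \<phi> i (F (e i)))"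
proof -
  define B where "B = (SOME B. independent B \<and> span B = V)"
  have "\<exists>B. independent B \<and> span B = V"
    using basis_exists[of V] sub by (metis span_eq_iff span_mono subset_antisym span_minimal)
  then have B: "independent B" "span B = V" unfolding B_def by (metis (mono_tags, lifting) someI_ex)+
  then have fin: "finite B" by (simp add: independent_imp_finite)
  have BV: "b \<in> V" if "b \<in> B" for b using that B(2) span_base by blast
  have rep: "representation B (F b) c = (\<Sum>i\<in>I. \<phi> i (F b) * representation B (e i) c)" if "b \<in> B" for b c
  proof -
    have "representation B (\<Sum>i\<in>I. \<phi> i (F b) *\<^sub>R e i) c = (\<Sum>i\<in>I. representation B (\<phi> i (F b) *\<^sub>R e i) c)"
      by (rule representation_sum[OF B(1), THEN fun_cong]) (simp add: B(2) subspace_scale[OF sub] e)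
    also have "\<dots> = (\<Sum>i\<in>I. \<phi> i (F b) * representation B (e i) c)"
      by (rule sum.cong) (simp_all add: representation_scale[OF B(1)] B(2) e)
    finally show ?thesis using frame[OF F(2)[OF BV[OF that]]] by simp
  qed
  have "trace_on V f = (\<Sum>b\<in>B. representation B (F b) b)"
    by (simp add: trace_on_def Let_def B_def[symmetric] f BV)
  also have "\<dots> = (\<Sum>b\<in>B. \<Sum>i\<in>I. \<phi> i (F b) * representation B (e i) b)"
    using rep by simp
  also have "\<dots> = (\<Sum>i\<in>I. \<Sum>b\<in>B. representation B (e i) b * \<phi> i (F b))"
    by (subst sum.swap) (simp add: mult.commute)
  also have "\<dots> = (\<Sum>i\<in>I. \<phi> i (F (\<Sum>b\<in>B. representation B (e i) b *\<^sub>R b)))"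
    by (rule sum.cong) (simp_all add: linear_sum[OF F(1)] linear_scale[OF F(1)] linear_sum[OF \<phi>] linear_scale[OF \<phi>])
  also have "\<dots> = (\<Sum>i\<in>I. \<phi> i (F (e i)))"
    by (rule sum.cong) (simp_all add: sum_representation_eq[OF B(1)] B(2) e fin)
  finally show ?thesis .
qed

text \<open>Same exchange of sums, with the functionals given by \<open>ip\<close> and the vectors
  \<open>d i\<close>. Existence of an orthonormal basis is a premise because it is what gives the
  chosen \<open>E\<close> its properties.\<close>

lemma metric_trace_on_frame:
  fixes H :: "'a::euclidean_space \<Rightarrow> 'a \<Rightarrow> real"
  assumes ip: "bounded_bilinear ip" and H: "bounded_bilinear H"
    and onb: "\<exists>E. independent E \<and> span E = V \<and> (\<forall>a\<in>E. \<forall>b\<in>E. ip a b = (if a = b then 1 else 0))"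
    and h: "\<And>u v. u \<in> V \<Longrightarrow> v \<in> V \<Longrightarrow> h u v = H u v"
    and d: "\<And>i. i \<in> I \<Longrightarrow> d i \<in> V"
    and frame: "\<And>v. v \<in> V \<Longrightarrow> v = (\<Sum>i\<in>I. ip v (d i) *\<^sub>R e i)"
  shows "metric_trace_on V ip h = (\<Sum>i\<in>I. H (e i) (d i))"
proof -
  define E where "E = (SOME E. independent E \<and> span E = V \<and>
                 (\<forall>a\<in>E. \<forall>b\<in>E. ip a b = (if a = b then 1 else 0)))"
  have E: "independent E" "span E = V" "\<And>a b. a \<in> E \<Longrightarrow> b \<in> E \<Longrightarrow> ip a b = (if a = b then 1 else 0)"
    using someI_ex[OF onb] unfolding E_def[symmetric] by blast+
  then have fin: "finite E" by (simp add: independent_imp_finite)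
  have EV: "b \<in> V" if "b \<in> E" for b using that E(2) span_base by blast
  have expand: "(\<Sum>b\<in>E. ip b w *\<^sub>R b) = w" if "w \<in> V" for w
  proof -
    have w: "(\<Sum>c\<in>E. representation E w c *\<^sub>R c) = w"
      by (rule sum_representation_eq[OF E(1)]) (use that E(2) fin in auto)
    have "ip b w = representation E w b" if b: "b \<in> E" for b
    proof -
      have "ip b w = (\<Sum>c\<in>E. representation E w c * ip b c)"
        by (subst w[symmetric]) (simp add: bounded_bilinear.sum_right[OF ip] bounded_bilinear.scaleR_right[OF ip])
      also have "\<dots> = (\<Sum>c\<in>E. if b = c then representation E w c else 0)"
        by (rule sum.cong) (simp_all add: E(3) b)
      finally show ?thesis using b fin by simp
    qed
    then show ?thesis using w by simp
  qed
  have "metric_trace_on V ip h = (\<Sum>b\<in>E. H b b)"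
    by (simp add: metric_trace_on_def Let_def E_def[symmetric] h EV)
  also have "\<dots> = (\<Sum>b\<in>E. H (\<Sum>i\<in>I. ip b (d i) *\<^sub>R e i) b)"
    by (rule sum.cong[OF refl]) (simp only: frame[OF EV, symmetric])
  also have "\<dots> = (\<Sum>b\<in>E. \<Sum>i\<in>I. ip b (d i) * H (e i) b)"
    by (simp add: bounded_bilinear.sum_left[OF H] bounded_bilinear.scaleR_left[OF H])
  also have "\<dots> = (\<Sum>i\<in>I. H (e i) (\<Sum>b\<in>E. ip b (d i) *\<^sub>R b))"
    by (subst sum.swap) (simp add: bounded_bilinear.sum_right[OF H] bounded_bilinear.scaleR_right[OF H])
  also have "\<dots> = (\<Sum>i\<in>I. H (e i) (d i))"
    by (rule sum.cong) (simp_all add: expand d)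
  finally show ?thesis .
qed

section \<open>Traces of the maps sending \<open>Z\<close> to \<open>P ** Z ** Q\<close>\<close>

definition matrix_unit :: "'a \<Rightarrow> 'b \<Rightarrow> real^'b^'a" where
  "matrix_unit i j = (\<chi> k l. if k = i \<and> l = j then 1 else 0)"

lemma matrix_unit_sum: "(\<Sum>i\<in>UNIV. \<Sum>j\<in>UNIV. A $ i $ j *\<^sub>R matrix_unit i j) = (A :: real^'b^'a)"
proof (rule matrix_eqI)
  fix k l
  have "(\<Sum>i\<in>UNIV. \<Sum>j\<in>UNIV. A $ i $ j *\<^sub>R matrix_unit i j) $ k $ l
      = (\<Sum>i\<in>UNIV. \<Sum>j\<in>UNIV. if k = i then if l = j then A $ i $ j else 0 else 0)"
    by (simp add: matrix_unit_def) (intro sum.cong, auto)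
  also have "\<dots> = (\<Sum>i\<in>UNIV. if k = i then \<Sum>j\<in>UNIV. if l = j then A $ i $ j else 0 else 0)"
    by (intro sum.cong) auto
  finally show "(\<Sum>i\<in>UNIV. \<Sum>j\<in>UNIV. A $ i $ j *\<^sub>R matrix_unit i j) $ k $ l = A $ k $ l" by simp
qed

lemma matrix_unit_mult: "(P ** matrix_unit i j ** Q) $ k $ l = P $ k $ i * Q $ j $ l"
  for P :: "real^'a^'c" and Q :: "real^'d^'b"
proof -
  have "(P ** matrix_unit i j) $ k $ m = (if m = j then P $ k $ i else 0)" for m
    by (simp add: matrix_matrix_mult_def matrix_unit_def if_distrib cong: if_cong)
  note e = this
  show ?thesis
    by (simp add: matrix_matrix_mult_def[of "P ** matrix_unit i j"] e mult_delta_left)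
qed

lemma transpose_matrix_unit: "transpose (matrix_unit i j) = matrix_unit j i"
  by (rule matrix_eqI) (auto simp: transpose_def matrix_unit_def)

text \<open>The left side is the trace of the operator sending \<open>Z\<close> to
  \<open>P ** Z ** Q\<close>, a tensor product of \<open>P\<close> and the transpose of
  \<open>Q\<close>.\<close>

lemma sum_matrix_unit_mult:
  "(\<Sum>i\<in>UNIV. \<Sum>j\<in>UNIV. (P ** matrix_unit i j ** Q) $ i $ j) = trace P * trace Q"
  by (simp add: matrix_unit_mult trace_def sum_product)

text \<open>Here \<open>Z\<close> enters transposed, and the diagonal terms pair equal entries of
  \<open>P\<close> and \<open>Q\<close>.\<close>

lemma sum_transpose_matrix_unit_mult:
  "(\<Sum>i\<in>UNIV. \<Sum>j\<in>UNIV. (P ** matrix_unit j i ** Q) $ i $ j) = trace (transpose P ** (Q :: real^'b^'a))"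
  by (simp add: matrix_unit_mult inner_matrix_eq_trace[symmetric] inner_vec_def)

text \<open>Indexed by all ordered pairs: \<open>(i, j)\<close> and \<open>(j, i)\<close> contribute
  equally to an expansion, which the factor 1/2 absorbs, and the diagonal ones vanish.\<close>

definition skew_unit :: "'a \<Rightarrow> 'a \<Rightarrow> real^'a^'a" where
  "skew_unit i j = (1/2) *\<^sub>R (matrix_unit i j - matrix_unit j i)"

lemma transpose_skew_unit: "transpose (skew_unit i j) = - skew_unit i j"
  by (simp add: skew_unit_def transpose_scaleR transpose_diff transpose_matrix_unit scaleR_diff_right)

lemma skew_unit_sum:
  assumes "transpose A = - A"
  shows "(\<Sum>i\<in>UNIV. \<Sum>j\<in>UNIV. A $ i $ j *\<^sub>R skew_unit i j) = A"
proof -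
  have "(\<Sum>i\<in>UNIV. \<Sum>j\<in>UNIV. A $ i $ j *\<^sub>R matrix_unit j i)
      = (\<Sum>j\<in>UNIV. \<Sum>i\<in>UNIV. transpose A $ j $ i *\<^sub>R matrix_unit j i)"
    by (subst sum.swap) (simp add: transpose_def)
  also have "\<dots> = - A" by (simp only: matrix_unit_sum assms)
  finally have swap: "(\<Sum>i\<in>UNIV. \<Sum>j\<in>UNIV. A $ i $ j *\<^sub>R matrix_unit j i) = - A" .
  have "(\<Sum>i\<in>UNIV. \<Sum>j\<in>UNIV. A $ i $ j *\<^sub>R skew_unit i j)
      = (1/2) *\<^sub>R ((\<Sum>i\<in>UNIV. \<Sum>j\<in>UNIV. A $ i $ j *\<^sub>R matrix_unit i j)
          - (\<Sum>i\<in>UNIV. \<Sum>j\<in>UNIV. A $ i $ j *\<^sub>R matrix_unit j i))"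
    by (simp only: skew_unit_def sum_subtractf[symmetric] scaleR_diff_right[symmetric] scaleR_sum_right)
       (simp only: scaleR_diff_right scaleR_left_commute)
  then show ?thesis by (simp add: swap matrix_unit_sum scaleR_2[symmetric])
qed

lemma sum_skew_unit_mult:
  "(\<Sum>i\<in>UNIV. \<Sum>j\<in>UNIV. (P ** skew_unit i j ** Q) $ i $ j)
    = (trace P * trace Q - trace (transpose P ** Q)) / 2"
proof -
  have "(\<Sum>i\<in>UNIV. \<Sum>j\<in>UNIV. (P ** skew_unit i j ** Q) $ i $ j) =
      ((\<Sum>i\<in>UNIV. \<Sum>j\<in>UNIV. (P ** matrix_unit i j ** Q) $ i $ j)
        - (\<Sum>i\<in>UNIV. \<Sum>j\<in>UNIV. (P ** matrix_unit j i ** Q) $ i $ j)) / 2"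
    by (simp add: skew_unit_def matrix_mult_bilinear sum_subtractf sum_divide_distrib diff_divide_distrib)
  then show ?thesis by (simp add: sum_matrix_unit_mult sum_transpose_matrix_unit_mult)
qed

section \<open>Ricci curvature\<close>

lemma trace_antisymmetric: "transpose A = - A \<Longrightarrow> trace (A :: real^'a^'a) = 0"
  using trace_transpose[of A] by (simp add: trace_minus)

lemma trace_transpose_mult: "trace (transpose B ** A) = trace (transpose A ** (B :: real^'a^'b))"
  using inner_commute[of A B] by (simp add: inner_matrix_eq_trace)

lemma ricci_trace_skew:
  fixes A1 A3 :: "real^'p^'p" and B1 B3 :: "real^'p^'q"
  assumes A: "transpose A1 = - A1" "transpose A3 = - A3"
  shows "(\<Sum>i\<in>UNIV. \<Sum>j\<in>UNIV. curvature_A \<alpha> A1 (skew_unit i j) A3 B1 0 B3 $ i $ j) =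
    (2 - real CARD('p)) / 4 * trace (A1 ** A3) + (real CARD('p) - 1) * \<alpha> / 2 * trace (transpose B1 ** B3)"
proof -
  let ?I = "mat 1 :: real^'p^'p"
  \<comment> \<open>Each word is written with one factor on either side of \<open>Z\<close>, padded
    by \<open>?I\<close> where a factor is missing, so that \<open>sum_skew_unit_mult\<close>
    evaluates its sum.\<close>
  have expand: "curvature_A \<alpha> A1 Z A3 B1 0 B3 $ i $ j =
      (1/4) * (A1 ** Z ** A3) $ i $ j + (1/4) * (A3 ** Z ** A1) $ i $ j
      - (1/4) * (?I ** Z ** (A1 ** A3)) $ i $ j - (1/4) * ((A3 ** A1) ** Z ** ?I) $ i $ j
      + (1/4) * (?I ** Z ** (transpose B1 ** B3)) $ i $ j + (1/4) * ((transpose B3 ** B1) ** Z ** ?I) $ i $ j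
      - ((1 - 2*\<alpha>)/4) * (?I ** Z ** (transpose B3 ** B1)) $ i $ j
      - ((1 - 2*\<alpha>)/4) * ((transpose B1 ** B3) ** Z ** ?I) $ i $ j" for Z i j
    by (simp add: curvature_A_def commutator_def matrix_expand) (simp add: field_simps)
  have t: "trace (transpose A1 ** A3) = - trace (A1 ** A3)" "trace (transpose A3 ** A1) = - trace (A1 ** A3)"
    "trace (transpose (A3 ** A1)) = trace (A1 ** A3)" "trace (A3 ** A1) = trace (A1 ** A3)"
    using trace_mul_sym[of A1 A3] by (simp_all add: A matrix_mult_bilinear trace_minus trace_transpose)
  have tB: "trace (transpose B3 ** B1) = trace (transpose B1 ** B3)" by (rule trace_transpose_mult)
  show ?thesis
    unfolding expand sum.distrib sum_subtractf sum_distrib_left[symmetric] sum_skew_unit_mult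
    by (simp add: t tB trace_I trace_antisymmetric A trace_transpose matrix_mult_bilinear trace_minus)
       (simp add: field_simps)
qed

lemma ricci_trace_horizontal:
  fixes A1 A3 :: "real^'p^'p" and B1 B3 :: "real^'p^'q"
  shows "(\<Sum>k\<in>UNIV. \<Sum>l\<in>UNIV. curvature_B \<alpha> A1 0 A3 B1 (matrix_unit k l) B3 $ k $ l) =
    - (\<alpha>\<^sup>2 * real CARD('q)) * trace (A1 ** A3)
    + ((1 - \<alpha>) * (real CARD('p) - 1) + (\<alpha> - 2) / 2 * (1 - real CARD('q))
       + \<alpha> / 2 * (real CARD('q) - real CARD('p))) * trace (transpose B1 ** B3)"
proof -
  let ?I = "mat 1 :: real^'p^'p" and ?J = "mat 1 :: real^'q^'q"
  \<comment> \<open>Words containing the transpose of the middle block produce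
    \<open>matrix_unit l k\<close> and are summed by the transposed formula.\<close>
  have expand: "curvature_B \<alpha> A1 0 A3 B1 (matrix_unit k l) B3 $ k $ l =
      - ((2*\<alpha>\<^sup>2 - \<alpha>)/2) * (?J ** matrix_unit k l ** (A3 ** A1)) $ k $ l
      + (1 - \<alpha>) * ((B3 ** transpose B1) ** matrix_unit k l ** ?I) $ k $ l
      - (1 - \<alpha>) * (B3 ** matrix_unit l k ** B1) $ k $ l
      + ((\<alpha> - 2)/2) * (B1 ** matrix_unit l k ** B3) $ k $ l
      - ((\<alpha> - 2)/2) * (?J ** matrix_unit k l ** (transpose B1 ** B3)) $ k $ l
      - (\<alpha>/2) * ((B1 ** transpose B3) ** matrix_unit k l ** ?I) $ k $ l
      - (\<alpha>/2) * (?J ** matrix_unit k l ** (A1 ** A3)) $ k $ l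
      + (\<alpha>/2) * (?J ** matrix_unit k l ** (transpose B3 ** B1)) $ k $ l" for k l
    by (simp add: curvature_B_def matrix_expand transpose_matrix_unit) (simp add: field_simps)
  have t: "trace (A3 ** A1) = trace (A1 ** A3)" by (rule trace_mul_sym)
  have tB: "trace (transpose B3 ** B1) = trace (transpose B1 ** B3)" by (rule trace_transpose_mult)
  have tB': "trace (B3 ** transpose B1) = trace (transpose B1 ** B3)"
    "trace (B1 ** transpose B3) = trace (transpose B1 ** B3)"
    using trace_mul_sym[of B3 "transpose B1"] trace_mul_sym[of B1 "transpose B3"] tB by simp_all
  show ?thesis
    unfolding expand sum.distrib sum_subtractf sum_distrib_left[symmetric]
      sum_matrix_unit_mult sum_transpose_matrix_unit_mult
    by (simp add: t tB tB' trace_I) (simp add: field_simps power2_eq_square)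
qed

text \<open>Linearity is joint in the two blocks of the middle argument, the variable over which the
  Ricci trace is taken.\<close>

lemma curvature_A_linear:
  fixes A1 A3 :: "real^'p^'p" and B1 B3 :: "real^'p^'q"
  shows "curvature_A \<alpha> A1 (A + A') A3 B1 (B + B') B3 =
      curvature_A \<alpha> A1 A A3 B1 B B3 + curvature_A \<alpha> A1 A' A3 B1 B' B3"
    "curvature_A \<alpha> A1 (c *\<^sub>R A) A3 B1 (c *\<^sub>R B) B3 = c *\<^sub>R curvature_A \<alpha> A1 A A3 B1 B B3"
  unfolding curvature_A_def commutator_def
  by (rule matrix_eqI; simp add: matrix_expand; simp add: field_simps)+

lemma curvature_B_linear:
  fixes A1 A3 :: "real^'p^'p" and B1 B3 :: "real^'p^'q"
  shows "curvature_B \<alpha> A1 (A + A') A3 B1 (B + B') B3 =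
      curvature_B \<alpha> A1 A A3 B1 B B3 + curvature_B \<alpha> A1 A' A3 B1 B' B3"
    "curvature_B \<alpha> A1 (c *\<^sub>R A) A3 B1 (c *\<^sub>R B) B3 = c *\<^sub>R curvature_B \<alpha> A1 A A3 B1 B B3"
  unfolding curvature_B_def
  by (rule matrix_eqI; simp add: matrix_expand; simp add: field_simps)+

lemma sum_frame_index:
  fixes f :: "'a::finite \<Rightarrow> 'b::finite \<Rightarrow> 'e::comm_monoid_add" and h :: "'c::finite \<Rightarrow> 'd::finite \<Rightarrow> 'e"
  shows "(\<Sum>x\<in>UNIV. case_sum (\<lambda>(i, j). f i j) (\<lambda>(k, l). h k l) x)
    = (\<Sum>i\<in>UNIV. \<Sum>j\<in>UNIV. f i j) + (\<Sum>k\<in>UNIV. \<Sum>l\<in>UNIV. h k l)"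
  by (simp add: UNIV_Plus_UNIV[symmetric] sum.Plus sum.cartesian_product UNIV_Times_UNIV[symmetric]
      del: UNIV_Plus_UNIV UNIV_Times_UNIV)

lemma stiefel_metric_frame:
  fixes A C :: "real^'p^'p" and B D :: "real^'p^'q" and Y :: "real^'p^'n" and Yp :: "real^'q^'n"
  assumes "Y \<in> stiefel" "orth_complement Y Yp"
  shows "stiefel_metric \<alpha>0 \<alpha>1 Y (Y ** A + Yp ** B) (Y ** C + Yp ** D) = \<alpha>1 * (A \<bullet> C) + \<alpha>0 * (B \<bullet> D)"
  unfolding stiefel_metric_eq_inner
  by (simp add: inner_matrix_eq_trace matrix_expand orth_complement_cancel[OF assms] trace_add)
     (simp add: algebra_simps)

lemma tangent_frame_decomposition:
  assumes "Y \<in> stiefel" "orth_complement Y Yp" "v \<in> tangent_space stiefel Y"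
  shows "v = Y ** (transpose Y ** v) + Yp ** (transpose Yp ** v)"
    "transpose (transpose Y ** v) = - (transpose Y ** v)"
proof -
  have "Y ** (transpose Y ** v) + Yp ** (transpose Yp ** v) = (Y ** transpose Y + Yp ** transpose Yp) ** v"
    by (simp add: matrix_mult_bilinear matrix_mul_assoc)
  then show "v = Y ** (transpose Y ** v) + Yp ** (transpose Yp ** v)"
    using assms(2) by (simp add: orth_complement_def)
  show "transpose (transpose Y ** v) = - (transpose Y ** v)"
    using assms by (simp add: stiefel_tangent_iff matrix_transpose_mul)
qed

lemma frame_components:
  assumes "Y \<in> stiefel" "orth_complement Y Yp"
  shows "transpose Y ** (Y ** A + Yp ** B) = A" "transpose Yp ** (Y ** A + Yp ** B) = B"
  by (simp_all add: matrix_expand orth_complement_cancel[OF assms])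

lemma tangent_frame_expansion:
  fixes Y :: "real^'p^'n" and Yp :: "real^'q^'n"
  assumes Y: "Y \<in> stiefel" and Yp: "orth_complement Y Yp" and v: "v \<in> tangent_space stiefel Y"
  shows "(\<Sum>x\<in>UNIV. case_sum
      (\<lambda>(i, j). (transpose Y ** v) $ i $ j *\<^sub>R (Y ** skew_unit i j))
      (\<lambda>(k, l). (transpose Yp ** v) $ k $ l *\<^sub>R (Yp ** matrix_unit k l)) x) = v"
proof -
  note dec = tangent_frame_decomposition[OF Y Yp v]
  have "(\<Sum>x\<in>UNIV. case_sum
      (\<lambda>(i, j). (transpose Y ** v) $ i $ j *\<^sub>R (Y ** skew_unit i j))
      (\<lambda>(k, l). (transpose Yp ** v) $ k $ l *\<^sub>R (Yp ** matrix_unit k l)) x)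
    = Y ** (\<Sum>i\<in>UNIV. \<Sum>j\<in>UNIV. (transpose Y ** v) $ i $ j *\<^sub>R skew_unit i j)
      + Yp ** (\<Sum>k\<in>UNIV. \<Sum>l\<in>UNIV. (transpose Yp ** v) $ k $ l *\<^sub>R matrix_unit k l)"
    unfolding sum_frame_index
    by (simp only: bounded_bilinear.sum_right[OF bounded_bilinear_matrix_mult] matrix_mult_bilinear)
  also have "\<dots> = v"
    unfolding skew_unit_sum[OF dec(2)] matrix_unit_sum by (rule dec(1)[symmetric])
  finally show ?thesis .
qed

text \<open>A trace sees diagonal blocks only: on \<open>Y ** skew_unit i j\<close> the functional
  reads \<open>curvature_A\<close> with \<open>B2 = 0\<close>, on
  \<open>Yp ** matrix_unit k l\<close> it reads \<open>curvature_B\<close> with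
  \<open>A2 = 0\<close>.\<close>

theorem stiefel_ricci_curvature:
  fixes A1 A3 :: "real^'p^'p" and B1 B3 :: "real^'p^'q" and Y :: "real^'p^'n" and Yp :: "real^'q^'n"
  assumes pos: "\<alpha>0 > 0" "\<alpha>1 > 0" and Y: "Y \<in> stiefel" and Yp: "orth_complement Y Yp"
    and A: "transpose A1 = - A1" "transpose A3 = - A3" and \<alpha>: "\<alpha> = \<alpha>1 / \<alpha>0"
  shows "ricci_curvature stiefel (stiefel_metric \<alpha>0 \<alpha>1) Y (Y ** A1 + Yp ** B1) (Y ** A3 + Yp ** B3) =
    ((2 - real CARD('p)) / 4 - real CARD('q) * \<alpha>\<^sup>2) * trace (A1 ** A3)
    + ((1 - real CARD('p)) * \<alpha> + (real CARD('p) + real CARD('q) - 2)) * trace (transpose B1 ** B3)"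
proof -
  let ?T = "tangent_space stiefel Y"
  let ?F = "\<lambda>v. Y ** curvature_A \<alpha> A1 (transpose Y ** v) A3 B1 (transpose Yp ** v) B3
    + Yp ** curvature_B \<alpha> A1 (transpose Y ** v) A3 B1 (transpose Yp ** v) B3"
  let ?e = "case_sum (\<lambda>(i, j). Y ** skew_unit i j) (\<lambda>(k, l). Yp ** matrix_unit k l)"
  let ?\<phi> = "case_sum (\<lambda>(i, j). \<lambda>v. (transpose Y ** v) $ i $ j) (\<lambda>(k, l). \<lambda>v. (transpose Yp ** v) $ k $ l)"
  note tangent = stiefel_tangent_frame[OF Y Yp] and dec = tangent_frame_decomposition[OF Y Yp]
    and comp = frame_components[OF Y Yp]
  have skew: "Y ** skew_unit i j = Y ** skew_unit i j + Yp ** 0"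
    and unit: "Yp ** matrix_unit k l = Y ** 0 + Yp ** matrix_unit k l" for i j k l
    by (simp_all add: matrix_mult_bilinear)
  have "ricci_curvature stiefel (stiefel_metric \<alpha>0 \<alpha>1) Y (Y ** A1 + Yp ** B1) (Y ** A3 + Yp ** B3)
    = (\<Sum>x\<in>UNIV. ?\<phi> x (?F (?e x)))"
    unfolding ricci_curvature_def
  proof (rule trace_on_frame[where F = ?F and e = ?e and \<phi> = ?\<phi>])
    show "subspace ?T"
      by (rule embedded_connection.subspace_tangent_space[OF embedded_connection_stiefel[OF pos] Y])
    show "linear ?F"
      by (simp add: linear_iff matrix_mult_bilinear curvature_A_linear curvature_B_linear scaleR_add_right)
    show "?F v \<in> ?T" if "v \<in> ?T" for v
      by (intro tangent curvature_A_antisymmetric A dec(2) that)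
    show "riemann_curvature stiefel (stiefel_metric \<alpha>0 \<alpha>1) Y (Y ** A1 + Yp ** B1) v (Y ** A3 + Yp ** B3) = ?F v"
      if v: "v \<in> ?T" for v
    proof -
      have "riemann_curvature stiefel (stiefel_metric \<alpha>0 \<alpha>1) Y (Y ** A1 + Yp ** B1)
          (Y ** (transpose Y ** v) + Yp ** (transpose Yp ** v)) (Y ** A3 + Yp ** B3) = ?F v"
        by (rule stiefel_riemann_curvature[OF pos Y Yp A(1) dec(2)[OF v] A(2) \<alpha>])
      then show ?thesis by (simp only: dec(1)[OF v, symmetric])
    qed
    show "?e x \<in> ?T" for x
      using tangent[OF transpose_skew_unit, of _ _ 0] tangent[of 0, OF _, of "matrix_unit _ _"]
      by (auto split: sum.split simp: matrix_mult_bilinear transpose_zero)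
    show "linear (?\<phi> x)" for x
      by (auto split: sum.split simp: linear_iff matrix_mult_bilinear)
    show "v = (\<Sum>x\<in>UNIV. ?\<phi> x v *\<^sub>R ?e x)" if v: "v \<in> ?T" for v
    proof -
      have "(\<Sum>x\<in>UNIV. ?\<phi> x v *\<^sub>R ?e x) = (\<Sum>x\<in>UNIV. case_sum
          (\<lambda>(i, j). (transpose Y ** v) $ i $ j *\<^sub>R (Y ** skew_unit i j))
          (\<lambda>(k, l). (transpose Yp ** v) $ k $ l *\<^sub>R (Yp ** matrix_unit k l)) x)"
        by (rule sum.cong) (auto split: sum.split)
      also have "\<dots> = v" by (rule tangent_frame_expansion[OF Y Yp v])
      finally show ?thesis by simp
    qed
  qed
  also have "\<dots> = (\<Sum>x\<in>UNIV. case_sum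
      (\<lambda>(i, j). curvature_A \<alpha> A1 (skew_unit i j) A3 B1 0 B3 $ i $ j)
      (\<lambda>(k, l). curvature_B \<alpha> A1 0 A3 B1 (matrix_unit k l) B3 $ k $ l) x)"
  proof (rule sum.cong[OF refl])
    fix x :: "'p \<times> 'p + 'q \<times> 'p"
    have "transpose Y ** (Y ** skew_unit i j) = skew_unit i j" "transpose Yp ** (Y ** skew_unit i j) = 0"
      "transpose Y ** (Yp ** matrix_unit k l) = 0" "transpose Yp ** (Yp ** matrix_unit k l) = matrix_unit k l"
      for i j l :: 'p and k :: 'q
      using comp[of "skew_unit i j" 0] comp[of 0 "matrix_unit k l"] by (simp_all add: matrix_mult_bilinear)
    then show "?\<phi> x (?F (?e x)) = case_sum
      (\<lambda>(i, j). curvature_A \<alpha> A1 (skew_unit i j) A3 B1 0 B3 $ i $ j)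
      (\<lambda>(k, l). curvature_B \<alpha> A1 0 A3 B1 (matrix_unit k l) B3 $ k $ l) x"
      by (auto split: sum.split simp: comp)
  qed
  also have "\<dots> = ((2 - real CARD('p)) / 4 - real CARD('q) * \<alpha>\<^sup>2) * trace (A1 ** A3)
    + ((1 - real CARD('p)) * \<alpha> + (real CARD('p) + real CARD('q) - 2)) * trace (transpose B1 ** B3)"
    unfolding sum_frame_index ricci_trace_skew[OF A] ricci_trace_horizontal
    by (simp add: field_simps)
  finally show ?thesis .
qed

section \<open>Sectional curvature\<close>

lemma trace_rotate: "trace (P ** Q ** R ** S) = trace (Q ** R ** S ** (P :: real^'a^'b))"
  using trace_mul_sym[of P "Q ** R ** S"] by (simp add: matrix_mul_assoc)

lemma trace_reverse:
  "trace (P ** Q ** R ** S) = trace (transpose S ** transpose R ** transpose Q ** transpose (P :: real^'a^'b))"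
  using trace_transpose[of "P ** Q ** R ** S"] by (simp add: matrix_transpose_mul matrix_mul_assoc)

text \<open>Cyclic permutation and transposition identify the words occurring in the curvature;
  one representative per class is kept.\<close>

lemma trace_words:
  fixes A1 A2 :: "real^'p^'p" and B1 B2 :: "real^'p^'q"
  assumes A: "transpose A1 = - A1" "transpose A2 = - A2"
  shows
    "trace (A2 ** A1 ** A2 ** A1) = trace (A1 ** A2 ** A1 ** A2)"
    "trace (A2 ** A1 ** A1 ** A2) = trace (A1 ** A1 ** A2 ** A2)"
    "trace (A1 ** A2 ** A2 ** A1) = trace (A1 ** A1 ** A2 ** A2)"
    "trace (A2 ** A2 ** A1 ** A1) = trace (A1 ** A1 ** A2 ** A2)"
    "trace (transpose B1 ** B1 ** transpose B2 ** B2) = trace (transpose B2 ** B2 ** transpose B1 ** B1)"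
    "trace (transpose B1 ** B2 ** transpose B2 ** B1) = trace (transpose B2 ** B1 ** transpose B1 ** B2)"
    "trace (transpose B1 ** B2 ** transpose B1 ** B2) = trace (transpose B2 ** B1 ** transpose B2 ** B1)"
    "trace (B1 ** transpose B2 ** B2 ** transpose B1) = trace (transpose B2 ** B2 ** transpose B1 ** B1)"
    "trace (B2 ** transpose B1 ** B1 ** transpose B2) = trace (transpose B2 ** B2 ** transpose B1 ** B1)"
    "trace (B1 ** transpose B2 ** B1 ** transpose B2) = trace (transpose B2 ** B1 ** transpose B2 ** B1)"
    "trace (B2 ** transpose B1 ** B2 ** transpose B1) = trace (transpose B2 ** B1 ** transpose B2 ** B1)"
proof -
  show "trace (A2 ** A1 ** A2 ** A1) = trace (A1 ** A2 ** A1 ** A2)" by (rule trace_rotate)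
  show 1: "trace (A2 ** A1 ** A1 ** A2) = trace (A1 ** A1 ** A2 ** A2)" by (rule trace_rotate)
  show "trace (A1 ** A2 ** A2 ** A1) = trace (A1 ** A1 ** A2 ** A2)" by (rule trace_rotate[symmetric])
  show "trace (A2 ** A2 ** A1 ** A1) = trace (A1 ** A1 ** A2 ** A2)"
    using trace_rotate[of A2 A2 A1 A1] 1 by simp
  show 2: "trace (transpose B1 ** B1 ** transpose B2 ** B2) = trace (transpose B2 ** B2 ** transpose B1 ** B1)"
    using trace_rotate[of "transpose B1" B1 "transpose B2" B2] trace_rotate[of B1 "transpose B2" B2 "transpose B1"] by simp
  show "trace (transpose B1 ** B2 ** transpose B2 ** B1) = trace (transpose B2 ** B1 ** transpose B1 ** B2)"
    using trace_rotate[of "transpose B1" B2 "transpose B2" B1] trace_rotate[of B2 "transpose B2" B1 "transpose B1"] by simp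
  show 3: "trace (transpose B1 ** B2 ** transpose B1 ** B2) = trace (transpose B2 ** B1 ** transpose B2 ** B1)"
    using trace_reverse[of "transpose B1" B2 "transpose B1" B2] by simp
  show "trace (B1 ** transpose B2 ** B2 ** transpose B1) = trace (transpose B2 ** B2 ** transpose B1 ** B1)"
    by (rule trace_rotate)
  show "trace (B2 ** transpose B1 ** B1 ** transpose B2) = trace (transpose B2 ** B2 ** transpose B1 ** B1)"
    using trace_rotate[of B2 "transpose B1" B1 "transpose B2"] 2 by simp
  show "trace (B1 ** transpose B2 ** B1 ** transpose B2) = trace (transpose B2 ** B1 ** transpose B2 ** B1)"
    by (rule trace_rotate)
  show "trace (B2 ** transpose B1 ** B2 ** transpose B1) = trace (transpose B2 ** B1 ** transpose B2 ** B1)"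
    using trace_rotate[of B2 "transpose B1" B2 "transpose B1"] 3 by simp
qed

text \<open>Two rotations bring both antisymmetric letters to the front. The third identity is a
  transposition, whose two signs cancel; it is later instantiated so as to put \<open>A1\<close>
  before \<open>A2\<close>.\<close>

lemma trace_mixed_words:
  fixes A C :: "real^'p^'p" and B D :: "real^'p^'q"
  shows "trace (A ** transpose B ** D ** C) = trace (C ** A ** transpose B ** D)"
    "trace (transpose B ** D ** A ** C) = trace (A ** C ** transpose B ** D)"
    "transpose A = - A \<Longrightarrow> transpose C = - C \<Longrightarrow>
      trace (A ** C ** transpose B ** D) = trace (C ** A ** transpose D ** B)"
proof -
  show "trace (A ** transpose B ** D ** C) = trace (C ** A ** transpose B ** D)"
    by (rule trace_rotate[symmetric])
  have 1: "trace (transpose B ** D ** A ** C) = trace (A ** C ** transpose B ** D)"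
    for A C :: "real^'p^'p" and B D :: "real^'p^'q"
    using trace_rotate[of "transpose B" D A C] trace_rotate[of D A C "transpose B"] by simp
  show "trace (transpose B ** D ** A ** C) = trace (A ** C ** transpose B ** D)" by (rule 1)
  assume "transpose A = - A" "transpose C = - C"
  then show "trace (A ** C ** transpose B ** D) = trace (C ** A ** transpose D ** B)"
    using trace_reverse[of A C "transpose B" D] 1[of D B C A] by (simp add: matrix_mult_bilinear)
qed

lemma sectional_numerator_trace:
  fixes A1 A2 :: "real^'p^'p" and B1 B2 :: "real^'p^'q"
  assumes A: "transpose A1 = - A1" "transpose A2 = - A2"
  shows "\<alpha> * (curvature_A \<alpha> A1 A2 A1 B1 B2 B1 \<bullet> A2) + curvature_B \<alpha> A1 A2 A1 B1 B2 B1 \<bullet> B2 =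
        trace (((2 - 3*\<alpha>) / 2) *\<^sub>R (transpose B2 ** B1 ** transpose B1 ** B2)
               + ((3*\<alpha> - 4) / 2) *\<^sub>R (transpose B2 ** B1 ** transpose B2 ** B1)
               + transpose B2 ** B2 ** transpose B1 ** B1
               - (\<alpha> / 4) *\<^sub>R (commutator A1 A2 ** commutator A1 A2))
        + \<alpha> * trace ((4*\<alpha> - 3) *\<^sub>R (A1 ** A2 ** transpose B2 ** B1)
                   + (3 - 2*\<alpha>) *\<^sub>R (A1 ** A2 ** transpose B1 ** B2)
                   - \<alpha> *\<^sub>R (A2 ** A2 ** transpose B1 ** B1)
                   - \<alpha> *\<^sub>R (A1 ** A1 ** transpose B2 ** B2))"
  unfolding curvature_A_def curvature_B_def commutator_def
  by (simp only: inner_matrix_eq_trace matrix_expand A trace_add trace_sub trace_scaleR trace_minus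
      minus_minus)
     (simp add: trace_words[OF A]
      trace_mixed_words(1,2)[where A = A1 and C = A2] trace_mixed_words(1,2)[where A = A2 and C = A1]
      trace_mixed_words(1,2)[where A = A1 and C = A1] trace_mixed_words(1,2)[where A = A2 and C = A2]
      trace_mixed_words(3)[OF A(2,1)], simp add: field_simps power2_eq_square)

text \<open>With \<open>S = transpose B2 ** B1 - transpose B1 ** B2\<close>, the word
  \<open>A1 ** A2 ** transpose B2 ** B1\<close> receives a contribution only from the square with
  the commutator, which forces \<open>3 - 4*\<alpha>\<close>. Once the norm of
  \<open>B1 ** transpose B2 - B2 ** transpose B1\<close> is split off, the pure \<open>B\<close>
  words amount to \<open>(2 - 3*\<alpha>) / 4\<close> times the squared norm of \<open>S\<close>.
  Completing the square uses \<open>\<alpha> * (3 - 4*\<alpha>)\<^sup>2 / 4\<close> of it and leaves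
  \<open>(1 - 2*\<alpha>)^3 / 2\<close>.\<close>

lemma sectional_numerator_norms:
  fixes A1 A2 :: "real^'p^'p" and B1 B2 :: "real^'p^'q"
  assumes A: "transpose A1 = - A1" "transpose A2 = - A2"
  shows "\<alpha> * (curvature_A \<alpha> A1 A2 A1 B1 B2 B1 \<bullet> A2) + curvature_B \<alpha> A1 A2 A1 B1 B2 B1 \<bullet> B2 =
        \<alpha> / 4 * (norm (commutator A1 A2
                     + (3 - 4*\<alpha>) *\<^sub>R (transpose B2 ** B1 - transpose B1 ** B2)))\<^sup>2
        + \<alpha>\<^sup>2 * (norm (B1 ** A2 - B2 ** A1))\<^sup>2
        + 1/2 * (norm (B1 ** transpose B2 - B2 ** transpose B1))\<^sup>2
        + (1 - 2*\<alpha>)^3 / 2 * (norm (transpose B2 ** B1 - transpose B1 ** B2))\<^sup>2"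
  unfolding sectional_numerator_trace[OF A] norm_matrix_sq commutator_def
  by (simp only: matrix_expand A trace_add trace_sub trace_scaleR trace_minus minus_minus)
     (simp add: trace_words[OF A]
      trace_mixed_words(1,2)[where A = A1 and C = A2] trace_mixed_words(1,2)[where A = A2 and C = A1]
      trace_mixed_words(1,2)[where A = A1 and C = A1] trace_mixed_words(1,2)[where A = A2 and C = A2]
      trace_mixed_words(3)[OF A(2,1)], simp add: field_simps power2_eq_square power3_eq_cube)

text \<open>The factor \<open>\<alpha>0\<close> is kept because non-negativity is claimed for every
  \<open>\<alpha>0\<close>, unlike the explicit formulas.\<close>

lemma stiefel_sectional_numerator:
  fixes A1 A2 :: "real^'p^'p" and B1 B2 :: "real^'p^'q" and Y :: "real^'p^'n" and Yp :: "real^'q^'n"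
  assumes pos: "\<alpha>0 > 0" "\<alpha>1 > 0" and Y: "Y \<in> stiefel" and Yp: "orth_complement Y Yp"
    and A: "transpose A1 = - A1" "transpose A2 = - A2" and \<alpha>: "\<alpha> = \<alpha>1 / \<alpha>0"
  shows "sectional_numerator stiefel (stiefel_metric \<alpha>0 \<alpha>1) Y (Y ** A1 + Yp ** B1) (Y ** A2 + Yp ** B2) =
    \<alpha>0 * (\<alpha> * (curvature_A \<alpha> A1 A2 A1 B1 B2 B1 \<bullet> A2) + curvature_B \<alpha> A1 A2 A1 B1 B2 B1 \<bullet> B2)"
  unfolding sectional_numerator_def stiefel_riemann_curvature[OF pos Y Yp A(1,2,1) \<alpha>]
    stiefel_metric_frame[OF Y Yp]
  using pos by (simp add: \<alpha> distrib_left)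

lemma stiefel_wedge_norm_nonneg:
  fixes A1 A2 :: "real^'p^'p" and B1 B2 :: "real^'p^'q" and Y :: "real^'p^'n" and Yp :: "real^'q^'n"
  assumes pos: "\<alpha>0 > 0" "\<alpha>1 > 0" and Y: "Y \<in> stiefel" and Yp: "orth_complement Y Yp"
  shows "wedge_norm_sq (stiefel_metric \<alpha>0 \<alpha>1) Y (Y ** A1 + Yp ** B1) (Y ** A2 + Yp ** B2) \<ge> 0"
proof -
  \<comment> \<open>Rescaling the blocks by square roots of the weights turns the metric into a
    Euclidean product of pairs, to which Cauchy-Schwarz applies.\<close>
  have g: "stiefel_metric \<alpha>0 \<alpha>1 Y (Y ** A + Yp ** B) (Y ** C + Yp ** D) =
      (sqrt \<alpha>1 *\<^sub>R A, sqrt \<alpha>0 *\<^sub>R B) \<bullet> (sqrt \<alpha>1 *\<^sub>R C, sqrt \<alpha>0 *\<^sub>R D)"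
    for A C :: "real^'p^'p" and B D :: "real^'p^'q"
    using pos by (simp add: stiefel_metric_frame[OF Y Yp] mult.assoc[symmetric])
  show ?thesis unfolding wedge_norm_sq_def g by (simp only: diff_ge_0_iff_ge Cauchy_Schwarz_ineq)
qed

section \<open>Scalar curvature\<close>

lemma inner_matrix_unit: "A \<bullet> matrix_unit i j = A $ i $ j"
proof -
  have "A \<bullet> matrix_unit i j = (\<Sum>k\<in>UNIV. \<Sum>l\<in>UNIV. if k = i then if l = j then A $ k $ l else 0 else 0)"
    by (simp add: inner_vec_def matrix_unit_def) (intro sum.cong, auto)
  also have "\<dots> = (\<Sum>k\<in>UNIV. if k = i then \<Sum>l\<in>UNIV. if l = j then A $ k $ l else 0 else 0)"
    by (intro sum.cong) auto
  finally show ?thesis by simp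
qed

lemma inner_skew_unit:
  assumes "transpose A = - A"
  shows "A \<bullet> skew_unit i j = A $ i $ j"
proof -
  have "transpose A $ i $ j = - A $ i $ j" by (simp add: assms)
  then have "A $ j $ i = - A $ i $ j" by (simp add: transpose_def)
  then show ?thesis by (simp add: skew_unit_def inner_diff_right inner_matrix_unit)
qed

text \<open>Scaling the block along \<open>Y\<close> by \<open>1 / sqrt \<alpha>\<close> maps the
  Euclidean product to the metric and preserves the tangent space, so it carries a Euclidean
  orthonormal basis to a metric one.\<close>

lemma stiefel_metric_orthonormal_basis:
  fixes Y :: "real^'p^'n"
  assumes Y: "Y \<in> stiefel" and pos: "\<alpha> > 0"
  shows "\<exists>E. independent E \<and> span E = tangent_space stiefel Y \<and>
    (\<forall>a\<in>E. \<forall>b\<in>E. stiefel_metric 1 \<alpha> Y a b = (if a = b then 1 else 0))"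
proof -
  let ?T = "tangent_space stiefel Y"
  \<comment> \<open>Pulls the metric back to the Euclidean inner product.\<close>
  let ?N = "\<lambda>s (v :: real^'p^'n). v + (s - 1) *\<^sub>R (Y ** (transpose Y ** v))"
  let ?s = "1 / sqrt \<alpha>"
  have lin: "linear (?N s)" for s
    by (simp add: linear_iff matrix_mult_bilinear algebra_simps)
  have YN: "transpose Y ** ?N s v = s *\<^sub>R (transpose Y ** v)" for s v
    by (simp add: matrix_mult_bilinear stiefel_cancel[OF Y] algebra_simps)
  have N_inv: "?N ?s (?N (sqrt \<alpha>) v) = v" for v
    unfolding YN using pos by (simp add: matrix_mult_bilinear algebra_simps)
  have N_T: "?N s v \<in> ?T" if "v \<in> ?T" for s v
    using that by (simp add: stiefel_tangent_iff[OF Y] matrix_expand stiefel_cancel[OF Y]) 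
  have isometry: "stiefel_metric 1 \<alpha> Y (?N ?s a) (?N ?s b) = a \<bullet> b" for a b
  proof -
    have "?N ?s a \<bullet> ?N ?s b = a \<bullet> b + (?s\<^sup>2 - 1) * ((transpose Y ** a) \<bullet> (transpose Y ** b))"
      by (simp add: inner_add_left inner_add_right inner_matrix_mult_left stiefel_cancel[OF Y]
          inner_commute[of a "Y ** _"] inner_commute[of "transpose Y ** b"] power2_eq_square algebra_simps)
    moreover have "?s\<^sup>2 = 1 / \<alpha>" using pos by (simp add: power_divide)
    ultimately show ?thesis
      unfolding stiefel_metric_eq_inner YN using pos
      by (simp add: power2_eq_square[symmetric] field_simps)
  qed
  have sub: "subspace ?T"
    by (rule embedded_connection.subspace_tangent_space[OF embedded_connection_stiefel[OF zero_less_one pos] Y])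
  obtain B where B: "B \<subseteq> ?T" "pairwise orthogonal B" "\<And>x. x \<in> B \<Longrightarrow> norm x = 1"
    "independent B" "span B = ?T"
    using orthonormal_basis_subspace[OF sub] by metis
  have inj: "inj (?N ?s)"
  proof (rule injI)
    fix a b assume "?N ?s a = ?N ?s b"
    then have "?N ?s (a - b) = 0" by (simp add: linear_diff[OF lin])
    then have "(a - b) \<bullet> (a - b) = 0"
      using isometry[of "a - b" "a - b"] by (simp add: stiefel_metric_eq_inner matrix_mult_bilinear)
    then show "a = b" by simp
  qed
  let ?E = "?N ?s ` B"
  have "independent ?E"
    using linear_independent_injective_image[OF lin B(4)] inj by (simp add: inj_on_subset)
  moreover have "span ?E = ?T"
  proof -
    have "span ?E = ?N ?s ` ?T" using linear_span_image[OF lin] B(5) by metis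
    also have "\<dots> = ?T"
    proof (intro set_eqI iffI)
      fix v assume "v \<in> ?T"
      then have "?N (sqrt \<alpha>) v \<in> ?T" by (rule N_T)
      then show "v \<in> ?N ?s ` ?T" using N_inv[of v] by (intro image_eqI[of v "?N ?s" "?N (sqrt \<alpha>) v"]) simp_all
    qed (use N_T in blast)
    finally show ?thesis .
  qed
  moreover have "stiefel_metric 1 \<alpha> Y a b = (if a = b then 1 else 0)" if "a \<in> ?E" "b \<in> ?E" for a b
  proof -
    from that(1) obtain x where x: "a = ?N ?s x" "x \<in> B" by (rule imageE)
    from that(2) obtain y where y: "b = ?N ?s y" "y \<in> B" by (rule imageE)
    have "stiefel_metric 1 \<alpha> Y a b = x \<bullet> y" unfolding x(1) y(1) by (rule isometry)
    also have "\<dots> = (if x = y then 1 else 0)"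
      using B(2,3) x(2) y(2) by (auto simp: pairwise_def orthogonal_def norm_eq_1)
    also have "x = y \<longleftrightarrow> a = b" unfolding x(1) y(1) by (rule inj_eq[OF inj, symmetric])
    finally show ?thesis .
  qed
  ultimately show ?thesis by blast
qed

theorem stiefel_scalar_curvature:
  fixes Y :: "real^'p^'n" and Yp :: "real^'q^'n"
  assumes pos: "\<alpha> > 0" and Y: "Y \<in> stiefel" and Yp: "orth_complement Y Yp"
  shows "scalar_curvature stiefel (stiefel_metric 1 \<alpha>) Y =
    ((1 - real CARD('p)) * \<alpha> + (real CARD('p) + real CARD('q) - 2)) * real CARD('q) * real CARD('p)
    + (real CARD('q) * \<alpha> + (real CARD('p) - 2) / (4 * \<alpha>)) * (real CARD('p) * (real CARD('p) - 1) / 2)"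
proof -
  let ?T = "tangent_space stiefel Y"
  define c1 where "c1 = (2 - real CARD('p)) / 4 - real CARD('q) * \<alpha>\<^sup>2"
  define c2 where "c2 = (1 - real CARD('p)) * \<alpha> + (real CARD('p) + real CARD('q) - 2)"
  \<comment> \<open>The transpose in the second summand turns the inner product into
    \<open>trace (A1 ** A2)\<close> of the two blocks, the form found in the Ricci
    curvature.\<close>
  let ?H = "\<lambda>u v. c2 * ((transpose Yp ** u) \<bullet> (transpose Yp ** v)) + c1 * (transpose (transpose Y ** u) \<bullet> (transpose Y ** v))"
  let ?e = "case_sum (\<lambda>(i, j). Y ** skew_unit i j) (\<lambda>(k, l). Yp ** matrix_unit k l)"
  \<comment> \<open>The metric weights the block along \<open>Y\<close> by \<open>\<alpha>\<close>;
    dividing by it makes the product with \<open>?d\<close> return the plain coefficients.\<close>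
  let ?d = "case_sum (\<lambda>(i, j). (1 / \<alpha>) *\<^sub>R (Y ** skew_unit i j)) (\<lambda>(k, l). Yp ** matrix_unit k l)"
  note tangent = stiefel_tangent_frame[OF Y Yp] and dec = tangent_frame_decomposition[OF Y Yp]
    and comp = frame_components[OF Y Yp]
  have "scalar_curvature stiefel (stiefel_metric 1 \<alpha>) Y = (\<Sum>x\<in>UNIV. ?H (?e x) (?d x))"
    unfolding scalar_curvature_def
  proof (rule metric_trace_on_frame[where H = ?H and e = ?e and d = ?d])
    show "bounded_bilinear (stiefel_metric 1 \<alpha> Y)" by (rule bounded_bilinear_stiefel_metric)
    show "bounded_bilinear ?H"
      unfolding bilinear_conv_bounded_bilinear[symmetric] bilinear_def linear_iff
      by (simp add: matrix_mult_bilinear transpose_add transpose_scaleR inner_simps algebra_simps)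
    show "\<exists>E. independent E \<and> span E = ?T \<and>
        (\<forall>a\<in>E. \<forall>b\<in>E. stiefel_metric 1 \<alpha> Y a b = (if a = b then 1 else 0))"
      by (rule stiefel_metric_orthonormal_basis[OF Y pos])
    show "ricci_curvature stiefel (stiefel_metric 1 \<alpha>) Y u v = ?H u v" if u: "u \<in> ?T" and v: "v \<in> ?T" for u v
    proof -
      have "ricci_curvature stiefel (stiefel_metric 1 \<alpha>) Y
          (Y ** (transpose Y ** u) + Yp ** (transpose Yp ** u)) (Y ** (transpose Y ** v) + Yp ** (transpose Yp ** v))
        = c1 * trace ((transpose Y ** u) ** (transpose Y ** v))
          + c2 * trace (transpose (transpose Yp ** u) ** (transpose Yp ** v))"
        unfolding c1_def c2_def
        by (rule stiefel_ricci_curvature[OF zero_less_one pos Y Yp dec(2)[OF u] dec(2)[OF v]]) simp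
      then show ?thesis
        unfolding dec(1)[OF u, symmetric] dec(1)[OF v, symmetric]
        by (simp add: inner_matrix_eq_trace)
    qed
    show "?d x \<in> ?T" for x
    proof -
      have "Y ** ((1 / \<alpha>) *\<^sub>R skew_unit i j) + Yp ** 0 \<in> ?T" for i j
        by (rule tangent) (simp add: transpose_scaleR transpose_skew_unit)
      moreover have "Y ** 0 + Yp ** matrix_unit k l \<in> ?T" for k l
        by (rule tangent) (simp add: transpose_zero)
      ultimately show ?thesis by (auto split: sum.split simp: matrix_mult_bilinear)
    qed
    show "v = (\<Sum>x\<in>UNIV. stiefel_metric 1 \<alpha> Y v (?d x) *\<^sub>R ?e x)" if v: "v \<in> ?T" for v
    proof -
      have m: "stiefel_metric 1 \<alpha> Y v (Y ** C + Yp ** D) =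
          \<alpha> * ((transpose Y ** v) \<bullet> C) + (transpose Yp ** v) \<bullet> D" for C D
        by (subst (1) dec(1)[OF v]) (simp add: stiefel_metric_frame[OF Y Yp])
      have skew: "stiefel_metric 1 \<alpha> Y v ((1 / \<alpha>) *\<^sub>R (Y ** skew_unit i j)) = (transpose Y ** v) $ i $ j" for i j
        using m[of "(1 / \<alpha>) *\<^sub>R skew_unit i j" 0] pos
        by (simp add: matrix_mult_bilinear inner_skew_unit[OF dec(2)[OF v]])
      have unit: "stiefel_metric 1 \<alpha> Y v (Yp ** matrix_unit k l) = (transpose Yp ** v) $ k $ l" for k l
        using m[of 0 "matrix_unit k l"] by (simp add: matrix_mult_bilinear inner_matrix_unit)
      have "(\<Sum>x\<in>UNIV. stiefel_metric 1 \<alpha> Y v (?d x) *\<^sub>R ?e x) = (\<Sum>x\<in>UNIV. case_sum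
          (\<lambda>(i, j). (transpose Y ** v) $ i $ j *\<^sub>R (Y ** skew_unit i j))
          (\<lambda>(k, l). (transpose Yp ** v) $ k $ l *\<^sub>R (Yp ** matrix_unit k l)) x)"
        by (rule sum.cong) (auto split: sum.split simp: skew unit)
      also have "\<dots> = v" by (rule tangent_frame_expansion[OF Y Yp v])
      finally show ?thesis by simp
    qed
  qed
  \<comment> \<open>The minus sign comes from transposing an antisymmetric unit. The factors
    \<open>mat 1\<close> give the shape that \<open>sum_skew_unit_mult\<close> expects, which counts
    the dimension \<open>p * (p - 1) / 2\<close> of the antisymmetric matrices.\<close>
  also have "\<dots> = (\<Sum>x\<in>UNIV. case_sum
      (\<lambda>(i, j). (- c1 / \<alpha>) * (mat 1 ** skew_unit i j ** mat 1 :: real^'p^'p) $ i $ j)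
      (\<lambda>(k :: 'q, l :: 'p). c2) x :: real)"
  proof (rule sum.cong[OF refl])
    fix x :: "'p \<times> 'p + 'q \<times> 'p"
    have c: "transpose Y ** (Y ** skew_unit i j) = skew_unit i j" "transpose Yp ** (Y ** skew_unit i j) = 0"
      "transpose Y ** (Yp ** matrix_unit k l) = 0" "transpose Yp ** (Yp ** matrix_unit k l) = matrix_unit k l"
      for i j l :: 'p and k :: 'q
      using comp[of "skew_unit i j" 0] comp[of 0 "matrix_unit k l"] by (simp_all add: matrix_mult_bilinear)
    have "matrix_unit k l \<bullet> (matrix_unit k l :: real^'p^'q) = 1" for k l
      by (simp add: inner_matrix_unit) (simp add: matrix_unit_def)
    then show "?H (?e x) (?d x) = case_sum
      (\<lambda>(i, j). (- c1 / \<alpha>) * (mat 1 ** skew_unit i j ** mat 1 :: real^'p^'p) $ i $ j)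
      (\<lambda>(k :: 'q, l :: 'p). c2) x"
      by (auto split: sum.split simp: c matrix_mult_bilinear transpose_skew_unit inner_skew_unit[OF transpose_skew_unit]
          transpose_zero)
  qed
  also have "\<dots> = c2 * (real CARD('q) * real CARD('p)) - c1 / \<alpha> * ((real CARD('p) * real CARD('p) - real CARD('p)) / 2)"
    unfolding sum_frame_index sum_distrib_left[symmetric] sum_skew_unit_mult
    by (simp add: trace_I)
  also have "\<dots> = ((1 - real CARD('p)) * \<alpha> + (real CARD('p) + real CARD('q) - 2)) * real CARD('q) * real CARD('p)
    + (real CARD('q) * \<alpha> + (real CARD('p) - 2) / (4 * \<alpha>)) * (real CARD('p) * (real CARD('p) - 1) / 2)"
    unfolding c1_def c2_def using pos by (simp add: field_simps power2_eq_square)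
  finally show ?thesis .
qed

theorem theorem3p1:
  fixes \<alpha>0 \<alpha>1 \<alpha> n p :: real
    and Y :: "real^'p^'n" and Yp :: "real^'q^'n"
    and A1 A2 A3 :: "real^'p^'p" and B1 B2 B3 :: "real^'p^'q"
    and \<xi> \<eta> \<phi> :: "real^'p^'n"
    and g :: "real^'p^'n \<Rightarrow> real^'p^'n \<Rightarrow> real^'p^'n \<Rightarrow> real"
  assumes p_less_n: "CARD('p) < CARD('n)"
    and card_q: "CARD('q) = CARD('n) - CARD('p)"
    and n: "n = real CARD('n)" and p: "p = real CARD('p)"
    and pos: "\<alpha>0 > 0" "\<alpha>1 > 0"
    and alpha: "\<alpha> = \<alpha>1 / \<alpha>0"
    and g: "g = stiefel_metric \<alpha>0 \<alpha>1"
    and Y: "Y \<in> stiefel" and Yp: "orth_complement Y Yp"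
    and A: "antisymmetric A1" "antisymmetric A2" "antisymmetric A3"
    and xi: "\<xi> = Y ** A1 + Yp ** B1"
    and eta: "\<eta> = Y ** A2 + Yp ** B2"
    and phi: "\<phi> = Y ** A3 + Yp ** B3"
  shows
    "(let A\<^sub>R =
           ((1 - 2*\<alpha>) / 4) *\<^sub>R
             (A1 ** transpose B3 ** B2 - A2 ** transpose B3 ** B1
              - transpose B1 ** B3 ** A2 + transpose B2 ** B3 ** A1)
           + ((1 - \<alpha>) / 2) *\<^sub>R
             (A3 ** transpose B1 ** B2 - A3 ** transpose B2 ** B1
              - transpose B1 ** B2 ** A3 + transpose B2 ** B1 ** A3)
           + (1/4) *\<^sub>R
             (commutator (commutator A1 A2) A3
              - A1 ** transpose B2 ** B3 + A2 ** transpose B1 ** B3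
              + transpose B3 ** B1 ** A2 - transpose B3 ** B2 ** A1);
         B\<^sub>R =
           ((2*\<alpha>\<^sup>2 - \<alpha>) / 2) *\<^sub>R (B1 ** A3 ** A2 - B2 ** A3 ** A1)
           + (\<alpha>\<^sup>2 - \<alpha>) *\<^sub>R (B3 ** A1 ** A2 - B3 ** A2 ** A1)
           + (1 - \<alpha>) *\<^sub>R (B3 ** transpose B1 ** B2 - B3 ** transpose B2 ** B1)
           + ((\<alpha> - 2) / 2) *\<^sub>R (B1 ** transpose B2 ** B3 - B2 ** transpose B1 ** B3)
           + (\<alpha> / 2) *\<^sub>R
             (B1 ** A2 ** A3 - B1 ** transpose B3 ** B2
              - B2 ** A1 ** A3 + B2 ** transpose B3 ** B1)
     in antisymmetric A\<^sub>R \<and>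
        riemann_curvature stiefel g Y \<xi> \<eta> \<phi> = Y ** A\<^sub>R + Yp ** B\<^sub>R) \<and>

     (p > 1 \<longrightarrow>
      ricci_curvature stiefel g Y \<xi> \<eta> =
        ((2 - p) / 4 + (p - n) * \<alpha>\<^sup>2) * trace (A1 ** A2)
        + ((1 - p) * \<alpha> + (n - 2)) * trace (transpose B1 ** B2)) \<and>

     (p > 1 \<longrightarrow> \<alpha>0 = 1 \<longrightarrow>
      scalar_curvature stiefel g Y =
        ((1 - p) * \<alpha> + n - 2) * (n - p) * p
        + ((n - p) * \<alpha> + (p - 2) / (4 * \<alpha>)) * (p * (p - 1) / 2)) \<and>

     (\<alpha>0 = 1 \<longrightarrow>
      sectional_numerator stiefel g Y \<xi> \<eta> =
        trace (((2 - 3*\<alpha>) / 2) *\<^sub>R (transpose B2 ** B1 ** transpose B1 ** B2)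
               + ((3*\<alpha> - 4) / 2) *\<^sub>R (transpose B2 ** B1 ** transpose B2 ** B1)
               + transpose B2 ** B2 ** transpose B1 ** B1
               - (\<alpha> / 4) *\<^sub>R (commutator A1 A2 ** commutator A1 A2))
        + \<alpha> * trace ((4*\<alpha> - 3) *\<^sub>R (A1 ** A2 ** transpose B2 ** B1)
                   + (3 - 2*\<alpha>) *\<^sub>R (A1 ** A2 ** transpose B1 ** B2)
                   - \<alpha> *\<^sub>R (A2 ** A2 ** transpose B1 ** B1)
                   - \<alpha> *\<^sub>R (A1 ** A1 ** transpose B2 ** B2))) \<and>

     (\<alpha>0 = 1 \<longrightarrow>
      sectional_numerator stiefel g Y \<xi> \<eta> =
        \<alpha> / 4 * (norm (commutator A1 A2
                     + (3 - 4*\<alpha>) *\<^sub>R (transpose B2 ** B1 - transpose B1 ** B2)))\<^sup>2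
        + \<alpha>\<^sup>2 * (norm (B1 ** A2 - B2 ** A1))\<^sup>2
        + 1/2 * (norm (B1 ** transpose B2 - B2 ** transpose B1))\<^sup>2
        + (1 - 2*\<alpha>)^3 / 2 * (norm (transpose B2 ** B1 - transpose B1 ** B2))\<^sup>2) \<and>

     (\<alpha> \<le> 1/2 \<longrightarrow> \<xi> \<noteq> \<eta> \<longrightarrow> independent {\<xi>, \<eta>} \<longrightarrow>
      sectional_curvature stiefel g Y \<xi> \<eta> \<ge> 0) \<and>

     (g Y \<xi> \<eta> = 0 \<longrightarrow>
      wedge_norm_sq g Y \<xi> \<eta> =
        (\<alpha>1 * trace (A1 ** transpose A1) + \<alpha>0 * trace (B1 ** transpose B1))
        * (\<alpha>1 * trace (A2 ** transpose A2) + \<alpha>0 * trace (B2 ** transpose B2)))"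
proof -
  have A': "transpose A1 = - A1" "transpose A2 = - A2" "transpose A3 = - A3"
    using A by (simp_all add: antisymmetric_def)
  \<comment> \<open>\<open>card_q\<close> subtracts natural numbers; \<open>p_less_n\<close> makes
    this agree with real subtraction.\<close>
  have q: "n - p = real CARD('q)" "n = real CARD('p) + real CARD('q)" "p - n = - real CARD('q)"
    using card_q p_less_n by (simp_all add: n p)
  have riemann: "antisymmetric (curvature_A \<alpha> A1 A2 A3 B1 B2 B3) \<and>
      riemann_curvature stiefel g Y \<xi> \<eta> \<phi> =
        Y ** curvature_A \<alpha> A1 A2 A3 B1 B2 B3 + Yp ** curvature_B \<alpha> A1 A2 A3 B1 B2 B3"
    unfolding antisymmetric_def g xi eta phi
    using curvature_A_antisymmetric[OF A'] stiefel_riemann_curvature[OF pos Y Yp A' alpha] by blast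
  have ricci: "ricci_curvature stiefel g Y \<xi> \<eta> =
        ((2 - p) / 4 + (p - n) * \<alpha>\<^sup>2) * trace (A1 ** A2)
        + ((1 - p) * \<alpha> + (n - 2)) * trace (transpose B1 ** B2)"
    unfolding g xi eta stiefel_ricci_curvature[OF pos Y Yp A'(1,2) alpha] q(3)
    by (simp add: q(2) p)
  have scalar: "scalar_curvature stiefel g Y =
        ((1 - p) * \<alpha> + n - 2) * (n - p) * p
        + ((n - p) * \<alpha> + (p - 2) / (4 * \<alpha>)) * (p * (p - 1) / 2)" if "\<alpha>0 = 1"
    using stiefel_scalar_curvature[OF pos(2) Y Yp] alpha that
    unfolding g q(1) by (simp add: q(2) p add_diff_eq)
  note sec = stiefel_sectional_numerator[OF pos Y Yp A'(1,2) alpha, of B1 B2, folded g xi eta]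
  have nonneg: "sectional_curvature stiefel g Y \<xi> \<eta> \<ge> 0" if "\<alpha> \<le> 1/2"
  proof -
    have "sectional_numerator stiefel g Y \<xi> \<eta> \<ge> 0"
      \<comment> \<open>Each of the four squares is non-negative by itself;
        \<open>\<alpha> \<le> 1/2\<close> gives the sign of the cube.\<close>
      unfolding sec sectional_numerator_norms[OF A'(1,2)]
      using pos alpha that by (intro mult_nonneg_nonneg add_nonneg_nonneg) simp_all
    moreover have "wedge_norm_sq g Y \<xi> \<eta> \<ge> 0"
      unfolding g xi eta by (rule stiefel_wedge_norm_nonneg[OF pos Y Yp])
    ultimately show ?thesis by (simp add: sectional_curvature_def)
  qed
  have wedge: "wedge_norm_sq g Y \<xi> \<eta> =
        (\<alpha>1 * trace (A1 ** transpose A1) + \<alpha>0 * trace (B1 ** transpose B1))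
        * (\<alpha>1 * trace (A2 ** transpose A2) + \<alpha>0 * trace (B2 ** transpose B2))" if "g Y \<xi> \<eta> = 0"
    using that unfolding wedge_norm_sq_def g xi eta stiefel_metric_frame[OF Y Yp]
    by (simp add: inner_matrix_eq_trace trace_mul_sym[of A1] trace_mul_sym[of A2]
        trace_mul_sym[of B1] trace_mul_sym[of B2])
  have sec1: "sectional_numerator stiefel g Y \<xi> \<eta> =
      \<alpha> * (curvature_A \<alpha> A1 A2 A1 B1 B2 B1 \<bullet> A2) + curvature_B \<alpha> A1 A2 A1 B1 B2 B1 \<bullet> B2"
    if "\<alpha>0 = 1" using sec that by simp
  show ?thesis
    unfolding Let_def
    by (intro conjI impI ricci scalar nonneg wedge
        riemann[unfolded curvature_A_def curvature_B_def, THEN conjunct1]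
        riemann[unfolded curvature_A_def curvature_B_def, THEN conjunct2]
        sec1[unfolded sectional_numerator_trace[OF A'(1,2)]]
        sec1[unfolded sectional_numerator_norms[OF A'(1,2)]])
qed

end
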